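(* Let $u$ be a Lipschitz semiconcave viscosity solution of $H(x,Du(x))=0$ in $\Omega\subset\mathbb{R}^2$ and let $x_0\in\mathrm{Sing}(u)$. Let $\mathbf{x}$ be a strict singular characteristic from $x_0$ and let $\mathbf{y}$ be any singular characteristic from $x_0$. If $x_0$ is not a critical point with respect to $(H,u)$, i.e. $0\notin H_p(x_0,D^+u(x_0))$, then there exist $\sigma>0$ and a bi-Lipschitz homeomorphism $\phi:[0,\sigma]\to[0,\phi(\sigma)]$ such that $\mathbf{y}(\phi(s))=\mathbf{x}(s)$ for all $s\in[0,\sigma]$.
   Context: Setting: $\Omega\subset\mathbb{R}^2$ is a bounded domain and $H:\Omega\times\mathbb{R}^2\to\mathbb{R}$, $(x,p)\mapsto H(x,p)$, is of class $C^1$ and strictly convex in $p$; $H_p$ denotes the gradient in $p$, and $H_p(x,A)=\{H_p(x,p):p\in A\}$ for a set $A$. Solutions of $H(x,Du(x))=0$ in $\Omega$ are understood in the viscosity sense. A function $u:\Omega\to\mathbb{R}$ is semiconcave (with linear modulus) if there is $C>0$ with $\lambda u(x)+(1-\lambda)u(y)-u(\lambda x+(1-\lambda)y)\le \frac C2\lambda(1-\lambda)|x-y|^2$ for all $\lambda\in[0,1]$ and all $x,y\in\Omega$ such that the segment joining $x$ and $y$ lies in $\Omega$. The superdifferential is $D^+u(x)=\{p:\limsup_{y\to x}\frac{u(y)-u(x)-\langle p,y-x\rangle}{|y-x|}\le 0\}$; for semiconcave $u$ it is a nonempty compact convex set. $\mathrm{Sing}(u)$ is the set of $x\in\Omega$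 such that $D^+u(x)$ is not a singleton. A strict singular characteristic from $x_0\in\mathrm{Sing}(u)$ is a Lipschitz curve $\mathbf{x}:[0,T]\to\Omega$ ($T>0$) with $\mathbf{x}(t)\in\mathrm{Sing}(u)$ for all $t\in[0,T]$ and $\mathbf{x}(0)=x_0$, for which there exists a measurable selection $p(t)\in D^+u(\mathbf{x}(t))$ such that $\dot{\mathbf{x}}(t)=H_p(\mathbf{x}(t),p(t))$ for a.e. $t\in[0,T]$. A singular characteristic from $x_0\in\mathrm{Sing}(u)$ is a Lipschitz arc $\mathbf{y}:[0,\tau]\to\Omega$ ($\tau>0$) such that: (1) $\mathbf{y}(0)=x_0$ and $\mathbf{y}$ is a generalized characteristic, i.e. $\dot{\mathbf{y}}(s)\in\mathrm{co}\,H_p(\mathbf{y}(s),D^+u(\mathbf{y}(s)))$ for a.e. $s\in[0,\tau]$ (co denotes convex hull); (2) $\mathbf{y}(t)\in\mathrm{Sing}(u)$ for all $t\in[0,\tau]$; (3) the right derivative $\dot{\mathbf{y}}^+(0)$ exists and equals $H_p(x_0,p_0)$, where $p_0=\arg\min\{H(x_0,p):p\in D^+u(x_0)\}$; (4) $\lim_{t\to0^+}\operatorname{ess\,sup}_{s\in[0,t]}|\dot{\mathbf{y}}(s)-\dot{\mathbf{y}}^+(0)|=0$. *)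

theory Defs
  imports "HOL-Analysis.Analysis" "HOL-Probability.Essential_Supremum"
begin

text \<open>Only meaningful where \<open>f\<close> is differentiable; there the gradient is unique.\<close>

definition gradient :: "('a::euclidean_space \<Rightarrow> real) \<Rightarrow> 'a \<Rightarrow> 'a" where
  "gradient f x = (THE D. GDERIV f x :> D)"

text \<open>Intended for open \<open>S\<close>.\<close>

definition C1_on :: "'a::euclidean_space set \<Rightarrow> ('a \<Rightarrow> real) \<Rightarrow> bool" where
  "C1_on S f \<longleftrightarrow> (\<exists>g. (\<forall>x\<in>S. GDERIV f x :> g x) \<and> continuous_on S g)"

definition strictly_convex_on :: "'a::euclidean_space set \<Rightarrow> ('a \<Rightarrow> real) \<Rightarrow> bool" where
  "strictly_convex_on S f \<longleftrightarrow> convex S \<and>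
     (\<forall>x\<in>S. \<forall>y\<in>S. \<forall>u>0. \<forall>v>0. x \<noteq> y \<longrightarrow> u + v = 1 \<longrightarrow>
        f (u *\<^sub>R x + v *\<^sub>R y) < u * f x + v * f y)"

text \<open>$H_p$\<close>

definition grad_p :: "('a::euclidean_space \<Rightarrow> 'a \<Rightarrow> real) \<Rightarrow> 'a \<Rightarrow> 'a \<Rightarrow> 'a" where
  "grad_p H x p = gradient (H x) p"

definition viscosity_subsolution ::
    "'a::euclidean_space set \<Rightarrow> ('a \<Rightarrow> 'a \<Rightarrow> real) \<Rightarrow> ('a \<Rightarrow> real) \<Rightarrow> bool" where
  "viscosity_subsolution \<Omega> H u \<longleftrightarrow> continuous_on \<Omega> u \<and>
     (\<forall>\<phi> x. C1_on \<Omega> \<phi> \<longrightarrow> x \<in> \<Omega> \<longrightarrow>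
        (\<forall>\<^sub>F y in at x within \<Omega>. u y - \<phi> y \<le> u x - \<phi> x) \<longrightarrow> H x (gradient \<phi> x) \<le> 0)"

definition viscosity_supersolution ::
    "'a::euclidean_space set \<Rightarrow> ('a \<Rightarrow> 'a \<Rightarrow> real) \<Rightarrow> ('a \<Rightarrow> real) \<Rightarrow> bool" where
  "viscosity_supersolution \<Omega> H u \<longleftrightarrow> continuous_on \<Omega> u \<and>
     (\<forall>\<phi> x. C1_on \<Omega> \<phi> \<longrightarrow> x \<in> \<Omega> \<longrightarrow>
        (\<forall>\<^sub>F y in at x within \<Omega>. u y - \<phi> y \<ge> u x - \<phi> x) \<longrightarrow> H x (gradient \<phi> x) \<ge> 0)"

definition viscosity_solution ::
    "'a::euclidean_space set \<Rightarrow> ('a \<Rightarrow> 'a \<Rightarrow> real) \<Rightarrow> ('a \<Rightarrow> real) \<Rightarrow> bool" where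
  "viscosity_solution \<Omega> H u \<longleftrightarrow> viscosity_subsolution \<Omega> H u \<and> viscosity_supersolution \<Omega> H u"

definition semiconcave_on :: "'a::euclidean_space set \<Rightarrow> ('a \<Rightarrow> real) \<Rightarrow> bool" where
  "semiconcave_on \<Omega> u \<longleftrightarrow>
     (\<exists>C>0. \<forall>l\<in>{0..1}. \<forall>x\<in>\<Omega>. \<forall>y\<in>\<Omega>. closed_segment x y \<subseteq> \<Omega> \<longrightarrow>
        l * u x + (1 - l) * u y - u (l *\<^sub>R x + (1 - l) *\<^sub>R y)
          \<le> C / 2 * l * (1 - l) * (norm (x - y))\<^sup>2)"

definition superdiff :: "'a::euclidean_space set \<Rightarrow> ('a \<Rightarrow> real) \<Rightarrow> 'a \<Rightarrow> 'a set" where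
  "superdiff \<Omega> u x =
     {p. Limsup (at x within \<Omega>) (\<lambda>y. ereal ((u y - u x - p \<bullet> (y - x)) / norm (y - x))) \<le> 0}"

definition Sing :: "'a::euclidean_space set \<Rightarrow> ('a \<Rightarrow> real) \<Rightarrow> 'a set" where
  "Sing \<Omega> u = {x\<in>\<Omega>. \<not> is_singleton (superdiff \<Omega> u x)}"

definition critical_point ::
    "'a::euclidean_space set \<Rightarrow> ('a \<Rightarrow> 'a \<Rightarrow> real) \<Rightarrow> ('a \<Rightarrow> real) \<Rightarrow> 'a \<Rightarrow> bool" where
  "critical_point \<Omega> H u x \<longleftrightarrow> 0 \<in> grad_p H x ` superdiff \<Omega> u x"

definition strict_singular_characteristic ::
    "'a::euclidean_space set \<Rightarrow> ('a \<Rightarrow> 'a \<Rightarrow> real) \<Rightarrow> ('a \<Rightarrow> real) \<Rightarrow> 'a \<Rightarrow> real \<Rightarrow> (real \<Rightarrow> 'a) \<Rightarrow> bool"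
where
  "strict_singular_characteristic \<Omega> H u x0 T x \<longleftrightarrow>
     T > 0 \<and> (\<exists>L. L-lipschitz_on {0..T} x) \<and> x ` {0..T} \<subseteq> \<Omega> \<and>
     (\<forall>t\<in>{0..T}. x t \<in> Sing \<Omega> u) \<and> x 0 = x0 \<and>
     (\<exists>p. p \<in> borel_measurable (lebesgue_on {0..T}) \<and>
          (\<forall>t\<in>{0..T}. p t \<in> superdiff \<Omega> u (x t)) \<and>
          (AE t in lebesgue_on {0..T}.
             (x has_vector_derivative grad_p H (x t) (p t)) (at t within {0..T})))"

text \<open>
  The minimiser \<open>p0\<close> is unique for the Hamiltonians
  considered, since the superdifferential is convex and \<open>H\<close> is strictly convex in \<open>p\<close>. The arbitrary
  value of \<open>vector_derivative\<close> on the null set where \<open>y\<close> is not differentiable affects neither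
  the essential supremum nor, \<open>lebesgue_on\<close> being complete, the measurability it requires.
\<close>

definition singular_characteristic ::
    "'a::euclidean_space set \<Rightarrow> ('a \<Rightarrow> 'a \<Rightarrow> real) \<Rightarrow> ('a \<Rightarrow> real) \<Rightarrow> 'a \<Rightarrow> real \<Rightarrow> (real \<Rightarrow> 'a) \<Rightarrow> bool"
where
  "singular_characteristic \<Omega> H u x0 \<tau> y \<longleftrightarrow>
     \<tau> > 0 \<and> (\<exists>L. L-lipschitz_on {0..\<tau>} y) \<and> y ` {0..\<tau>} \<subseteq> \<Omega> \<and> y 0 = x0 \<and>
     (AE s in lebesgue_on {0..\<tau>}.
        \<exists>v \<in> convex hull (grad_p H (y s) ` superdiff \<Omega> u (y s)).
          (y has_vector_derivative v) (at s within {0..\<tau>})) \<and>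
     (\<forall>t\<in>{0..\<tau>}. y t \<in> Sing \<Omega> u) \<and>
     (\<exists>p0. is_arg_min (H x0) (\<lambda>p. p \<in> superdiff \<Omega> u x0) p0 \<and>
        (y has_vector_derivative grad_p H x0 p0) (at_right 0) \<and>
        ((\<lambda>t. esssup (lebesgue_on {0..t})
                (\<lambda>s. ereal (norm (vector_derivative y (at s within {0..\<tau>}) - grad_p H x0 p0))))
           \<longlongrightarrow> 0) (at_right 0))"

definition bilipschitz_homeomorphism ::
    "'a::metric_space set \<Rightarrow> 'b::metric_space set \<Rightarrow> ('a \<Rightarrow> 'b) \<Rightarrow> bool" where
  "bilipschitz_homeomorphism S T f \<longleftrightarrow>
     (\<exists>g. homeomorphism S T f g \<and> (\<exists>L. L-lipschitz_on S f) \<and> (\<exists>L. L-lipschitz_on T g))"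

end

(*
  Near x0 the superdifferential D u is upper semicontinuous, and each of its faces contains a point p
  with H(z,p) = 0, because such pairs (z,p) are dense. Let p0 minimise H(x0,.) over D u(x0) and
  v0 = H_p(x0,p0). The face of D u(x0) minimising the pairing with v0 then has two end points a, b on
  {H(x0,.) = 0} and contains p0 in its interior. In a thin cone around the ray x0 + r v0 every D u(z)
  is close to the segment [a,b], and its points with H = 0 are close to a or to b.

  Both curves leave x0 in direction v0 and therefore stay in every such cone. If D u were concentrated
  near a at some time, look back to the last time at which it was not: in between, the velocity is
  close to H_p(x0,a), and monotonicity of D u contradicts (a - b).H_p(x0,a) > 0. Hence along both
  curves D u has points near a and points near b. Monotonicity then forces the secants of the strict
  characteristic to be almost orthogonal to b - a, so its velocity tends to v0; the singular
  characteristic has this property by definition. In the plane, two points of the curves with the same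
  v0-coordinate differ by a multiple of b - a, and monotonicity once more shows that they coincide.
*)

theory Submission
  imports Defs
begin


section \<open>Mean value inequalities for Lipschitz curves\<close>

text \<open>Only the singular characteristic has a right derivative at 0 by definition. For the
  strict one the direction \<open>v0\<close> must be established first, and no cone statement is
  available before that; the function \<open>u - p0 \<bullet> (.)\<close> supplies it, since it
  would grow at least linearly along a curve deviating from \<open>v0\<close>, while
  \<open>p0\<close> being a superdifferential at \<open>x0\<close> allows only quadratic growth.
  Tangency at time 0 is still too weak: inverting the \<open>v0\<close>-coordinate needs control of
  secants between any two small times, hence the two-point notion \<open>near_line\<close>. As
  \<open>u\<close> need not be differentiable along the curves, derivatives of \<open>u\<close> are
  replaced by one-sided quadratic bounds backward in time, which suffice for a mean value
  inequality. Everything takes place in a ball around \<open>x0\<close>, where convexity turns the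
  superdifferential into a quadratic inequality valid on the whole ball; closedness and monotonicity
  follow at once. Noncriticality gives \<open>v0 \<noteq> 0\<close>. Singularity gives
  \<open>H x0 p0 < 0\<close>, which puts \<open>p0\<close> strictly between \<open>a\<close> and
  \<open>b\<close>.\<close>

lemma lipschitz_mean_value_le:
  fixes f :: "real \<Rightarrow> real"
  assumes lip: "L-lipschitz_on {a..b} f" and "a \<le> b" and N: "negligible N"
    and desc: "\<And>t k. t \<in> {a<..b} - N \<Longrightarrow> k > c \<Longrightarrow> \<exists>s\<in>{a..<t}. f t - f s \<le> k * (t - s)"
  shows "f b - f a \<le> c * (b - a)"
proof (rule ccontr)
  assume neg: "\<not> ?thesis"
  then have "a < b" using \<open>a \<le> b\<close> by (cases "a = b") auto
  have "c < (f b - f a) / (b - a)" using neg \<open>a < b\<close> by (simp add: field_simps)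
  then obtain k where kc: "k > c" and k2: "k < (f b - f a) / (b - a)" using dense by blast
  define h where "h = (\<lambda>t. f t - k * t)"
  have hab: "h a < h b" using k2 \<open>a < b\<close> by (simp add: h_def field_simps)
  have hc: "continuous_on {a..b} h"
    unfolding h_def using lipschitz_on_continuous_on[OF lip] by (intro continuous_intros)
  have hlip: "\<bar>h y - h x\<bar> \<le> (L + \<bar>k\<bar>) * \<bar>y - x\<bar>" if "x \<in> {a..b}" "y \<in> {a..b}" for x y
  proof -
    have "h y - h x = (f y - f x) - k * (y - x)" by (simp add: h_def algebra_simps)
    then have "\<bar>h y - h x\<bar> \<le> \<bar>f y - f x\<bar> + \<bar>k\<bar> * \<bar>y - x\<bar>"
      by (metis abs_mult abs_triangle_ineq4)
    then show ?thesis using lipschitz_onD[OF lip that(2,1)] by (simp add: dist_real_def algebra_simps)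
  qed
  \<comment> \<open>Lipschitz maps send null sets to null sets, so almost every level between
    \<open>h a\<close> and \<open>h b\<close> is attained only outside \<open>N\<close>.\<close>
  have "negligible (h ` (N \<inter> {a..b}))"
  proof (rule negligible_locally_Lipschitz_image)
    show "negligible (N \<inter> {a..b})" using N negligible_Int by blast
    fix x assume "x \<in> N \<inter> {a..b}"
    then show "\<exists>T B. open T \<and> x \<in> T \<and>
        (\<forall>y\<in>N \<inter> {a..b} \<inter> T. norm (h y - h x) \<le> B * norm (y - x))"
      using hlip by (intro exI[of _ UNIV] exI[of _ "L + \<bar>k\<bar>"]) auto
  qed simp
  moreover have "\<not> negligible {h a<..<h b}"
    using negligible_interval(2)[of "h a" "h b"] hab by (simp add: box_real)
  \<comment> \<open>At the first time where \<open>h\<close> reaches a level outside \<open>h ` N\<close>, the descent hypothesis fails.\<close>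
  ultimately obtain l where l: "l \<in> {h a<..<h b}" "l \<notin> h ` (N \<inter> {a..b})"
    using negligible_subset by blast
  define S where "S = {t \<in> {a..b}. h t = l}"
  have "closed S" unfolding S_def
    using continuous_closed_preimage[OF hc, of "{l}"] by (simp add: vimage_def Int_def)
  have "S \<noteq> {}" unfolding S_def using IVT'[of h a l b] l hc \<open>a < b\<close> by auto
  moreover have bdd: "bdd_below S" unfolding S_def by (auto intro: bdd_belowI[of _ a])
  ultimately have tS: "Inf S \<in> S" using \<open>closed S\<close> closed_contains_Inf by blast
  define t where "t = Inf S"
  have t: "t \<in> {a..b}" "h t = l" using tS by (auto simp: S_def t_def)
  have "t \<noteq> a" using t l by auto
  then have "t \<in> {a<..b} - N" using t l by auto
  from desc[OF this kc] obtain s where s: "s \<in> {a..<t}" "f t - f s \<le> k * (t - s)" by blast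
  then have "h s \<ge> l" using t by (simp add: h_def algebra_simps)
  moreover have "continuous_on {a..s} h" using hc by (rule continuous_on_subset) (use s t in auto)
  ultimately obtain t' where "a \<le> t'" "t' \<le> s" "h t' = l" using IVT'[of h a l s] s l by auto
  then have "t' \<in> S" "t' < t" using s t by (auto simp: S_def)
  then show False using cInf_lower[OF _ bdd] unfolding t_def by force
qed

lemma backward_difference_quotient:
  fixes x :: "real \<Rightarrow> 'a::real_normed_vector"
  assumes d: "(x has_vector_derivative v) (at t within S)" and sub': "{a..<t} \<subseteq> S"
  shows "((\<lambda>s. (1 / (t - s)) *\<^sub>R (x t - x s)) \<longlongrightarrow> v) (at t within {a..<t})"
    (is "(?q \<longlongrightarrow> v) _")
proof -
  have "((\<lambda>s. v - (1 / norm (s - t)) *\<^sub>R (x s - (x t + (s - t) *\<^sub>R v))) \<longlongrightarrow> v - 0)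
      (at t within {a..<t})"
    using has_vector_derivative_within_subset[OF d sub']
    unfolding has_vector_derivative_def has_derivative_within by (intro tendsto_intros) auto
  moreover have "\<forall>\<^sub>F s in at t within {a..<t}.
      v - (1 / norm (s - t)) *\<^sub>R (x s - (x t + (s - t) *\<^sub>R v)) = ?q s"
  proof -
    have "v - (1 / norm (s - t)) *\<^sub>R (x s - (x t + (s - t) *\<^sub>R v)) = ?q s" if "s < t" for s
    proof -
      have "(1 / (t - s)) *\<^sub>R ((s - t) *\<^sub>R v) = - v"
      proof -
        have "(s - t) / (t - s) = - 1" using that by (simp add: divide_simps)
        then show ?thesis by simp
      qed
      then show ?thesis
        using that by (simp add: scaleR_diff_right scaleR_add_right)
    qed
    then show ?thesis by (simp add: eventually_at_filter)
  qed
  ultimately show ?thesis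
    using Lim_transform_eventually by fastforce
qed

text \<open>The function \<open>f\<close> may fail to be differentiable: an upper bound on its
  backward increments is enough. After division by \<open>t - s\<close> the quadratic term is a
  difference quotient paired with \<open>x t - x s\<close>, which vanishes in the limit, so
  \<open>w\<close> and \<open>K\<close> may vary freely with \<open>t\<close>.\<close>

lemma curve_mean_value_le:
  fixes x :: "real \<Rightarrow> 'a::euclidean_space"
  assumes lip: "L-lipschitz_on {a..b} f" and "a \<le> b" and N: "negligible N"
    and sub: "{a..b} \<subseteq> S"
    and der: "\<And>t. t \<in> {a<..b} - N \<Longrightarrow> \<exists>v w K. (x has_vector_derivative v) (at t within S) \<and>
        (\<forall>s\<in>{a..<t}. f t - f s \<le> w \<bullet> (x t - x s) + K * (norm (x t - x s))\<^sup>2) \<and> w \<bullet> v \<le> c"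
  shows "f b - f a \<le> c * (b - a)"
proof (rule lipschitz_mean_value_le[OF lip \<open>a \<le> b\<close> N])
  fix t k assume t: "t \<in> {a<..b} - N" and k: "c < k"
  from der[OF t] obtain v w K where d: "(x has_vector_derivative v) (at t within S)"
    and le: "\<And>s. s\<in>{a..<t} \<Longrightarrow> f t - f s \<le> w \<bullet> (x t - x s) + K * (norm (x t - x s))\<^sup>2"
    and wv: "w \<bullet> v \<le> c" by blast
  let ?q = "\<lambda>s. (1 / (t - s)) *\<^sub>R (x t - x s)"
  have tF: "at t within {a..<t} \<noteq> bot"
    using t by (auto simp: trivial_limit_within islimpt_Ico)
  have sub': "{a..<t} \<subseteq> S" using sub t by auto
  have q: "(?q \<longlongrightarrow> v) (at t within {a..<t})"
    by (rule backward_difference_quotient[OF d sub'])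
  have x: "(x \<longlongrightarrow> x t) (at t within {a..<t})"
    using has_vector_derivative_continuous[OF has_vector_derivative_within_subset[OF d sub']]
    by (simp add: continuous_within)
  have "((\<lambda>s. w \<bullet> ?q s + K * (?q s \<bullet> (x t - x s))) \<longlongrightarrow> w \<bullet> v + K * (v \<bullet> (x t - x t))) (at t within {a..<t})"
    by (intro tendsto_intros q x)
  from order_tendstoD(2)[OF this, of k]
  have "\<forall>\<^sub>F s in at t within {a..<t}. w \<bullet> ?q s + K * (?q s \<bullet> (x t - x s)) < k"
    using wv k by (simp only: diff_self inner_zero_right mult_zero_right add_0_right)
  then have "\<forall>\<^sub>F s in at t within {a..<t}. s \<in> {a..<t} \<and> w \<bullet> ?q s + K * (?q s \<bullet> (x t - x s)) < k"
    by (intro eventually_conj) (auto simp: eventually_at_filter)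
  then obtain s where s: "s \<in> {a..<t}" "w \<bullet> ?q s + K * (?q s \<bullet> (x t - x s)) < k"
    using eventually_happens[OF _ ] tF by blast
  define Q where "Q = ?q s"
  have xs: "x t - x s = (t - s) *\<^sub>R Q" using s(1) by (simp add: Q_def)
  have "f t - f s \<le> w \<bullet> (x t - x s) + K * ((x t - x s) \<bullet> (x t - x s))"
    using le[OF s(1)] by (simp add: power2_norm_eq_inner)
  also have "\<dots> = (t - s) * (w \<bullet> Q + K * (Q \<bullet> (x t - x s)))"
    unfolding xs by (simp add: algebra_simps)
  also have "\<dots> \<le> (t - s) * k"
    using s by (intro mult_left_mono) (auto simp: Q_def)
  finally show "\<exists>s\<in>{a..<t}. f t - f s \<le> k * (t - s)" using s(1) by (auto simp: mult.commute)
qed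

text \<open>Pairing with the unit vector in the direction of the final defect \<open>W\<close>,
  fixed beforehand, reduces the vector estimate to the scalar one.\<close>

lemma curve_close_to_line:
  fixes x :: "real \<Rightarrow> 'a::euclidean_space"
  assumes lip: "L-lipschitz_on {a..b} x" and "a \<le> b" and N: "negligible N"
    and sub: "{a..b} \<subseteq> S"
    and der: "\<And>t. t \<in> {a<..b} - N \<Longrightarrow>
        \<exists>v'. (x has_vector_derivative v') (at t within S) \<and> norm (v' - v) \<le> e"
  shows "norm (x b - x a - (b - a) *\<^sub>R v) \<le> e * (b - a)"
proof -
  define W where "W = x b - x a - (b - a) *\<^sub>R v"
  define w where "w = sgn W"
  have w1: "norm w \<le> 1" by (simp add: w_def norm_sgn)
  have "L-lipschitz_on {a..b} (\<lambda>t. w \<bullet> x t)"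
  proof (rule lipschitz_onI)
    fix s t assume "s \<in> {a..b}" "t \<in> {a..b}"
    have "dist (w \<bullet> x s) (w \<bullet> x t) = \<bar>w \<bullet> (x s - x t)\<bar>"
      by (simp add: dist_real_def inner_diff_right)
    also have "\<dots> \<le> norm w * norm (x s - x t)" by (rule Cauchy_Schwarz_ineq2)
    also have "\<dots> \<le> norm (x s - x t)" using w1 mult_right_mono[OF w1, of "norm (x s - x t)"] by simp
    also have "\<dots> \<le> L * dist s t"
      using lipschitz_onD[OF lip \<open>s \<in> _\<close> \<open>t \<in> _\<close>] by (simp add: dist_norm)
    finally show "dist (w \<bullet> x s) (w \<bullet> x t) \<le> L * dist s t" .
  qed (use lipschitz_on_nonneg[OF lip] in auto)
  then have "w \<bullet> x b - w \<bullet> x a \<le> (w \<bullet> v + e) * (b - a)"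
  proof (rule curve_mean_value_le[OF _ \<open>a \<le> b\<close> N sub])
    fix t assume "t \<in> {a<..b} - N"
    from der[OF this] obtain v' where v': "(x has_vector_derivative v') (at t within S)"
      "norm (v' - v) \<le> e" by blast
    have "w \<bullet> (v' - v) \<le> norm w * norm (v' - v)" by (rule norm_cauchy_schwarz)
    also have "\<dots> \<le> e" using mult_right_mono[OF w1, of "norm (v' - v)"] v'(2) by simp
    finally have "w \<bullet> v' \<le> w \<bullet> v + e" by (simp add: inner_diff_right)
    with v' show "\<exists>v' w' K. (x has_vector_derivative v') (at t within S) \<and>
        (\<forall>s\<in>{a..<t}. w \<bullet> x t - w \<bullet> x s \<le> w' \<bullet> (x t - x s) + K * (norm (x t - x s))\<^sup>2) \<and>
        w' \<bullet> v' \<le> w \<bullet> v + e"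
      by (intro exI[of _ v'] exI[of _ w] exI[of _ 0]) (auto simp: inner_diff_right)
  qed
  then have "w \<bullet> W \<le> e * (b - a)"
    by (simp add: W_def inner_diff_right algebra_simps)
  moreover have "w \<bullet> W = norm W"
    by (simp add: w_def sgn_div_norm power2_norm_eq_inner[symmetric] power2_eq_square divide_simps)
  ultimately show ?thesis by (simp add: W_def)
qed


section \<open>Superdifferentials of semiconcave solutions\<close>

text \<open>On an open convex \<open>B\<close> inside the domain this is the superdifferential of a
  semiconcave function with constant \<open>2 * K\<close>, see
  \<open>superdiff_eq_quad_superdiff\<close>. An inequality valid on all of \<open>B\<close> passes
  to limits directly.\<close>

definition quad_superdiff :: "'a::euclidean_space set \<Rightarrow> real \<Rightarrow> ('a \<Rightarrow> real) \<Rightarrow> 'a \<Rightarrow> 'a set" where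
  "quad_superdiff B K u z = {p. \<forall>w\<in>B. u w \<le> u z + p \<bullet> (w - z) + K * (norm (w - z))\<^sup>2}"

text \<open>\<open>G\<close> stands for the gradient of \<open>H\<close> in \<open>p\<close>. Strict
  convexity enters as the tangent inequality \<open>H_gt\<close>, and the equation through
  \<open>H_le\<close> and \<open>H_zero_dense\<close>, which are derived from the viscosity
  properties at the end.\<close>

locale hj_superdiff =
  fixes B :: "'a::euclidean_space set" and K L :: real and u :: "'a \<Rightarrow> real"
    and H :: "'a \<Rightarrow> 'a \<Rightarrow> real" and G :: "'a \<Rightarrow> 'a \<Rightarrow> 'a"
  assumes open_B: "open B"
    and K_nonneg: "0 \<le> K"
    and u_lip: "L-lipschitz_on B u"
    and H_le: "\<And>z p. z \<in> B \<Longrightarrow> p \<in> quad_superdiff B K u z \<Longrightarrow> H z p \<le> 0"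
    and H_zero_dense: "\<And>z e. z \<in> B \<Longrightarrow> 0 < e \<Longrightarrow>
      \<exists>m\<in>B. dist m z < e \<and> (\<exists>p \<in> quad_superdiff B K u m. H m p = 0)"
    and H_cont: "continuous_on (B \<times> UNIV) (\<lambda>(z, p). H z p)"
    and G_cont: "continuous_on (B \<times> UNIV) (\<lambda>(z, p). G z p)"
    and H_gt: "\<And>z p q. z \<in> B \<Longrightarrow> p \<noteq> q \<Longrightarrow> H z p + G z p \<bullet> (q - p) < H z q"
begin

abbreviation D :: "'a \<Rightarrow> 'a set" where "D \<equiv> quad_superdiff B K u"

lemma D_le: "p \<in> D z \<Longrightarrow> w \<in> B \<Longrightarrow> u w \<le> u z + p \<bullet> (w - z) + K * (norm (w - z))\<^sup>2"
  by (auto simp: quad_superdiff_def)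

lemma u_cont: "continuous_on B u"
  using u_lip by (rule lipschitz_on_continuous_on)

text \<open>Moving from \<open>z\<close> by \<open>h\<close> against \<open>p\<close> lowers the
  upper bound for \<open>u\<close> by \<open>h * norm p\<close>, up to an error quadratic in
  \<open>h\<close>, whereas \<open>u\<close> itself can drop by at most
  \<open>L * h\<close>.\<close>

lemma D_bound:
  assumes "z \<in> B" "p \<in> D z"
  shows "norm p \<le> L"
proof (cases "p = 0")
  case False
  from open_B \<open>z \<in> B\<close> obtain e where e: "e > 0" "ball z e \<subseteq> B" by (auto elim: openE)
  have "norm p \<le> L + K * h" if h: "0 < h" "h < e" for h
  proof -
    define w where "w = z - h *\<^sub>R sgn p"
    have w: "norm (w - z) = h" "p \<bullet> (w - z) = - h * norm p"
      using h False by (auto simp: w_def norm_sgn sgn_div_norm power2_norm_eq_inner[symmetric] power2_eq_square)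
    then have "w \<in> B" using e h by (auto simp: dist_norm norm_minus_commute subset_iff)
    have "u z - u w \<le> L * h"
      using lipschitz_onD[OF u_lip \<open>z \<in> B\<close> \<open>w \<in> B\<close>] w(1)
      by (auto simp: dist_norm norm_minus_commute)
    then have "h * norm p \<le> h * (L + K * h)"
      using D_le[OF \<open>p \<in> D z\<close> \<open>w \<in> B\<close>] w by (simp add: algebra_simps power2_eq_square)
    then show ?thesis using h by simp
  qed
  then have "\<forall>\<^sub>F h in at_right 0. norm p \<le> L + K * h"
    using e(1) by (auto simp: eventually_at_right)
  moreover have "((\<lambda>h. L + K * h) \<longlongrightarrow> L + K * 0) (at_right 0)"
    by (intro tendsto_intros)
  ultimately show ?thesis by (simp add: tendsto_lowerbound)
qed (use lipschitz_on_nonneg[OF u_lip] in simp)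

text \<open>Sum of the defining inequalities at \<open>z\<close> and at \<open>w\<close>, each
  tested at the other point.\<close>

lemma D_monotone:
  assumes "z \<in> B" "w \<in> B" "p \<in> D z" "q \<in> D w"
  shows "(q - p) \<bullet> (w - z) \<le> 2 * K * (norm (w - z))\<^sup>2"
  using D_le[OF assms(3,2)] D_le[OF assms(4,1)]
  by (simp add: inner_diff_left inner_diff_right norm_minus_commute)

lemma convex_D: "convex (D z)"
proof (rule convexI)
  fix p q and s t :: real
  assume p: "p \<in> D z" and q: "q \<in> D z" and st: "0 \<le> s" "0 \<le> t" "s + t = 1"
  show "s *\<^sub>R p + t *\<^sub>R q \<in> D z"
    unfolding quad_superdiff_def
  proof (intro CollectI ballI)
    fix w assume w: "w \<in> B"
    have "u w = s * u w + t * u w" using st by (simp flip: distrib_right)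
    also have "\<dots> \<le> s * (u z + p \<bullet> (w - z) + K * (norm (w - z))\<^sup>2)
        + t * (u z + q \<bullet> (w - z) + K * (norm (w - z))\<^sup>2)"
      using D_le[OF p w] D_le[OF q w] st by (intro add_mono mult_left_mono) auto
    also have "\<dots> = (s + t) * (u z + K * (norm (w - z))\<^sup>2) + (s *\<^sub>R p + t *\<^sub>R q) \<bullet> (w - z)"
      by (simp add: algebra_simps inner_add_left)
    finally show "u w \<le> u z + (s *\<^sub>R p + t *\<^sub>R q) \<bullet> (w - z) + K * (norm (w - z))\<^sup>2"
      using st by simp
  qed
qed

lemma D_limit:
  assumes z: "z \<longlonglongrightarrow> z0" "z0 \<in> B" "\<And>n. z n \<in> B" and p: "p \<longlonglongrightarrow> p0" "\<And>n. p n \<in> D (z n)"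
  shows "p0 \<in> D z0"
  unfolding quad_superdiff_def
proof (intro CollectI ballI)
  fix w assume w: "w \<in> B"
  have "(\<lambda>n. u (z n)) \<longlonglongrightarrow> u z0"
    using continuous_on_tendsto_compose[OF u_cont z(1,2)] z(3) by simp
  then have "(\<lambda>n. u (z n) + p n \<bullet> (w - z n) + K * (norm (w - z n))\<^sup>2)
      \<longlonglongrightarrow> u z0 + p0 \<bullet> (w - z0) + K * (norm (w - z0))\<^sup>2"
    by (intro tendsto_intros z p)
  then show "u w \<le> u z0 + p0 \<bullet> (w - z0) + K * (norm (w - z0))\<^sup>2"
    by (rule LIMSEQ_le_const) (use D_le[OF p(2) w] in auto)
qed

text \<open>Compactness from \<open>D_bound\<close> and closedness from \<open>D_limit\<close>: the
  source of all upper semicontinuity below.\<close>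

lemma D_subseq:
  assumes z: "z \<longlonglongrightarrow> z0" "z0 \<in> B" "\<And>n. z n \<in> B" and p: "\<And>n. p n \<in> D (z n)"
  obtains r p0 where "strict_mono r" "(p \<circ> r) \<longlonglongrightarrow> p0" "p0 \<in> D z0"
proof -
  have "compact (cball (0::'a) L)" by simp
  moreover have "\<forall>n. p n \<in> cball 0 L" using D_bound[OF z(3) p] by simp
  ultimately obtain p0 r where r: "strict_mono r" "(p \<circ> r) \<longlonglongrightarrow> p0"
    unfolding compact_def by blast
  then have "p0 \<in> D z0"
    using D_limit[of "z \<circ> r" z0 "p \<circ> r" p0] LIMSEQ_subseq_LIMSEQ[OF z(1) r(1)] z p by simp
  with r that show ?thesis by blast
qed

lemma H_tendsto:
  assumes "(z \<longlongrightarrow> z0) F" "(p \<longlongrightarrow> p0) F" "z0 \<in> B" "eventually (\<lambda>n. z n \<in> B) F"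
  shows "((\<lambda>n. H (z n) (p n)) \<longlongrightarrow> H z0 p0) F"
  using continuous_on_tendsto_compose[OF H_cont tendsto_Pair[OF assms(1,2)]] assms by simp

lemma G_tendsto:
  assumes "(z \<longlongrightarrow> z0) F" "(p \<longlongrightarrow> p0) F" "z0 \<in> B" "eventually (\<lambda>n. z n \<in> B) F"
  shows "((\<lambda>n. G (z n) (p n)) \<longlongrightarrow> G z0 p0) F"
  using continuous_on_tendsto_compose[OF G_cont tendsto_Pair[OF assms(1,2)]] assms by simp

lemma G_monotone:
  assumes "z \<in> B" "p \<noteq> q" shows "0 < (p - q) \<bullet> (G z p - G z q)"
  using H_gt[OF assms] H_gt[OF assms(1) assms(2)[symmetric]]
  by (simp add: inner_diff_left inner_diff_right inner_commute)

text \<open>Approach \<open>z\<close> from direction \<open>\<theta>\<close> through points carrying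
  a superdifferential on the zero level. Divided by the distance, monotonicity says that these are
  asymptotically no larger in direction \<open>\<theta>\<close> than any \<open>q\<close> in
  \<open>D z\<close>; their limit is the minimiser.\<close>

lemma D_minimiser_on_zero_level:
  assumes z: "z \<in> B"
  obtains p where "p \<in> D z" "H z p = 0" "\<And>q. q \<in> D z \<Longrightarrow> p \<bullet> \<theta> \<le> q \<bullet> \<theta>"
proof -
  from open_B z obtain e where e: "e > 0" "ball z e \<subseteq> B" by (auto elim: openE)
  \<comment> \<open>Keeps the approaching points in the ball around \<open>z\<close>; the
    \<open>+ 1\<close> covers \<open>\<theta> = 0\<close>.\<close>
  define d where "d = e / (2 * (norm \<theta> + 1))"
  have d: "d > 0" "d * norm \<theta> < e"
  proof -
    show "d > 0" using e by (simp add: d_def add_nonneg_pos)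
    have "d * norm \<theta> \<le> d * (norm \<theta> + 1)" using \<open>d > 0\<close> by simp
    also have "\<dots> = e / 2" by (simp add: d_def divide_simps add_nonneg_eq_0_iff)
    finally show "d * norm \<theta> < e" using e by simp
  qed
  define h where "h n = d * inverse (real (Suc n))" for n
  have h: "0 < h n" "h n \<le> d" for n
    using d by (auto simp: h_def divide_simps)
  have h0: "h \<longlonglongrightarrow> 0"
    unfolding h_def using tendsto_mult[OF tendsto_const[of d] LIMSEQ_inverse_real_of_nat] by simp
  \<comment> \<open>The tolerance \<open>h n * h n\<close> is of smaller order than the
    displacement, so the direction of approach still converges to \<open>\<theta>\<close>.\<close>
  have "\<exists>m p. m \<in> B \<and> dist m (z + h n *\<^sub>R \<theta>) < h n * h n \<and> p \<in> D m \<and> H m p = 0" for n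
  proof -
    have "dist z (z + h n *\<^sub>R \<theta>) = h n * norm \<theta>" using h[of n] by (simp add: dist_norm)
    also have "\<dots> \<le> d * norm \<theta>" using h[of n] by (intro mult_right_mono) auto
    finally have "z + h n *\<^sub>R \<theta> \<in> B" using d e by auto
    from H_zero_dense[OF this, of "h n * h n"] h[of n] show ?thesis by auto
  qed
  then obtain m p where m: "\<And>n. m n \<in> B" "\<And>n. dist (m n) (z + h n *\<^sub>R \<theta>) < h n * h n"
    and p: "\<And>n. p n \<in> D (m n)" "\<And>n. H (m n) (p n) = 0" by metis
  define \<xi> where "\<xi> n = (1 / h n) *\<^sub>R (m n - z)" for n
  have m_eq: "m n - z = h n *\<^sub>R \<xi> n" for n using h(1)[of n] by (simp add: \<xi>_def)
  have "norm (\<xi> n - \<theta>) \<le> h n" for n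
  proof -
    have "h n * norm (\<xi> n - \<theta>) = norm (h n *\<^sub>R \<xi> n - h n *\<^sub>R \<theta>)"
      using h(1)[of n] by (simp flip: scaleR_diff_right)
    also have "\<dots> \<le> h n * h n" using m(2)[of n] by (simp add: m_eq[symmetric] dist_norm algebra_simps)
    finally show ?thesis using h(1)[of n] by simp
  qed
  then have "(\<lambda>n. \<xi> n - \<theta>) \<longlonglongrightarrow> 0" using h0 by (rule Lim_null_comparison[OF always_eventually[OF allI]])
  then have \<xi>: "\<xi> \<longlonglongrightarrow> \<theta>" by (simp add: LIM_zero_iff)
  have "(\<lambda>n. z + h n *\<^sub>R \<xi> n) \<longlonglongrightarrow> z + 0 *\<^sub>R \<theta>" by (intro tendsto_intros h0 \<xi>)
  then have mz: "m \<longlonglongrightarrow> z" by (simp flip: m_eq)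
  obtain r p' where r: "strict_mono r" "(p \<circ> r) \<longlonglongrightarrow> p'" "p' \<in> D z"
    using D_subseq[OF mz z m(1) p(1)] .
  have mr: "(\<lambda>n. m (r n)) \<longlonglongrightarrow> z" using LIMSEQ_subseq_LIMSEQ[OF mz r(1)] by (simp add: o_def)
  have "(\<lambda>n. H (m (r n)) ((p \<circ> r) n)) \<longlonglongrightarrow> H z p'"
    by (rule H_tendsto[OF mr r(2) z]) (simp add: m)
  then have "H z p' = 0" using p(2) by (simp add: LIMSEQ_const_iff)
  moreover have "p' \<bullet> \<theta> \<le> q \<bullet> \<theta>" if q: "q \<in> D z" for q
  proof -
    have "(p n - q) \<bullet> \<xi> n \<le> 2 * K * (h n * (norm (\<xi> n))\<^sup>2)" for n
    proof -
      have "h n * ((p n - q) \<bullet> \<xi> n) \<le> h n * (2 * K * (h n * (norm (\<xi> n))\<^sup>2))"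
        using D_monotone[OF z m(1)[of n] q p(1)[of n]]
        by (simp add: m_eq power_mult_distrib algebra_simps power2_eq_square)
      then show ?thesis using h(1)[of n] by simp
    qed
    then have "\<forall>n. ((p \<circ> r) n - q) \<bullet> (\<xi> \<circ> r) n \<le> 2 * K * ((h \<circ> r) n * (norm ((\<xi> \<circ> r) n))\<^sup>2)" by simp
    moreover have "(\<lambda>n. ((p \<circ> r) n - q) \<bullet> (\<xi> \<circ> r) n) \<longlonglongrightarrow> (p' - q) \<bullet> \<theta>"
      by (intro tendsto_intros r(2) LIMSEQ_subseq_LIMSEQ[OF \<xi> r(1)])
    moreover have "(\<lambda>n. 2 * K * ((h \<circ> r) n * (norm ((\<xi> \<circ> r) n))\<^sup>2)) \<longlonglongrightarrow> 2 * K * (0 * (norm \<theta>)\<^sup>2)"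
      by (intro tendsto_intros LIMSEQ_subseq_LIMSEQ[OF \<xi> r(1)] LIMSEQ_subseq_LIMSEQ[OF h0 r(1)])
    ultimately have "(p' - q) \<bullet> \<theta> \<le> 2 * K * (0 * (norm \<theta>)\<^sup>2)"
      by (intro LIMSEQ_le) auto
    then show ?thesis by (simp add: inner_diff_left)
  qed
  ultimately show ?thesis using that r(3) by blast
qed

lemma D_maximiser_on_zero_level:
  assumes z: "z \<in> B"
  obtains p where "p \<in> D z" "H z p = 0" "\<And>q. q \<in> D z \<Longrightarrow> q \<bullet> \<theta> \<le> p \<bullet> \<theta>"
  using D_minimiser_on_zero_level[OF z, where \<theta> = "- \<theta>"] by (metis inner_minus_right neg_le_iff_le)

end


section \<open>Noncritical singular points in the plane\<close>

text \<open>The planar ingredient: the orthogonal complement of a nonzero vector is a line.\<close>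

lemma orthogonal_vec2_collinear:
  fixes v w e :: "real^2"
  assumes "v \<noteq> 0" "e \<noteq> 0" "w \<bullet> v = 0" "e \<bullet> v = 0"
  obtains c where "w = c *\<^sub>R e"
proof -
  have w: "w$1 * v$1 + w$2 * v$2 = 0" and e: "e$1 * v$1 + e$2 * v$2 = 0"
    using assms by (auto simp: inner_vec_def sum_2)
  \<comment> \<open>Multiplied by either coordinate of \<open>v\<close>, the determinant is a
    combination of the two orthogonality relations.\<close>
  have det: "w$1 * e$2 = w$2 * e$1"
  proof -
    have "v$1 * (w$1 * e$2 - w$2 * e$1) = e$2 * (w$1 * v$1 + w$2 * v$2) - w$2 * (e$1 * v$1 + e$2 * v$2)"
      "v$2 * (w$1 * e$2 - w$2 * e$1) = w$1 * (e$1 * v$1 + e$2 * v$2) - e$1 * (w$1 * v$1 + w$2 * v$2)"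
      by (simp_all add: algebra_simps)
    moreover have "v$1 \<noteq> 0 \<or> v$2 \<noteq> 0"
      using \<open>v \<noteq> 0\<close> by (auto simp: vec_eq_iff forall_2)
    ultimately show ?thesis using w e by auto
  qed
  have "w = (w \<bullet> e / (e \<bullet> e)) *\<^sub>R e"
  proof -
    have ee: "e \<bullet> e = e$1 * e$1 + e$2 * e$2" "w \<bullet> e = w$1 * e$1 + w$2 * e$2"
      by (auto simp: inner_vec_def sum_2)
    have "e \<bullet> e \<noteq> 0" using \<open>e \<noteq> 0\<close> by simp
    moreover have "(e \<bullet> e) * w$1 = (w \<bullet> e) * e$1" "(e \<bullet> e) * w$2 = (w \<bullet> e) * e$2"
      using det unfolding ee by algebra+
    ultimately show ?thesis by (simp add: vec_eq_iff forall_2 field_simps)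
  qed
  with that show ?thesis by blast
qed

locale hj_singular_point = hj_superdiff B K L u H G
  for B :: "(real^2) set" and K L u H G +
  fixes x0 p0 :: "real^2"
  assumes x0: "x0 \<in> B"
    and p0: "p0 \<in> quad_superdiff B K u x0"
    and p0_min: "\<And>p. p \<in> quad_superdiff B K u x0 \<Longrightarrow> H x0 p0 \<le> H x0 p"
    and singular: "quad_superdiff B K u x0 \<noteq> {p0}"
    and noncritical: "G x0 p0 \<noteq> 0"
begin

definition v0 :: "real^2" where "v0 = G x0 p0"

lemma v0_nonzero: "v0 \<noteq> 0" using noncritical by (simp add: v0_def)

text \<open>First-order optimality of \<open>p0\<close> in the convex set \<open>D x0\<close>. The
  locale provides only tangent inequalities, so the sign is obtained for \<open>G\<close> at
  \<open>p0 + s *\<^sub>R (p - p0)\<close>, from the tangent inequality there and minimality of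
  \<open>p0\<close>; then \<open>s\<close> tends to 0.\<close>

lemma face:
  assumes p: "p \<in> D x0" shows "0 \<le> (p - p0) \<bullet> v0"
proof (cases "p = p0")
  case False
  have "0 \<le> G x0 (p0 + s *\<^sub>R (p - p0)) \<bullet> (p - p0)" if s: "0 < s" "s < 1" for s
  proof -
    let ?q = "p0 + s *\<^sub>R (p - p0)"
    have "?q = (1 - s) *\<^sub>R p0 + s *\<^sub>R p" by (simp add: algebra_simps)
    then have "?q \<in> D x0" using convexD[OF convex_D p0 p, of "1 - s" s] s by simp
    then have "H x0 p0 \<le> H x0 ?q" by (rule p0_min)
    moreover have "H x0 ?q + G x0 ?q \<bullet> (p0 - ?q) < H x0 p0"
      using H_gt[OF x0, of ?q p0] False s by simp
    ultimately have "0 < s * (G x0 ?q \<bullet> (p - p0))" by simp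
    then show ?thesis using s by (simp add: zero_less_mult_iff)
  qed
  then have "\<forall>\<^sub>F s in at_right 0. 0 \<le> G x0 (p0 + s *\<^sub>R (p - p0)) \<bullet> (p - p0)"
    unfolding eventually_at_right[OF zero_less_one] by (intro exI[of _ 1]) auto
  moreover have "((\<lambda>s. p0 + s *\<^sub>R (p - p0)) \<longlongrightarrow> p0 + 0 *\<^sub>R (p - p0)) (at_right 0)"
    by (intro tendsto_intros)
  then have "((\<lambda>s. G x0 (p0 + s *\<^sub>R (p - p0))) \<longlongrightarrow> v0) (at_right 0)"
    unfolding v0_def using x0 by (intro G_tendsto) auto
  then have "((\<lambda>s. G x0 (p0 + s *\<^sub>R (p - p0)) \<bullet> (p - p0)) \<longlongrightarrow> v0 \<bullet> (p - p0)) (at_right 0)"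
    by (intro tendsto_intros)
  ultimately show ?thesis by (auto simp: inner_commute intro: tendsto_lowerbound)
qed simp

text \<open>At a second point \<open>q\<close> of \<open>D x0\<close> the strict tangent inequality
  and \<open>face\<close> give \<open>H x0 p0 < H x0 q\<close>, and the latter is at most 0. Hence
  \<open>p0\<close> differs from every zero-level point of the face.\<close>

lemma H_p0_neg: "H x0 p0 < 0"
proof -
  obtain q where q: "q \<in> D x0" "q \<noteq> p0" using singular p0 by blast
  have "H x0 p0 + v0 \<bullet> (q - p0) < H x0 q" unfolding v0_def using H_gt[OF x0] q by auto
  then show ?thesis using face[OF q(1)] H_le[OF x0 q(1)] by (simp add: inner_commute)
qed

text \<open>Strict monotonicity of \<open>G x0\<close> improves the sign given by
  \<open>face\<close>. This pairing, zero only at \<open>p0\<close>, will later bound the deviation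
  of a velocity from \<open>v0\<close>.\<close>

lemma G_pairing_pos:
  assumes "p \<in> D x0" "p \<noteq> p0" shows "0 < (p - p0) \<bullet> G x0 p"
  using G_monotone[OF x0 assms(2)] face[OF assms(1)] by (simp add: v0_def inner_diff_right)

text \<open>Minimising in direction \<open>v0\<close> alone gives a point of the face but does not
  say on which side of \<open>p0\<close>. Tilting the direction slightly by \<open>w\<close> selects
  the side, and the limit of the tilted minimisers stays in the face and on the zero level.\<close>

lemma face_zero_level:
  obtains a where "a \<in> D x0" "H x0 a = 0" "(a - p0) \<bullet> v0 = 0" "(a - p0) \<bullet> w \<le> 0"
proof -
  define \<theta> where "\<theta> n = v0 + inverse (real (Suc n)) *\<^sub>R w" for n
  have "\<exists>p. p \<in> D x0 \<and> H x0 p = 0 \<and> (p - p0) \<bullet> \<theta> n \<le> 0" for n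
    using D_minimiser_on_zero_level[OF x0, of "\<theta> n"] p0 by (metis inner_diff_left diff_le_0_iff_le)
  then obtain p where p: "\<And>n. p n \<in> D x0" "\<And>n. H x0 (p n) = 0" "\<And>n. (p n - p0) \<bullet> \<theta> n \<le> 0"
    by metis
  obtain r a where r: "strict_mono r" "(p \<circ> r) \<longlonglongrightarrow> a" "a \<in> D x0"
    using D_subseq[of "\<lambda>_. x0" x0 p] x0 p by auto
  have "\<theta> \<longlonglongrightarrow> v0 + 0 *\<^sub>R w"
    unfolding \<theta>_def by (intro tendsto_intros LIMSEQ_inverse_real_of_nat)
  from LIMSEQ_subseq_LIMSEQ[OF this r(1)] have "(\<theta> \<circ> r) \<longlonglongrightarrow> v0" by simp
  then have "(\<lambda>n. ((p \<circ> r) n - p0) \<bullet> (\<theta> \<circ> r) n) \<longlonglongrightarrow> (a - p0) \<bullet> v0"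
    by (intro tendsto_intros r)
  then have "(a - p0) \<bullet> v0 \<le> 0" by (rule LIMSEQ_le_const2) (use p(3) in auto)
  then have "(a - p0) \<bullet> v0 = 0" using face[OF r(3)] by simp
  moreover have "(\<lambda>n. H x0 ((p \<circ> r) n)) \<longlonglongrightarrow> H x0 a"
    by (rule H_tendsto[OF tendsto_const r(2) x0]) (simp add: x0)
  then have "H x0 a = 0" using p(2) by (simp add: LIMSEQ_const_iff)
  \<comment> \<open>By \<open>face\<close> the \<open>v0\<close> part of the tilted pairing is
    nonnegative, so the \<open>w\<close> part is nonpositive already before the limit.\<close>
  moreover have "(p n - p0) \<bullet> w \<le> 0" for n
  proof -
    have "inverse (real (Suc n)) * ((p n - p0) \<bullet> w) \<le> 0"
      using p(3)[of n] face[OF p(1)[of n]] by (simp add: \<theta>_def inner_add_right)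
    then show ?thesis by (simp add: mult_le_0_iff)
  qed
  then have "(a - p0) \<bullet> w \<le> 0"
    by (intro LIMSEQ_le_const2[of "\<lambda>n. ((p \<circ> r) n - p0) \<bullet> w"] tendsto_intros r) auto
  ultimately show ?thesis using that r(3) by blast
qed

text \<open>
  The end points \<open>a\<close>, \<open>b\<close> of the face of \<open>D x0\<close> on which the pairing with \<open>v0\<close> is minimal.
\<close>

definition ends :: "real^2 \<Rightarrow> real^2 \<Rightarrow> bool" where
  "ends a b \<longleftrightarrow> a \<in> D x0 \<and> b \<in> D x0 \<and> H x0 a = 0 \<and> H x0 b = 0 \<and> (b - a) \<bullet> v0 = 0 \<and>
     p0 \<in> open_segment a b"

lemma ends_swap: "ends a b \<Longrightarrow> ends b a"
  by (auto simp: ends_def open_segment_commute inner_diff_left)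

lemma ends_exist: obtains a b where "ends a b"
proof -
  \<comment> \<open>\<open>v0\<close> turned by a right angle; tilting by \<open>e\<close> and by
    \<open>- e\<close> selects the two ends.\<close>
  define e :: "real^2" where "e = vector [- v0$2, v0$1]"
  have e: "e \<bullet> v0 = 0" "e \<noteq> 0"
    using v0_nonzero by (auto simp: e_def inner_vec_def sum_2 vec_eq_iff forall_2)
  obtain a where a: "a \<in> D x0" "H x0 a = 0" "(a - p0) \<bullet> v0 = 0" "(a - p0) \<bullet> e \<le> 0"
    using face_zero_level .
  obtain b where b: "b \<in> D x0" "H x0 b = 0" "(b - p0) \<bullet> v0 = 0" "(b - p0) \<bullet> (- e) \<le> 0"
    using face_zero_level .
  obtain c where c: "a - p0 = c *\<^sub>R e" using orthogonal_vec2_collinear[OF v0_nonzero e(2) a(3) e(1)] .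
  obtain d where d: "b - p0 = d *\<^sub>R e" using orthogonal_vec2_collinear[OF v0_nonzero e(2) b(3) e(1)] .
  have "e \<bullet> e > 0" using e by simp
  then have "c \<le> 0" "d \<ge> 0"
    using a(4) b(4) by (auto simp: c d mult_le_0_iff zero_le_mult_iff simp del: inner_gt_zero_iff)
  \<comment> \<open>A vanishing coefficient would put \<open>p0\<close> on the zero level, against
    \<open>H_p0_neg\<close>.\<close>
  moreover have "c \<noteq> 0" "d \<noteq> 0" using a b c d H_p0_neg by auto
  ultimately have cd: "c < 0" "0 < d" by auto
  have ab: "a = p0 + c *\<^sub>R e" "b = p0 + d *\<^sub>R e" using c d by (auto simp: algebra_simps)
  define t where "t = - c / (d - c)"
  have t: "0 < t" "t < 1" "c + t * (d - c) = 0" using cd by (auto simp: t_def divide_simps)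
  have "(1 - t) *\<^sub>R a + t *\<^sub>R b = p0 + (c + t * (d - c)) *\<^sub>R e"
    by (simp add: ab algebra_simps)
  then have "p0 \<in> open_segment a b"
    using t cd e by (auto simp: in_segment ab intro!: exI[of _ t])
  moreover have "(b - a) \<bullet> v0 = 0" using a(3) b(3) by (simp add: inner_diff_left)
  ultimately have "ends a b" using a b by (simp add: ends_def)
  with that show ?thesis .
qed

lemma ends_neq: "ends a b \<Longrightarrow> a \<noteq> b"
  by (auto simp: ends_def)

lemma ends_inner_pos:
  assumes "ends a b" shows "0 < (b - p0) \<bullet> (b - a)" "0 < (p0 - a) \<bullet> (b - a)"
proof -
  obtain t where t: "0 < t" "t < 1" "p0 = (1 - t) *\<^sub>R a + t *\<^sub>R b"
    using assms by (auto simp: ends_def in_segment)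
  have "b - p0 = (1 - t) *\<^sub>R (b - a)" "p0 - a = t *\<^sub>R (b - a)" using t by (auto simp: algebra_simps)
  moreover have "(b - a) \<bullet> (b - a) > 0" using ends_neq[OF assms] by simp
  ultimately show "0 < (b - p0) \<bullet> (b - a)" "0 < (p0 - a) \<bullet> (b - a)"
    using t by simp_all
qed

lemma ends_perp: "ends a b \<Longrightarrow> (p0 - a) \<bullet> v0 = 0"
proof -
  assume ab: "ends a b"
  then obtain t where t: "p0 = (1 - t) *\<^sub>R a + t *\<^sub>R b" by (auto simp: ends_def in_segment)
  have "p0 - a = t *\<^sub>R (b - a)" by (simp add: t algebra_simps)
  then show ?thesis using ab by (simp add: ends_def)
qed

text \<open>Take the tangent inequalities at \<open>q\<close> towards both ends with the weights
  that represent \<open>q\<close>: the gradient terms cancel.\<close>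

lemma H_neg_on_open_segment:
  assumes ab: "ends a b" and q: "q \<in> open_segment a b" shows "H x0 q < 0"
proof -
  obtain t where t: "0 < t" "t < 1" "q = (1 - t) *\<^sub>R a + t *\<^sub>R b" using q by (auto simp: in_segment)
  have "a \<noteq> q" "b \<noteq> q" using q by (auto simp: open_segment_def)
  then have 1: "H x0 q + G x0 q \<bullet> (a - q) < 0" "H x0 q + G x0 q \<bullet> (b - q) < 0"
    using H_gt[OF x0, of q a] H_gt[OF x0, of q b] ab by (auto simp: ends_def)
  have "(1 - t) * (H x0 q + G x0 q \<bullet> (a - q)) + t * (H x0 q + G x0 q \<bullet> (b - q)) < 0"
    using mult_pos_neg[OF _ 1(1), of "1 - t"] mult_pos_neg[OF t(1) 1(2)] t(2) by linarith
  moreover have "(1 - t) *\<^sub>R (a - q) + t *\<^sub>R (b - q) = 0" by (simp add: t algebra_simps)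
  then have "(1 - t) * (G x0 q \<bullet> (a - q)) + t * (G x0 q \<bullet> (b - q)) = 0"
    by (metis inner_add_right inner_scaleR_right inner_zero_right)
  ultimately show ?thesis by (simp add: algebra_simps)
qed

text \<open>Tangent inequality between two points of the same level. It forbids superdifferentials
  to pass from near \<open>b\<close> to near \<open>a\<close> along a short secant parallel to
  \<open>G x0 a\<close>, since monotonicity would make this pairing almost nonpositive.\<close>

lemma G_ends_pos:
  assumes "ends a b" shows "0 < (a - b) \<bullet> G x0 a"
  using H_gt[OF x0, of a b] assms ends_neq[OF assms]
  by (auto simp: ends_def inner_diff_left inner_diff_right inner_commute)

text \<open>On the line through \<open>a\<close> and \<open>b\<close>, \<open>H x0\<close> is
  positive beyond either end, while it is nonpositive on \<open>D x0\<close>; so the face stops at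
  the ends.\<close>

lemma face_subset_segment:
  assumes ab: "ends a b" and q: "q \<in> D x0" "(q - p0) \<bullet> v0 \<le> 0"
  shows "q \<in> closed_segment a b"
proof -
  have *: "c \<le> 1" if ab: "ends a b" and q: "q \<in> D x0" "q = a + c *\<^sub>R (b - a)" for a b c
  proof (rule ccontr)
    assume c: "\<not> c \<le> 1"
    have qb: "q - b = (c - 1) *\<^sub>R (b - a)" using q by (simp add: algebra_simps)
    then have "q \<noteq> b" using c ends_neq[OF ab] by auto
    then have "(c - 1) * (G x0 b \<bullet> (b - a)) < H x0 q"
      using H_gt[OF x0, of b q] ab by (auto simp: ends_def qb)
    moreover have "0 < G x0 b \<bullet> (b - a)"
      using G_ends_pos[OF ends_swap[OF ab]] by (simp add: inner_commute)
    ultimately have "0 < H x0 q" using c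
      by (meson diff_gt_0_iff_gt less_trans mult_pos_pos not_le)
    then show False using H_le[OF x0 q(1)] by simp
  qed
  have "(q - a) \<bullet> v0 = 0"
    using q face[OF q(1)] ends_perp[OF ab] by (simp add: inner_diff_left)
  then obtain c where c: "q - a = c *\<^sub>R (b - a)"
    using orthogonal_vec2_collinear[OF v0_nonzero, of "b - a" "q - a"] ab ends_neq[OF ab]
    by (auto simp: ends_def)
  have "c \<le> 1" by (rule *[OF ab q(1)]) (simp flip: c)
  moreover have "1 - c \<le> 1"
    by (rule *[OF ends_swap[OF ab] q(1)]) (use c in \<open>simp add: algebra_simps\<close>)
  moreover have "q = (1 - c) *\<^sub>R a + c *\<^sub>R b" using c by (simp add: algebra_simps)
  ultimately show ?thesis by (auto simp: in_segment)
qed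

end


section \<open>Superdifferentials in thin cones around the direction \<open>v0\<close>\<close>

context hj_singular_point
begin

definition thin_cone :: "real \<Rightarrow> (real^2) set" where
  "thin_cone d = {z. \<exists>r\<in>{0<..<d}. norm (z - x0 - r *\<^sub>R v0) \<le> d * r}"

text \<open>Approach to \<open>x0\<close> tangentially to \<open>v0\<close>: the parameter
  \<open>d\<close> bounds length and aperture of the cone at once. Every curve starting at
  \<open>x0\<close> with right derivative \<open>v0\<close> converges along this filter, see
  \<open>narrow_if_tangent\<close>.\<close>

definition narrow :: "(real^2) filter" where
  "narrow = (INF d\<in>{0<..}. principal (thin_cone d))"

lemma thin_cone_mono:
  assumes "d \<le> d'" shows "thin_cone d \<subseteq> thin_cone d'"
proof
  fix z assume "z \<in> thin_cone d"
  then obtain r where r: "0 < r" "r < d" "norm (z - x0 - r *\<^sub>R v0) \<le> d * r" by (auto simp: thin_cone_def)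
  moreover have "d * r \<le> d' * r" using r assms by (intro mult_right_mono) auto
  ultimately have "norm (z - x0 - r *\<^sub>R v0) \<le> d' * r" by linarith
  with r assms show "z \<in> thin_cone d'" by (auto simp: thin_cone_def intro!: bexI[of _ r])
qed

lemma eventually_narrow: "eventually P narrow \<longleftrightarrow> (\<exists>d>0. \<forall>z\<in>thin_cone d. P z)"
proof -
  have "eventually P narrow \<longleftrightarrow> (\<exists>d\<in>{0<..}. eventually P (principal (thin_cone d)))"
    unfolding narrow_def
  proof (rule eventually_INF_base)
    fix a b :: real assume "a \<in> {0<..}" "b \<in> {0<..}"
    then show "\<exists>x\<in>{0<..}. principal (thin_cone x) \<le> inf (principal (thin_cone a)) (principal (thin_cone b))"
      using thin_cone_mono[of "min a b" a] thin_cone_mono[of "min a b" b]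
      by (intro bexI[of _ "min a b"]) auto
  qed auto
  then show ?thesis by (auto simp: eventually_principal)
qed

text \<open>The scales \<open>r\<close> are the heights in the cones; dividing monotonicity
  inequalities by them produces statements about \<open>v0\<close> in the limit.\<close>

lemma narrow_sequence:
  assumes "\<not> eventually P narrow"
  obtains z r where "\<forall>n::nat. \<not> P (z n)" "\<forall>n. 0 < r n" "r \<longlonglongrightarrow> 0"
    "(\<lambda>n. (1 / r n) *\<^sub>R (z n - x0)) \<longlonglongrightarrow> v0" "z \<longlonglongrightarrow> x0"
proof -
  define d where "d n = inverse (real (Suc n))" for n
  have d0: "d \<longlonglongrightarrow> 0" unfolding d_def by (rule LIMSEQ_inverse_real_of_nat)
  have "\<exists>z r. \<not> P z \<and> 0 < r \<and> r < d n \<and> norm (z - x0 - r *\<^sub>R v0) \<le> d n * r" for n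
  proof -
    have "d n > 0" by (simp add: d_def)
    then obtain z where "z \<in> thin_cone (d n)" "\<not> P z" using assms by (auto simp: eventually_narrow)
    then show ?thesis unfolding thin_cone_def by force
  qed
  then obtain z r where zr: "\<And>n. \<not> P (z n)" "\<And>n. 0 < r n" "\<And>n. r n < d n"
    "\<And>n. norm (z n - x0 - r n *\<^sub>R v0) \<le> d n * r n" by metis
  have r0: "r \<longlonglongrightarrow> 0"
    by (rule real_tendsto_sandwich[OF _ _ tendsto_const d0])
      (use zr in \<open>auto intro!: always_eventually less_imp_le\<close>)
  have z_eq: "z n = x0 + r n *\<^sub>R ((1 / r n) *\<^sub>R (z n - x0))" for n using zr(2)[of n] by simp
  have "norm ((1 / r n) *\<^sub>R (z n - x0) - v0) \<le> d n" for n
  proof -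
    have "r n * norm ((1 / r n) *\<^sub>R (z n - x0) - v0) = norm (r n *\<^sub>R ((1 / r n) *\<^sub>R (z n - x0) - v0))"
      using zr(2)[of n] by simp
    also have "\<dots> = norm (z n - x0 - r n *\<^sub>R v0)" using zr(2)[of n] by (simp add: scaleR_diff_right)
    also have "\<dots> \<le> r n * d n" using zr(4)[of n] by (simp add: mult.commute)
    finally show ?thesis using zr(2)[of n] by simp
  qed
  then have "(\<lambda>n. (1 / r n) *\<^sub>R (z n - x0) - v0) \<longlonglongrightarrow> 0"
    using d0 by (rule Lim_null_comparison[OF always_eventually[OF allI]])
  then have \<xi>: "(\<lambda>n. (1 / r n) *\<^sub>R (z n - x0)) \<longlonglongrightarrow> v0" by (simp add: LIM_zero_iff)
  have "(\<lambda>n. x0 + r n *\<^sub>R ((1 / r n) *\<^sub>R (z n - x0))) \<longlonglongrightarrow> x0 + 0 *\<^sub>R v0"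
    by (intro tendsto_intros r0 \<xi>)
  then have "z \<longlonglongrightarrow> x0" unfolding z_eq[symmetric] by simp
  with that zr(1,2) r0 \<xi> show ?thesis by blast
qed

lemma narrow_le_nhds: "narrow \<le> nhds x0"
proof (rule filter_leI, rule ccontr)
  fix P assume "eventually P (nhds x0)" "\<not> eventually P narrow"
  from narrow_sequence[OF this(2)] obtain z where z: "\<forall>n::nat. \<not> P (z n)" "z \<longlonglongrightarrow> x0" by metis
  then have "\<forall>\<^sub>F n in sequentially. P (z n)"
    using \<open>eventually P (nhds x0)\<close> by (auto simp: filterlim_iff)
  then show False using z(1) by simp
qed

lemma eventually_B_nhds: "\<forall>\<^sub>F z in nhds x0. z \<in> B"
  using open_B x0 by (rule eventually_nhds_in_open)

lemma narrow_B: "\<forall>\<^sub>F z in narrow. z \<in> B"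
  using eventually_B_nhds narrow_le_nhds by (rule filter_leD[rotated])

text \<open>\<open>W\<close> consists of pairs, so that open conditions involving both
  \<open>z\<close> and \<open>q\<close>, such as bounds on \<open>G z q\<close>, carry over from
  \<open>x0\<close> without further estimates.\<close>

lemma nhds_upper_semicontinuous:
  assumes W: "open W" "\<And>q. q \<in> D x0 \<Longrightarrow> (x0, q) \<in> W"
  shows "\<forall>\<^sub>F z in nhds x0. \<forall>q\<in>D z. (z, q) \<in> W"
proof (rule ccontr)
  assume neg: "\<not> ?thesis"
  from open_B x0 obtain e where e: "e > 0" "ball x0 e \<subseteq> B" by (auto elim: openE)
  define d where "d n = min e (inverse (real (Suc n)))" for n
  have "\<exists>z q. dist z x0 < d n \<and> q \<in> D z \<and> (z, q) \<notin> W" for n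
  proof -
    have "d n > 0" using e by (simp add: d_def)
    then show ?thesis using neg unfolding eventually_nhds_metric by blast
  qed
  then obtain z q where zq: "\<And>n. dist (z n) x0 < d n" "\<And>n. q n \<in> D (z n)" "\<And>n. (z n, q n) \<notin> W"
    by metis
  have "norm (dist (z n) x0) \<le> inverse (real (Suc n))" for n
    using zq(1)[of n] by (simp add: d_def)
  then have "(\<lambda>n. dist (z n) x0) \<longlonglongrightarrow> 0"
    using LIMSEQ_inverse_real_of_nat by (rule Lim_null_comparison[OF always_eventually[OF allI]])
  then have z: "z \<longlonglongrightarrow> x0" by (rule tendsto_dist_iff[THEN iffD2])
  have "z n \<in> B" for n using zq(1)[of n] by (intro subsetD[OF e(2)]) (simp add: d_def dist_commute)
  from D_subseq[OF z x0 this zq(2)] obtain r q' where r: "strict_mono r" "(q \<circ> r) \<longlonglongrightarrow> q'" "q' \<in> D x0" .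
  have "(\<lambda>n. (z (r n), (q \<circ> r) n)) \<longlonglongrightarrow> (x0, q')"
    using LIMSEQ_subseq_LIMSEQ[OF z r(1)] r(2) by (intro tendsto_Pair) (auto simp: o_def)
  then have "\<forall>\<^sub>F n in sequentially. (z (r n), (q \<circ> r) n) \<in> W"
    by (rule topological_tendstoD) (use W r(3) in blast)+
  then obtain n where "(z (r n), (q \<circ> r) n) \<in> W"
    using eventually_happens'[OF sequentially_bot] by meson
  with zq(3)[of "r n"] show False unfolding comp_apply by (rule notE)
qed

text \<open>Approach along \<open>v0\<close> selects a face: monotonicity against \<open>p0\<close>,
  divided by the scale, yields \<open>(q' - p0) \<bullet> v0 \<le> 0\<close> for every limit
  \<open>q'\<close>, and \<open>face_subset_segment\<close> applies.\<close>

lemma narrow_upper_semicontinuous: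
  assumes ab: "ends a b" and W: "open W" "\<And>q. q \<in> closed_segment a b \<Longrightarrow> (x0, q) \<in> W"
  shows "\<forall>\<^sub>F z in narrow. \<forall>q\<in>D z. (z, q) \<in> W"
proof (rule ccontr)
  assume neg: "\<not> ?thesis"
  \<comment> \<open>Membership in \<open>B\<close> is built into the property so that the failing
    sequence lies in \<open>B\<close>.\<close>
  have "\<not> (\<forall>\<^sub>F z in narrow. z \<in> B \<longrightarrow> (\<forall>q\<in>D z. (z, q) \<in> W))"
  proof
    assume "\<forall>\<^sub>F z in narrow. z \<in> B \<longrightarrow> (\<forall>q\<in>D z. (z, q) \<in> W)"
    from eventually_mp[OF this narrow_B] neg show False by (rule notE[rotated])
  qed
  from narrow_sequence[OF this] obtain z r where
    zr: "\<forall>n::nat. \<not> (z n \<in> B \<longrightarrow> (\<forall>q\<in>D (z n). (z n, q) \<in> W))"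
      "\<forall>n. 0 < r n" "r \<longlonglongrightarrow> 0" "(\<lambda>n. (1 / r n) *\<^sub>R (z n - x0)) \<longlonglongrightarrow> v0" "z \<longlonglongrightarrow> x0" .
  have zB: "z n \<in> B" and "\<exists>q\<in>D (z n). (z n, q) \<notin> W" for n using zr(1) by blast+
  then obtain q where q: "\<And>n. q n \<in> D (z n)" "\<And>n. (z n, q n) \<notin> W" by metis
  from D_subseq[OF zr(5) x0 zB q(1)] obtain \<rho> q' where \<rho>: "strict_mono \<rho>" "(q \<circ> \<rho>) \<longlonglongrightarrow> q'" "q' \<in> D x0" .
  define \<xi> where "\<xi> n = (1 / r n) *\<^sub>R (z n - x0)" for n
  have z_eq: "z n - x0 = r n *\<^sub>R \<xi> n" for n using zr(2)[rule_format, of n] by (simp add: \<xi>_def)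
  have \<xi>: "(\<xi> \<circ> \<rho>) \<longlonglongrightarrow> v0" using LIMSEQ_subseq_LIMSEQ[OF zr(4) \<rho>(1)] by (simp add: \<xi>_def o_def)
  have r\<rho>: "(r \<circ> \<rho>) \<longlonglongrightarrow> 0" using LIMSEQ_subseq_LIMSEQ[OF zr(3) \<rho>(1)] .
  have "(q n - p0) \<bullet> \<xi> n \<le> 2 * K * (r n * (norm (\<xi> n))\<^sup>2)" for n
  proof -
    have "r n * ((q n - p0) \<bullet> \<xi> n) \<le> r n * (2 * K * (r n * (norm (\<xi> n))\<^sup>2))"
      using D_monotone[OF x0 zB[of n] p0 q(1)[of n]]
      by (simp add: z_eq power_mult_distrib algebra_simps power2_eq_square)
    then show ?thesis using zr(2)[rule_format, of n] by simp
  qed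
  then have "\<forall>n. ((q \<circ> \<rho>) n - p0) \<bullet> (\<xi> \<circ> \<rho>) n \<le> 2 * K * ((r \<circ> \<rho>) n * (norm ((\<xi> \<circ> \<rho>) n))\<^sup>2)" by simp
  moreover have "(\<lambda>n. ((q \<circ> \<rho>) n - p0) \<bullet> (\<xi> \<circ> \<rho>) n) \<longlonglongrightarrow> (q' - p0) \<bullet> v0"
    by (intro tendsto_intros \<rho> \<xi>)
  moreover have "(\<lambda>n. 2 * K * ((r \<circ> \<rho>) n * (norm ((\<xi> \<circ> \<rho>) n))\<^sup>2)) \<longlonglongrightarrow> 2 * K * (0 * (norm v0)\<^sup>2)"
    by (intro tendsto_intros \<xi> r\<rho>)
  ultimately have "(q' - p0) \<bullet> v0 \<le> 2 * K * (0 * (norm v0)\<^sup>2)" by (intro LIMSEQ_le) auto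
  then have q': "q' \<in> closed_segment a b" using face_subset_segment[OF ab \<rho>(3)] by simp
  have "(\<lambda>n. (z (\<rho> n), (q \<circ> \<rho>) n)) \<longlonglongrightarrow> (x0, q')"
    using LIMSEQ_subseq_LIMSEQ[OF zr(5) \<rho>(1)] \<rho>(2) by (intro tendsto_Pair) (auto simp: o_def)
  then have "\<forall>\<^sub>F n in sequentially. (z (\<rho> n), (q \<circ> \<rho>) n) \<in> W"
    by (rule topological_tendstoD) (use W q' in blast)+
  then obtain n where "(z (\<rho> n), (q \<circ> \<rho>) n) \<in> W"
    using eventually_happens'[OF sequentially_bot] by meson
  with q(2)[of "\<rho> n"] show False unfolding comp_apply by (rule notE)
qed

lemma narrow_near_segment:
  assumes ab: "ends a b" and "0 < e"
  shows "\<forall>\<^sub>F z in narrow. \<forall>q\<in>D z. \<exists>s\<in>closed_segment a b. dist q s < e"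
proof -
  let ?W = "UNIV \<times> (\<Union>s\<in>closed_segment a b. ball s e) :: ((real^2) \<times> (real^2)) set"
  have "open ?W" by (intro open_Times open_UN) auto
  from narrow_upper_semicontinuous[OF ab this] \<open>0 < e\<close> show ?thesis
    by (force simp: dist_commute elim!: eventually_mono)
qed

text \<open>On the open segment \<open>H x0\<close> is negative, so \<open>H z q \<noteq> 0\<close>
  is an open condition that holds there; the two balls cover the ends.\<close>

lemma narrow_zero_level_near_ends:
  assumes ab: "ends a b" and "0 < e"
  shows "\<forall>\<^sub>F z in narrow. \<forall>q\<in>D z. H z q = 0 \<longrightarrow> dist q a < e \<or> dist q b < e"
proof -
  let ?W = "(B \<times> UNIV \<inter> (\<lambda>(z, p). H z p) -` (- {0})) \<union> UNIV \<times> ball a e \<union> UNIV \<times> ball b e"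
  have "open ?W"
    by (intro open_Un continuous_open_preimage[OF H_cont] open_Times open_B) auto
  moreover have "(x0, q) \<in> ?W" if "q \<in> closed_segment a b" for q
  proof (cases "q = a \<or> q = b")
    case False
    then have "q \<in> open_segment a b" using that by (auto simp: open_segment_def)
    then have "H x0 q \<noteq> 0" using H_neg_on_open_segment[OF ab] by force
    then show ?thesis using x0 by auto
  qed (use \<open>0 < e\<close> in auto)
  ultimately have "\<forall>\<^sub>F z in narrow. \<forall>q\<in>D z. (z, q) \<in> ?W" by (intro narrow_upper_semicontinuous[OF ab])
  then show ?thesis by (rule eventually_mono) (auto simp: dist_commute)
qed

text \<open>The point of \<open>D z\<close> farthest in direction \<open>b - a\<close> may be taken
  on the zero level, hence near \<open>a\<close> or \<open>b\<close>. Being on the \<open>a\<close>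
  side of \<open>p0\<close> it is near \<open>a\<close>, and then so is all of \<open>D z\<close>,
  which stays close to the segment.\<close>

lemma narrow_one_sided:
  assumes ab: "ends a b" and "0 < e"
  shows "\<forall>\<^sub>F z in narrow. (\<forall>q\<in>D z. (q - p0) \<bullet> (b - a) < 0) \<longrightarrow> (\<forall>q\<in>D z. dist q a < e)"
proof -
  define n where "n = norm (b - a)"
  have n: "n > 0" using ends_neq[OF ab] by (simp add: n_def)
  \<comment> \<open>The second bound keeps the \<open>k\<close>-ball around \<open>b\<close> on the
    \<open>b\<close> side of \<open>p0\<close>. The first leaves \<open>k\<close> for the distance
    from \<open>q\<close> to the segment and \<open>2 * k\<close> for the distance along the
    segment.\<close>
  define k where "k = min (e / 3) ((b - p0) \<bullet> (b - a) / n)"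
  have k: "k > 0" "3 * k \<le> e" "k * n \<le> (b - p0) \<bullet> (b - a)"
    using n ends_inner_pos[OF ab] \<open>0 < e\<close> by (auto simp: k_def min_def field_simps)
  have ip: "\<bar>(p - q) \<bullet> (b - a)\<bar> \<le> k * n" if "dist p q < k" for p q
  proof -
    have "\<bar>(p - q) \<bullet> (b - a)\<bar> \<le> norm (p - q) * n" unfolding n_def by (rule Cauchy_Schwarz_ineq2)
    also have "\<dots> \<le> k * n" using that n by (intro mult_right_mono) (auto simp: dist_norm)
    finally show ?thesis .
  qed
  show ?thesis
    using narrow_B narrow_near_segment[OF ab k(1)] narrow_zero_level_near_ends[OF ab k(1)]
  proof eventually_elim
    case (elim z)
    show ?case
    proof (intro impI ballI)
      fix q assume neg: "\<forall>q\<in>D z. (q - p0) \<bullet> (b - a) < 0" and q: "q \<in> D z"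
      obtain q1 where q1: "q1 \<in> D z" "H z q1 = 0" "\<And>q. q \<in> D z \<Longrightarrow> q \<bullet> (b - a) \<le> q1 \<bullet> (b - a)"
        using D_maximiser_on_zero_level[OF elim(1)] by blast
      have "\<not> dist q1 b < k"
      proof
        assume "dist q1 b < k"
        from ip[OF this] have "(q1 - p0) \<bullet> (b - a) \<ge> 0" using k(3) by (simp add: inner_diff_left)
        then show False using neg q1(1) by force
      qed
      then have "dist q1 a < k" using elim(3) q1 by blast
      from ip[OF this] q1(3)[OF q] have 1: "(q - a) \<bullet> (b - a) \<le> k * n" by (simp add: inner_diff_left)
      obtain s where s: "s \<in> closed_segment a b" "dist q s < k" using elim(2) q by blast
      then obtain t where t: "0 \<le> t" "s = (1 - t) *\<^sub>R a + t *\<^sub>R b" by (auto simp: in_segment)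
      have sa: "s - a = t *\<^sub>R (b - a)" using t by (simp add: algebra_simps)
      have "(s - a) \<bullet> (b - a) \<le> 2 * (k * n)" using ip[OF s(2)] 1 by (simp add: inner_diff_left)
      then have "(t * n) * n \<le> (2 * k) * n"
        by (simp add: sa n_def power2_norm_eq_inner[symmetric] power2_eq_square mult.assoc)
      then have "t * n \<le> 2 * k" using n by simp
      moreover have "dist s a = t * n" using t(1) by (simp add: dist_norm sa n_def)
      ultimately show "dist q a < e" using s(2) k(2) dist_triangle[of q a s] by linarith
    qed
  qed
qed

text \<open>Counterpart of \<open>narrow_one_sided\<close>: a single point on the \<open>b\<close>
  side keeps the extremal zero-level point on that side, away from \<open>a\<close>.\<close>

lemma narrow_far_end:
  assumes ab: "ends a b" and "0 < e"
  shows "\<forall>\<^sub>F z in narrow. (\<exists>q\<in>D z. 0 \<le> (q - p0) \<bullet> (b - a)) \<longrightarrow> (\<exists>q\<in>D z. dist q b < e)"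
proof -
  define n where "n = norm (b - a)"
  have n: "n > 0" using ends_neq[OF ab] by (simp add: n_def)
  define k where "k = min e ((p0 - a) \<bullet> (b - a) / n / 2)"
  have k: "k > 0" "k \<le> e" "k * n < (p0 - a) \<bullet> (b - a)"
    using n ends_inner_pos[OF ab] \<open>0 < e\<close> by (auto simp: k_def min_def field_simps)
  show ?thesis
    using narrow_B narrow_zero_level_near_ends[OF ab k(1)]
  proof eventually_elim
    case (elim z)
    show ?case
    proof
      assume "\<exists>q\<in>D z. 0 \<le> (q - p0) \<bullet> (b - a)"
      then obtain q where q: "q \<in> D z" "0 \<le> (q - p0) \<bullet> (b - a)" by blast
      obtain q1 where q1: "q1 \<in> D z" "H z q1 = 0" "\<And>q. q \<in> D z \<Longrightarrow> q \<bullet> (b - a) \<le> q1 \<bullet> (b - a)"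
        using D_maximiser_on_zero_level[OF elim(1)] by blast
      have "\<not> dist q1 a < k"
      proof
        assume "dist q1 a < k"
        have "(q1 - a) \<bullet> (b - a) \<le> norm (q1 - a) * n" unfolding n_def by (rule norm_cauchy_schwarz)
        also have "\<dots> \<le> k * n" using \<open>dist q1 a < k\<close> n by (intro mult_right_mono) (auto simp: dist_norm)
        finally show False using k(3) q(2) q1(3)[OF q(1)] by (simp add: inner_diff_left)
      qed
      then have "dist q1 b < e" using elim(2) q1 k(2) by fastforce
      then show "\<exists>q\<in>D z. dist q b < e" using q1 by blast
    qed
  qed
qed

end


section \<open>Characteristics\<close>

lemma LIMSEQ_if_dist_le_inverse_Suc:
  fixes f :: "nat \<Rightarrow> 'a::metric_space"
  assumes "\<And>n. dist (f n) l \<le> inverse (real (Suc n))"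
  shows "f \<longlonglongrightarrow> l"
proof (rule tendsto_dist_iff[THEN iffD2])
  show "(\<lambda>n. dist (f n) l) \<longlonglongrightarrow> 0"
    by (rule Lim_null_comparison[OF always_eventually[OF allI] LIMSEQ_inverse_real_of_nat])
      (use assms in simp)
qed

context hj_singular_point
begin

text \<open>Closedness in time makes the supremum of the times with a superdifferential in the
  half-space a time of the same kind.\<close>

lemma closed_superdiff_halfspace:
  fixes \<gamma> :: "real \<Rightarrow> real^2"
  assumes c: "continuous_on {s..t} \<gamma>" and B: "\<gamma> ` {s..t} \<subseteq> B"
  shows "closed {r \<in> {s..t}. \<exists>q\<in>D (\<gamma> r). k \<le> q \<bullet> w}"
  unfolding closed_sequential_limits
proof (intro allI impI)
  fix r l assume "(\<forall>n. r n \<in> {r \<in> {s..t}. \<exists>q\<in>D (\<gamma> r). k \<le> q \<bullet> w}) \<and> r \<longlonglongrightarrow> l"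
  then have r: "\<And>n. r n \<in> {s..t}" "\<And>n. \<exists>q\<in>D (\<gamma> (r n)). k \<le> q \<bullet> w" and l: "r \<longlonglongrightarrow> l" by auto
  have lst: "l \<in> {s..t}" using closed_sequentially[OF closed_atLeastAtMost r(1) l] .
  from r(2) obtain q where q: "\<And>n. q n \<in> D (\<gamma> (r n))" "\<And>n. k \<le> q n \<bullet> w" by metis
  have \<gamma>: "(\<lambda>n. \<gamma> (r n)) \<longlonglongrightarrow> \<gamma> l"
    using continuous_on_tendsto_compose[OF c l lst] r(1) by simp
  have "\<gamma> l \<in> B" "\<And>n. \<gamma> (r n) \<in> B" using B lst r(1) by auto
  from D_subseq[OF \<gamma> this q(1)] obtain \<rho> q' where \<rho>: "(q \<circ> \<rho>) \<longlonglongrightarrow> q'" "q' \<in> D (\<gamma> l)" by metis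
  have "(\<lambda>n. (q \<circ> \<rho>) n \<bullet> w) \<longlonglongrightarrow> q' \<bullet> w" by (intro tendsto_intros \<rho>)
  then have "k \<le> q' \<bullet> w" by (rule LIMSEQ_le_const) (use q(2) in auto)
  with \<rho> lst show "l \<in> {r \<in> {s..t}. \<exists>q\<in>D (\<gamma> r). k \<le> q \<bullet> w}" by auto
qed

lemma G_continuous_near:
  assumes "0 < e"
  obtains d where "0 < d" "\<And>z q. z \<in> B \<Longrightarrow> dist z x0 < d \<Longrightarrow> dist q a < d \<Longrightarrow> dist (G z q) (G x0 a) < e"
proof -
  let ?W = "(B \<times> UNIV) \<inter> (\<lambda>(z, p). G z p) -` ball (G x0 a) e"
  have "open ?W" by (intro continuous_open_preimage[OF G_cont] open_Times open_B) auto
  moreover have "(x0, a) \<in> ?W" using x0 assms by auto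
  ultimately obtain U V where UV: "open U" "open V" "(x0, a) \<in> U \<times> V" "U \<times> V \<subseteq> ?W"
    by (rule open_prod_elim)
  obtain d1 d2 where d: "0 < d1" "ball x0 d1 \<subseteq> U" "0 < d2" "ball a d2 \<subseteq> V"
    using UV(1-3) by (metis mem_Sigma_iff open_contains_ball)
  show ?thesis
  proof (rule that[of "min d1 d2"])
    fix z q assume "dist z x0 < min d1 d2" "dist q a < min d1 d2"
    then have "z \<in> U" "q \<in> V" using d by (auto simp: dist_commute subset_iff)
    then have "(z, q) \<in> ?W" using UV(4) by blast
    then show "dist (G z q) (G x0 a) < e" by (auto simp: dist_commute)
  qed (use d in auto)
qed

text \<open>
  Otherwise the superdifferential is concentrated near \<open>a\<close> at some time \<open>t\<close>. With \<open>s\<close> the last earlier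
  time at which it is not, the secant from \<open>\<gamma> s\<close> to \<open>\<gamma> t\<close> is almost parallel to \<open>G x0 a\<close>, against monotonicity.
\<close>

lemma generalized_characteristic_far_end:
  assumes ab: "ends a b" and T: "0 < T" and lip: "M-lipschitz_on {0..T} \<gamma>" and B: "\<gamma> ` {0..T} \<subseteq> B"
    and \<gamma>0: "\<gamma> 0 = x0" and N: "negligible N"
    and der: "\<And>t. t \<in> {0..T} - N \<Longrightarrow> \<exists>v\<in>convex hull (G (\<gamma> t) ` D (\<gamma> t)).
        (\<gamma> has_vector_derivative v) (at t within {0..T})"
    and narrow: "filterlim \<gamma> narrow (at_right 0)" and e: "0 < e"
  shows "\<forall>\<^sub>F t in at_right 0. \<exists>q\<in>D (\<gamma> t). dist q b < e"
proof -
  have nar: "\<forall>\<^sub>F t in at_right 0. P (\<gamma> t)" if "eventually P narrow" for P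
    using narrow that by (simp add: filterlim_iff)
  have "\<forall>\<^sub>F t in at_right 0. \<exists>q\<in>D (\<gamma> t). 0 \<le> (q - p0) \<bullet> (b - a)"
  proof (rule ccontr)
    assume neg: "\<not> ?thesis"
    \<comment> \<open>Each scale \<open>k\<close> yields one secant direction \<open>\<xi>\<close>
      over a time span \<open>h\<close>. As \<open>k\<close> tends to 0, these data tend to
      \<open>a\<close>, \<open>b\<close>, \<open>G x0 a\<close> and 0, and the last inequality
      contradicts \<open>G_ends_pos\<close>.\<close>
    have step: "\<exists>qa qb \<xi> h. dist qa a < k \<and> dist qb b < k \<and> dist \<xi> (G x0 a) \<le> k \<and> 0 < h \<and> h < k \<and>
        (qa - qb) \<bullet> \<xi> \<le> 2 * K * (h * (norm \<xi>)\<^sup>2)" if k: "0 < k" for k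
    proof -
      obtain d0 where d0: "0 < d0"
        "\<And>z q. z \<in> B \<Longrightarrow> dist z x0 < d0 \<Longrightarrow> dist q a < d0 \<Longrightarrow> dist (G z q) (G x0 a) < k"
        using G_continuous_near[OF k, of a] by blast
      define d where "d = min d0 k"
      have d: "0 < d" "d \<le> k" "d \<le> d0" using d0 k by (auto simp: d_def)
      have "\<forall>\<^sub>F z in narrow. dist z x0 < d0"
        using narrow_le_nhds d0(1) by (auto intro: filter_leD eventually_nhds_metric[THEN iffD2])
      then have "\<forall>\<^sub>F t in at_right 0. dist (\<gamma> t) x0 < d0 \<and>
          ((\<forall>q\<in>D (\<gamma> t). (q - p0) \<bullet> (b - a) < 0) \<longrightarrow> (\<forall>q\<in>D (\<gamma> t). dist q a < d)) \<and>
          ((\<exists>q\<in>D (\<gamma> t). 0 \<le> (q - p0) \<bullet> (b - a)) \<longrightarrow> (\<exists>q\<in>D (\<gamma> t). dist q b < k))"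
        by (intro nar eventually_conj narrow_one_sided[OF ab d(1)] narrow_far_end[OF ab k])
      then obtain t1 where "0 < t1" and all: "\<forall>t>0. t < t1 \<longrightarrow> dist (\<gamma> t) x0 < d0 \<and>
          ((\<forall>q\<in>D (\<gamma> t). (q - p0) \<bullet> (b - a) < 0) \<longrightarrow> (\<forall>q\<in>D (\<gamma> t). dist q a < d)) \<and>
          ((\<exists>q\<in>D (\<gamma> t). 0 \<le> (q - p0) \<bullet> (b - a)) \<longrightarrow> (\<exists>q\<in>D (\<gamma> t). dist q b < k))"
        unfolding eventually_at_right[OF zero_less_one] by blast
      then have t1: "\<And>t. 0 < t \<Longrightarrow> t < t1 \<Longrightarrow> dist (\<gamma> t) x0 < d0"
        "\<And>t. 0 < t \<Longrightarrow> t < t1 \<Longrightarrow> \<forall>q\<in>D (\<gamma> t). (q - p0) \<bullet> (b - a) < 0 \<Longrightarrow> \<forall>q\<in>D (\<gamma> t). dist q a < d"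
        "\<And>t. 0 < t \<Longrightarrow> t < t1 \<Longrightarrow> \<exists>q\<in>D (\<gamma> t). 0 \<le> (q - p0) \<bullet> (b - a) \<Longrightarrow> \<exists>q\<in>D (\<gamma> t). dist q b < k"
        by blast+
      define t2 where "t2 = min t1 (min k T)"
      have "t2 > 0" using \<open>0 < t1\<close> k T by (simp add: t2_def)
      then obtain t where t: "0 < t" "t < t2" "\<not> (\<exists>q\<in>D (\<gamma> t). 0 \<le> (q - p0) \<bullet> (b - a))"
        using neg unfolding eventually_at_right[OF zero_less_one] by meson
      have tk: "t < t1" "t < k" "t < T" using t by (auto simp: t2_def)
      define S where "S = {r \<in> {0..t}. \<exists>q\<in>D (\<gamma> r). p0 \<bullet> (b - a) \<le> q \<bullet> (b - a)}"
      have sub: "{0..t} \<subseteq> {0..T}" using tk by auto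
      have "closed S" unfolding S_def
        using lipschitz_on_continuous_on[OF lip] sub B
        by (intro closed_superdiff_halfspace) (auto intro: continuous_on_subset)
      \<comment> \<open>At time 0 the end \<open>b\<close> itself belongs to \<open>D x0\<close>, so
        there is an earlier time to look back to.\<close>
      moreover have "0 \<in> S"
        using ab ends_inner_pos(1)[OF ab] t unfolding S_def ends_def
        by (auto simp: \<gamma>0 inner_diff_left intro!: bexI[of _ b])
      moreover have bdd: "bdd_above S" unfolding S_def by (auto intro: bdd_aboveI[of _ t])
      ultimately have sS: "Sup S \<in> S" using closed_contains_Sup by blast
      define s where "s = Sup S"
      have s: "0 \<le> s" "s \<le> t" "\<exists>q\<in>D (\<gamma> s). 0 \<le> (q - p0) \<bullet> (b - a)"
        using sS by (auto simp: S_def s_def inner_diff_left)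
      then have "s < t" using t(3) by (cases "s = t") auto
      have after: "\<forall>q\<in>D (\<gamma> r). dist q a < d" if r: "s < r" "r \<le> t" for r
      proof -
        have "r \<notin> S" using cSup_upper[OF _ bdd, of r] r by (auto simp: s_def)
        then have "\<forall>q\<in>D (\<gamma> r). (q - p0) \<bullet> (b - a) < 0"
          using r s by (auto simp: S_def inner_diff_left not_le)
        with t1(2)[of r] r s tk show ?thesis by simp
      qed
      have line: "norm (\<gamma> t - \<gamma> s - (t - s) *\<^sub>R G x0 a) \<le> k * (t - s)"
      proof (rule curve_close_to_line[OF _ _ N])
        show "M-lipschitz_on {s..t} \<gamma>" using lip by (rule lipschitz_on_subset) (use s tk in auto)
        show "{s..t} \<subseteq> {0..T}" using s tk by auto
        fix r assume r: "r \<in> {s<..t} - N"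
        then obtain v where v: "v \<in> convex hull (G (\<gamma> r) ` D (\<gamma> r))"
          "(\<gamma> has_vector_derivative v) (at r within {0..T})" using der[of r] s tk by auto
        have r': "\<gamma> r \<in> B" "dist (\<gamma> r) x0 < d0" using B t1(1)[of r] r s tk by auto
        have "dist (G x0 a) (G (\<gamma> r) q) \<le> k" if "q \<in> D (\<gamma> r)" for q
        proof -
          have "dist q a < d0" using after[of r] that r d(3) by fastforce
          from d0(2)[OF r' this] show ?thesis by (simp add: dist_commute)
        qed
        then have "G (\<gamma> r) ` D (\<gamma> r) \<subseteq> cball (G x0 a) k" by auto
        \<comment> \<open>The velocity is only known to lie in the convex hull of values of
          \<open>G\<close>; since balls are convex, it inherits their closeness to
          \<open>G x0 a\<close>.\<close>
        then have "v \<in> cball (G x0 a) k" using v(1) hull_minimal[of _ _ convex] convex_cball by blast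
        then show "\<exists>v. (\<gamma> has_vector_derivative v) (at r within {0..T}) \<and> norm (v - G x0 a) \<le> k"
          using v(2) by (auto simp: dist_norm norm_minus_commute)
      qed (use s in auto)
      have \<gamma>B: "\<gamma> s \<in> B" "\<gamma> t \<in> B" using B s tk t by auto
      obtain qa where qa: "qa \<in> D (\<gamma> t)" using D_minimiser_on_zero_level[OF \<gamma>B(2)] by blast
      then have "dist qa a < k" using after[of t] \<open>s < t\<close> d(2) by auto
      \<comment> \<open>The cone estimates are available at positive times only; at time 0 the end
        \<open>b\<close> itself serves.\<close>
      obtain qb where qb: "qb \<in> D (\<gamma> s)" "dist qb b < k"
      proof (cases "s = 0")
        case True
        then show ?thesis using that[of b] ab k by (auto simp: ends_def \<gamma>0)
      next
        case False
        then show ?thesis using that t1(3)[of s] s tk by auto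
      qed
      define h where "h = t - s"
      define \<xi> where "\<xi> = (1 / h) *\<^sub>R (\<gamma> t - \<gamma> s)"
      have h: "0 < h" "h < k" using \<open>s < t\<close> s tk by (auto simp: h_def)
      have \<xi>: "\<gamma> t - \<gamma> s = h *\<^sub>R \<xi>" using h by (simp add: \<xi>_def)
      have "h * norm (\<xi> - G x0 a) = norm (h *\<^sub>R (\<xi> - G x0 a))" using h by simp
      also have "\<dots> \<le> h * k" using line by (simp add: \<xi> h_def[symmetric] scaleR_diff_right mult.commute)
      finally have "dist \<xi> (G x0 a) \<le> k" using h by (simp add: dist_norm)
      moreover have "h * ((qa - qb) \<bullet> \<xi>) \<le> h * (2 * K * (h * (norm \<xi>)\<^sup>2))"
        using D_monotone[OF \<gamma>B qb(1) qa]
        by (simp add: \<xi> power_mult_distrib algebra_simps power2_eq_square)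
      then have "(qa - qb) \<bullet> \<xi> \<le> 2 * K * (h * (norm \<xi>)\<^sup>2)" using h by simp
      ultimately show ?thesis using h qb(2) \<open>dist qa a < k\<close> by blast
    qed
    obtain qa qb \<xi> h where q: "\<And>n. dist (qa n) a < inverse (real (Suc n))"
      "\<And>n. dist (qb n) b < inverse (real (Suc n))" "\<And>n. dist (\<xi> n) (G x0 a) \<le> inverse (real (Suc n))"
      "\<And>n. 0 < h n" "\<And>n. h n < inverse (real (Suc n))"
      "\<And>n. (qa n - qb n) \<bullet> \<xi> n \<le> 2 * K * (h n * (norm (\<xi> n))\<^sup>2)"
      using step[OF positive_imp_inverse_positive[OF of_nat_0_less_iff[THEN iffD2, OF zero_less_Suc]]]
      by metis
    have "qa \<longlonglongrightarrow> a" "qb \<longlonglongrightarrow> b" using q(1,2) by (intro LIMSEQ_if_dist_le_inverse_Suc less_imp_le; blast)+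
    moreover have \<xi>: "\<xi> \<longlonglongrightarrow> G x0 a" using q(3) by (rule LIMSEQ_if_dist_le_inverse_Suc)
    ultimately have "(\<lambda>n. (qa n - qb n) \<bullet> \<xi> n) \<longlonglongrightarrow> (a - b) \<bullet> G x0 a" by (intro tendsto_intros)
    moreover have "h \<longlonglongrightarrow> 0" 
    proof (rule LIMSEQ_if_dist_le_inverse_Suc)
      show "dist (h n) 0 \<le> inverse (real (Suc n))" for n using q(4,5)[of n] by simp
    qed
    then have "(\<lambda>n. 2 * K * (h n * (norm (\<xi> n))\<^sup>2)) \<longlonglongrightarrow> 2 * K * (0 * (norm (G x0 a))\<^sup>2)"
      by (intro tendsto_intros \<xi>)
    ultimately have "(a - b) \<bullet> G x0 a \<le> 2 * K * (0 * (norm (G x0 a))\<^sup>2)"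
      by (rule LIMSEQ_le) (use q(6) in auto)
    then show False using G_ends_pos[OF ab] by simp
  qed
  moreover have "\<forall>\<^sub>F t in at_right 0. (\<exists>q\<in>D (\<gamma> t). 0 \<le> (q - p0) \<bullet> (b - a)) \<longrightarrow> (\<exists>q\<in>D (\<gamma> t). dist q b < e)"
    by (rule nar[OF narrow_far_end[OF ab e]])
  ultimately show ?thesis by (rule eventually_rev_mp)
qed

end


section \<open>Tangency and two-point estimates for strict characteristics\<close>

context hj_singular_point
begin

lemma narrow_if_tangent:
  assumes "\<And>e. 0 < e \<Longrightarrow> \<forall>\<^sub>F t in at_right 0. norm (\<gamma> t - x0 - t *\<^sub>R v0) \<le> e * t"
  shows "filterlim \<gamma> narrow (at_right 0)"
  unfolding filterlim_iff
proof (intro allI impI)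
  fix P assume "eventually P narrow"
  then obtain d where d: "0 < d" "\<And>z. z \<in> thin_cone d \<Longrightarrow> P z" by (auto simp: eventually_narrow)
  have "\<forall>\<^sub>F t in at_right 0. t \<in> {0<..<d}"
    using d(1) by (auto simp: eventually_at_right[OF zero_less_one])
  with assms[OF d(1)] show "\<forall>\<^sub>F t in at_right 0. P (\<gamma> t)"
    by eventually_elim (rule d(2), unfold thin_cone_def, blast)
qed

lemma compact_D: "z \<in> B \<Longrightarrow> compact (D z)"
  unfolding compact_def
proof (intro allI impI)
  fix f :: "nat \<Rightarrow> real^2" assume z: "z \<in> B" and f: "\<forall>n. f n \<in> D z"
  then show "\<exists>l\<in>D z. \<exists>r. strict_mono r \<and> (f \<circ> r) \<longlonglongrightarrow> l"
    using D_subseq[of "\<lambda>_. z" z f] by (metis tendsto_const)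
qed

lemma G_x0_cont: "continuous_on S (G x0)"
proof -
  have "continuous_on S (\<lambda>p. (\<lambda>(z, p). G z p) (x0, p))"
    by (rule continuous_on_compose2[OF G_cont]) (auto intro!: continuous_intros simp: x0)
  then show ?thesis by simp
qed

text \<open>At \<open>x0\<close> the pairing is positive except at \<open>p0\<close>, where the
  defect vanishes. Where the defect is at least \<open>e\<close>, compactness keeps the pairing away
  from 0, so a large multiple of it dominates; elsewhere \<open>e\<close> suffices. The strict
  inequality then extends to nearby \<open>z\<close> by upper semicontinuity.\<close>

lemma velocity_defect_le_pairing:
  assumes e: "0 < e"
  obtains A where "0 \<le> A" "\<forall>\<^sub>F z in nhds x0. \<forall>q\<in>D z. norm (G z q - v0) < e + A * ((q - p0) \<bullet> G z q)"
proof -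
  let ?n = "\<lambda>q. norm (G x0 q - v0)" and ?g = "\<lambda>q. (q - p0) \<bullet> G x0 q"
  define C where "C = D x0 \<inter> ?n -` {e..}"
  have C: "compact C"
    unfolding C_def
    by (intro compact_Int_closed compact_D x0 closed_vimage closed_atLeast continuous_intros G_x0_cont)
  have g0: "0 \<le> ?g q" if "q \<in> D x0" for q
    using G_pairing_pos[OF that] by (cases "q = p0") auto
  obtain A where A: "0 \<le> A" "\<And>q. q \<in> D x0 \<Longrightarrow> ?n q < e + A * ?g q"
  proof (cases "C = {}")
    case True
    then have "?n q < e + 0 * ?g q" if "q \<in> D x0" for q using that by (auto simp: C_def not_le)
    then show ?thesis using that[of 0] by blast
  next
    case False
    have cont: "continuous_on C ?n" "continuous_on C ?g"
      by (intro continuous_intros G_x0_cont)+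
    obtain q1 where q1: "q1 \<in> C" "\<And>q. q \<in> C \<Longrightarrow> ?g q1 \<le> ?g q"
      using continuous_attains_inf[OF C False cont(2)] by blast
    obtain q2 where q2: "q2 \<in> C" "\<And>q. q \<in> C \<Longrightarrow> ?n q \<le> ?n q2"
      using continuous_attains_sup[OF C False cont(1)] by blast
    have "q1 \<noteq> p0" using q1(1) e by (auto simp: C_def v0_def)
    then have g1: "0 < ?g q1" using q1(1) G_pairing_pos by (auto simp: C_def)
    show ?thesis
    \<comment> \<open>Largest defect on \<open>C\<close> divided by the smallest pairing
      there.\<close>
    proof (rule that[of "?n q2 / ?g q1"])
      show "0 \<le> ?n q2 / ?g q1" using g1 by simp
      fix q assume q: "q \<in> D x0"
      show "?n q < e + ?n q2 / ?g q1 * ?g q"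
      proof (cases "q \<in> C")
        case True
        have "?n q \<le> ?n q2 / ?g q1 * ?g q1" using q2(2)[OF True] g1 by simp
        also have "\<dots> \<le> ?n q2 / ?g q1 * ?g q" using q1(2)[OF True] g1 by (intro mult_left_mono) auto
        finally show ?thesis using e by linarith
      next
        case False
        then have "?n q < e" using q by (auto simp: C_def)
        moreover have "0 \<le> ?n q2 / ?g q1 * ?g q" using g1 g0[OF q] by (intro mult_nonneg_nonneg divide_nonneg_pos) auto
        ultimately show ?thesis by linarith
      qed
    qed
  qed
  let ?f = "\<lambda>x. norm ((\<lambda>(z, p). G z p) x - v0) - A * ((snd x - p0) \<bullet> (\<lambda>(z, p). G z p) x)"
  let ?W = "(B \<times> UNIV) \<inter> ?f -` {..<e}"
  have "open ?W"
    by (intro continuous_open_preimage continuous_intros G_cont open_Times open_B) auto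
  moreover have "(x0, q) \<in> ?W" if "q \<in> D x0" for q using A(2)[OF that] x0 by auto
  ultimately have "\<forall>\<^sub>F z in nhds x0. \<forall>q\<in>D z. (z, q) \<in> ?W" by (rule nhds_upper_semicontinuous)
  then have "\<forall>\<^sub>F z in nhds x0. \<forall>q\<in>D z. norm (G z q - v0) < e + A * ((q - p0) \<bullet> G z q)"
    by (rule eventually_mono) (auto simp: algebra_simps)
  with A(1) that show ?thesis by blast
qed

text \<open>
  Along a strict characteristic \<open>u (\<gamma> t) - p0 \<bullet> \<gamma> t\<close> grows at rate \<open>(p - p0) \<bullet> G (\<gamma> t) p\<close>, which by
  the previous lemma controls the deviation of the velocity from \<open>v0\<close>; semiconcavity makes the total
  growth quadratically small.
\<close>

lemma strict_characteristic_tangent: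
  assumes T: "0 < T" and lip: "M-lipschitz_on {0..T} \<gamma>" and B: "\<gamma> ` {0..T} \<subseteq> B"
    and \<gamma>0: "\<gamma> 0 = x0" and N: "negligible N"
    and der: "\<And>t. t \<in> {0..T} - N \<Longrightarrow> \<exists>q\<in>D (\<gamma> t). (\<gamma> has_vector_derivative G (\<gamma> t) q) (at t within {0..T})"
    and e: "0 < e"
  shows "\<forall>\<^sub>F t in at_right 0. norm (\<gamma> t - x0 - t *\<^sub>R v0) \<le> e * t"
proof -
  have M0: "0 \<le> M" using lipschitz_on_nonneg[OF lip] .
  have L0: "0 \<le> L" using lipschitz_on_nonneg[OF u_lip] .
  obtain A where A: "0 \<le> A"
    "\<forall>\<^sub>F z in nhds x0. \<forall>q\<in>D z. norm (G z q - v0) < e / 2 + A * ((q - p0) \<bullet> G z q)"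
    using velocity_defect_le_pairing[of "e / 2"] e by auto
  from A(2) obtain d where d: "0 < d"
    "\<And>z q. dist z x0 < d \<Longrightarrow> q \<in> D z \<Longrightarrow> norm (G z q - v0) < e / 2 + A * ((q - p0) \<bullet> G z q)"
    unfolding eventually_nhds_metric by blast
  have diff: "norm (\<gamma> t - \<gamma> s) \<le> M * \<bar>t - s\<bar>" if "s \<in> {0..T}" "t \<in> {0..T}" for s t
    using lipschitz_onD[OF lip that(2,1)] by (simp add: dist_norm)
  have main: "norm (\<gamma> t - x0 - t *\<^sub>R v0) \<le> e / 2 * t + A * K * M\<^sup>2 * t\<^sup>2"
    if t: "0 \<le> t" "t \<le> T" "M * t < d" for t
  proof -
    define w where "w = sgn (\<gamma> t - x0 - t *\<^sub>R v0)"
    have w1: "norm w \<le> 1" by (simp add: w_def norm_sgn)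
    \<comment> \<open>The slope of \<open>w \<bullet> \<gamma>\<close> exceeds
      \<open>w \<bullet> v0\<close> by at most \<open>e / 2\<close> plus \<open>A\<close> times the
      growth rate of the bracket, and subtracting that bracket compensates the excess.\<close>
    define f where "f s = w \<bullet> \<gamma> s - A * (u (\<gamma> s) - p0 \<bullet> \<gamma> s)" for s
    have "(M + A * (L * M + norm p0 * M))-lipschitz_on {0..t} f"
    proof (rule lipschitz_onI)
      fix s r assume sr: "s \<in> {0..t}" "r \<in> {0..t}"
      have 1: "norm (\<gamma> s - \<gamma> r) \<le> M * dist s r" using diff[of r s] sr t by (auto simp: dist_real_def)
      have "\<bar>w \<bullet> (\<gamma> s - \<gamma> r)\<bar> \<le> norm w * norm (\<gamma> s - \<gamma> r)" by (rule Cauchy_Schwarz_ineq2)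
      also have "\<dots> \<le> M * dist s r" using mult_mono[OF w1 1] M0 by simp
      finally have 2: "\<bar>w \<bullet> (\<gamma> s - \<gamma> r)\<bar> \<le> M * dist s r" .
      have "\<bar>p0 \<bullet> (\<gamma> s - \<gamma> r)\<bar> \<le> norm p0 * norm (\<gamma> s - \<gamma> r)" by (rule Cauchy_Schwarz_ineq2)
      also have "\<dots> \<le> norm p0 * (M * dist s r)" using 1 by (intro mult_left_mono) auto
      finally have 3: "\<bar>p0 \<bullet> (\<gamma> s - \<gamma> r)\<bar> \<le> norm p0 * (M * dist s r)" .
      have "\<gamma> s \<in> B" "\<gamma> r \<in> B" using B sr t by auto
      then have "\<bar>u (\<gamma> s) - u (\<gamma> r)\<bar> \<le> L * norm (\<gamma> s - \<gamma> r)"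
        using lipschitz_onD[OF u_lip] by (simp add: dist_norm)
      also have "\<dots> \<le> L * (M * dist s r)" using 1 L0 by (intro mult_left_mono) auto
      finally have 4: "\<bar>u (\<gamma> s) - u (\<gamma> r)\<bar> \<le> L * (M * dist s r)" .
      have "\<bar>(u (\<gamma> s) - u (\<gamma> r)) - p0 \<bullet> (\<gamma> s - \<gamma> r)\<bar> \<le> L * (M * dist s r) + norm p0 * (M * dist s r)"
        using 3 4 by linarith
      from mult_left_mono[OF this A(1)]
      have 5: "\<bar>A * ((u (\<gamma> s) - u (\<gamma> r)) - p0 \<bullet> (\<gamma> s - \<gamma> r))\<bar>
          \<le> A * (L * (M * dist s r) + norm p0 * (M * dist s r))" using A(1) by (simp add: abs_mult)
      have "f s - f r = w \<bullet> (\<gamma> s - \<gamma> r) - A * ((u (\<gamma> s) - u (\<gamma> r)) - p0 \<bullet> (\<gamma> s - \<gamma> r))"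
        by (simp add: f_def inner_diff_right algebra_simps)
      then have "dist (f s) (f r) \<le> M * dist s r + A * (L * (M * dist s r) + norm p0 * (M * dist s r))"
        unfolding dist_real_def[of "f s"] using 2 5 by linarith
      then show "dist (f s) (f r) \<le> (M + A * (L * M + norm p0 * M)) * dist s r" by (simp add: algebra_simps)
    qed (use M0 L0 A in simp)
    then have "f t - f 0 \<le> (w \<bullet> v0 + e / 2) * (t - 0)"
    proof (rule curve_mean_value_le[OF _ t(1) N])
      show "{0..t} \<subseteq> {0..T}" using t by auto
      fix r assume r: "r \<in> {0<..t} - N"
      then obtain q where q: "q \<in> D (\<gamma> r)"
        and v: "(\<gamma> has_vector_derivative G (\<gamma> r) q) (at r within {0..T})" using der[of r] t by auto
      let ?v = "G (\<gamma> r) q" and ?w = "w - A *\<^sub>R (q - p0)"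
      have "f r - f s \<le> ?w \<bullet> (\<gamma> r - \<gamma> s) + A * K * (norm (\<gamma> r - \<gamma> s))\<^sup>2" if s: "s \<in> {0..<r}" for s
      proof -
        \<comment> \<open>The superdifferential at the later point \<open>\<gamma> r\<close> is
          tested at the earlier one; with \<open>A\<close> nonnegative this bounds the backward
          increment of \<open>- A * u\<close> from above.\<close>
        have "\<gamma> s \<in> B" using B s r t by auto
        from mult_left_mono[OF D_le[OF q this] A(1)]
        show ?thesis
          by (simp add: f_def inner_diff_left inner_diff_right norm_minus_commute[of "\<gamma> s"] algebra_simps)
      qed
      moreover have "?w \<bullet> ?v \<le> w \<bullet> v0 + e / 2"
      proof -
        have "dist (\<gamma> r) x0 \<le> M * r" using diff[of 0 r] r t T by (auto simp: \<gamma>0 dist_norm)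
        also have "\<dots> \<le> M * t" using r M0 by (intro mult_left_mono) auto
        finally have "norm (?v - v0) < e / 2 + A * ((q - p0) \<bullet> ?v)" using t(3) d(2) q by simp
        moreover have "w \<bullet> (?v - v0) \<le> norm w * norm (?v - v0)" by (rule norm_cauchy_schwarz)
        moreover have "norm w * norm (?v - v0) \<le> norm (?v - v0)" using mult_right_mono[OF w1, of "norm (?v - v0)"] by simp
        ultimately have "w \<bullet> (?v - v0) \<le> e / 2 + A * ((q - p0) \<bullet> ?v)" by linarith
        then show ?thesis by (simp add: inner_diff_left inner_diff_right algebra_simps)
      qed
      ultimately show "\<exists>v w' K'. (\<gamma> has_vector_derivative v) (at r within {0..T}) \<and>
          (\<forall>s\<in>{0..<r}. f r - f s \<le> w' \<bullet> (\<gamma> r - \<gamma> s) + K' * (norm (\<gamma> r - \<gamma> s))\<^sup>2) \<and> w' \<bullet> v \<le> w \<bullet> v0 + e / 2"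
        using v by blast
    qed
    moreover have "w \<bullet> (\<gamma> t - x0 - t *\<^sub>R v0) = norm (\<gamma> t - x0 - t *\<^sub>R v0)"
      by (simp add: w_def sgn_div_norm power2_norm_eq_inner[symmetric] power2_eq_square divide_simps)
    ultimately have 1: "norm (\<gamma> t - x0 - t *\<^sub>R v0) \<le> e / 2 * t + A * (u (\<gamma> t) - u x0 - p0 \<bullet> (\<gamma> t - x0))"
      by (simp add: f_def \<gamma>0 inner_diff_right algebra_simps)
    have "\<gamma> t \<in> B" using B t by auto
    from D_le[OF p0 this] have "u (\<gamma> t) - u x0 - p0 \<bullet> (\<gamma> t - x0) \<le> K * (norm (\<gamma> t - x0))\<^sup>2" by simp
    also have "\<dots> \<le> K * (M * t)\<^sup>2"
      using diff[of 0 t] t T K_nonneg by (intro mult_left_mono power_mono) (auto simp: \<gamma>0)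
    finally show ?thesis using 1 mult_left_mono[OF _ A(1)] by (fastforce simp: power_mult_distrib mult.assoc)
  qed
  define c where "c = A * K * M\<^sup>2"
  have c0: "0 \<le> c" using A(1) K_nonneg by (simp add: c_def)
  \<comment> \<open>The constraints give \<open>M * t < d\<close>, so that the defect estimate holds
    up to time \<open>t\<close>, and \<open>c * t \<le> e / 2\<close>, which turns the quadratic
    remainder into the second half of \<open>e * t\<close>.\<close>
  define t0 where "t0 = min T (min (d / (M + 1)) (e / (2 * (c + 1))))"
  have "0 < t0" using T d e c0 M0 by (auto simp: t0_def)
  moreover have "norm (\<gamma> t - x0 - t *\<^sub>R v0) \<le> e * t" if t: "0 < t" "t < t0" for t
  proof -
    have "t < d / (M + 1)" "t < e / (2 * (c + 1))" "t \<le> T" using t by (auto simp: t0_def)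
    then have "t * (M + 1) < d" "t * (2 * (c + 1)) < e" using M0 c0 by (auto simp: field_simps)
    then have "M * t < d" "c * t \<le> e / 2" using t by (auto simp: algebra_simps)
    have "norm (\<gamma> t - x0 - t *\<^sub>R v0) \<le> e / 2 * t + (c * t) * t"
      using main[of t] t \<open>t \<le> T\<close> \<open>M * t < d\<close> by (simp add: c_def power2_eq_square mult.assoc)
    also have "(c * t) * t \<le> e / 2 * t" using \<open>c * t \<le> e / 2\<close> t by (intro mult_right_mono) auto
    finally show ?thesis by simp
  qed
  ultimately show ?thesis unfolding eventually_at_right[OF zero_less_one] by blast
qed

text \<open>On the segment, \<open>q - p0\<close> is a multiple of \<open>b - a\<close>, to which
  \<open>v0\<close> is orthogonal. Strict monotonicity of \<open>G x0\<close> therefore makes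
  \<open>(b - a) \<bullet> G x0 q\<close> nonzero unless \<open>q = p0\<close>, where the velocity
  is \<open>v0\<close>; compactness makes this quantitative.\<close>

lemma narrow_transversal_velocity:
  assumes ab: "ends a b" and e: "0 < e"
  obtains k where "0 < k"
    "\<forall>\<^sub>F z in narrow. \<forall>q\<in>D z. \<bar>(b - a) \<bullet> G z q\<bar> \<le> k \<longrightarrow> norm (G z q - v0) < e"
proof -
  let ?n = "\<lambda>q. norm (G x0 q - v0)" and ?g = "\<lambda>q. \<bar>(b - a) \<bullet> G x0 q\<bar>"
  define C where "C = closed_segment a b \<inter> ?n -` {e..}"
  have C: "compact C"
    unfolding C_def
    by (intro compact_Int_closed compact_segment closed_vimage closed_atLeast continuous_intros G_x0_cont)
  have pos: "0 < ?g q" if q: "q \<in> C" for q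
  proof -
    have "q \<noteq> p0" using q e by (auto simp: C_def v0_def)
    obtain s where s: "q = (1 - s) *\<^sub>R a + s *\<^sub>R b" using q by (auto simp: C_def in_segment)
    obtain t where t: "p0 = (1 - t) *\<^sub>R a + t *\<^sub>R b" using ab by (auto simp: ends_def in_segment)
    have qp: "q - p0 = (s - t) *\<^sub>R (b - a)" by (simp add: s t algebra_simps)
    have "0 < (q - p0) \<bullet> (G x0 q - v0)" unfolding v0_def by (rule G_monotone[OF x0 \<open>q \<noteq> p0\<close>])
    then have "(b - a) \<bullet> G x0 q \<noteq> 0"
      using ab by (auto simp: qp ends_def inner_diff_right)
    then show ?thesis by simp
  qed
  obtain k where k: "0 < k" "\<And>q. q \<in> C \<Longrightarrow> k < ?g q"
  proof (cases "C = {}")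
    case False
    have "continuous_on C ?g" by (intro continuous_intros G_x0_cont)
    from continuous_attains_inf[OF C False this]
    obtain q1 where q1: "q1 \<in> C" "\<And>q. q \<in> C \<Longrightarrow> ?g q1 \<le> ?g q" by blast
    show ?thesis
    proof (rule that[of "?g q1 / 2"])
      show "0 < ?g q1 / 2" using pos[OF q1(1)] by simp
      show "?g q1 / 2 < ?g q" if "q \<in> C" for q using q1(2)[OF that] pos[OF q1(1)] by linarith
    qed
  qed (use that[of 1] in auto)
  let ?W1 = "(B \<times> UNIV) \<inter> (\<lambda>x. norm ((\<lambda>(z, p). G z p) x - v0)) -` {..<e}"
  let ?W2 = "(B \<times> UNIV) \<inter> (\<lambda>x. \<bar>(b - a) \<bullet> (\<lambda>(z, p). G z p) x\<bar>) -` {k<..}"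
  have "open (?W1 \<union> ?W2)"
    by (intro open_Un continuous_open_preimage continuous_intros G_cont open_Times open_B) auto
  moreover have "(x0, q) \<in> ?W1 \<union> ?W2" if "q \<in> closed_segment a b" for q
    using k(2)[of q] x0 that by (cases "q \<in> C") (auto simp: C_def)
  ultimately have "\<forall>\<^sub>F z in narrow. \<forall>q\<in>D z. (z, q) \<in> ?W1 \<union> ?W2"
    by (rule narrow_upper_semicontinuous[OF ab])
  then have "\<forall>\<^sub>F z in narrow. \<forall>q\<in>D z. \<bar>(b - a) \<bullet> G z q\<bar> \<le> k \<longrightarrow> norm (G z q - v0) < e"
    by (rule eventually_mono) auto
  with k(1) that show ?thesis by blast
qed

text \<open>Allows monotonicity to be used as if \<open>b\<close> were in \<open>D z\<close> and
  \<open>a\<close> in \<open>D z'\<close>, at the price of the term with \<open>e\<close>.\<close>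

lemma near_ends_monotone:
  assumes B: "z \<in> B" "z' \<in> B" and p: "p \<in> D z" "dist p b < e" and q: "q \<in> D z'" "dist q a < e"
  shows "(a - b) \<bullet> (z' - z) \<le> 2 * K * (norm (z' - z))\<^sup>2 + 2 * e * norm (z' - z)"
proof -
  have "norm ((q - a) - (p - b)) \<le> 2 * e"
    using norm_triangle_ineq4[of "q - a" "p - b"] p(2) q(2) by (simp add: dist_norm)
  then have "norm ((q - a) - (p - b)) * norm (z' - z) \<le> 2 * e * norm (z' - z)"
    by (rule mult_right_mono) simp
  moreover have "\<bar>((q - a) - (p - b)) \<bullet> (z' - z)\<bar> \<le> norm ((q - a) - (p - b)) * norm (z' - z)"
    by (rule Cauchy_Schwarz_ineq2)
  moreover have "(a - b) \<bullet> (z' - z) = (q - p) \<bullet> (z' - z) - ((q - a) - (p - b)) \<bullet> (z' - z)"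
    by (simp add: inner_diff_left)
  ultimately show ?thesis using D_monotone[OF B p(1) q(1)] by linarith
qed

text \<open>Strict differentiability at 0 from the right with derivative \<open>v0\<close>: secants
  between any two small times are controlled, not only those from time 0. This makes the
  \<open>v0\<close>-coordinate of the curve bi-Lipschitz.\<close>

definition near_line :: "(real \<Rightarrow> real^2) \<Rightarrow> bool" where
  "near_line \<gamma> \<longleftrightarrow> (\<forall>e>0. \<exists>d>0. \<forall>s t. 0 \<le> s \<and> s \<le> t \<and> t \<le> d \<longrightarrow>
     norm (\<gamma> t - \<gamma> s - (t - s) *\<^sub>R v0) \<le> e * (t - s))"

lemma near_lineD:
  assumes "near_line \<gamma>" "0 < e"
  obtains d where "0 < d" "\<And>s t. 0 \<le> s \<Longrightarrow> s \<le> t \<Longrightarrow> t \<le> d \<Longrightarrow>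
    norm (\<gamma> t - \<gamma> s - (t - s) *\<^sub>R v0) \<le> e * (t - s)"
proof -
  from assms obtain d where "0 < d" "\<forall>s t. 0 \<le> s \<and> s \<le> t \<and> t \<le> d \<longrightarrow>
      norm (\<gamma> t - \<gamma> s - (t - s) *\<^sub>R v0) \<le> e * (t - s)" unfolding near_line_def by meson
  then show ?thesis by (intro that[of d]) auto
qed

lemma near_line_tangent:
  assumes "near_line \<gamma>" "\<gamma> 0 = x0" "0 < e"
  shows "\<forall>\<^sub>F t in at_right 0. norm (\<gamma> t - x0 - t *\<^sub>R v0) \<le> e * t"
proof -
  obtain d where d: "0 < d" "\<And>s t. 0 \<le> s \<Longrightarrow> s \<le> t \<Longrightarrow> t \<le> d \<Longrightarrow>
    norm (\<gamma> t - \<gamma> s - (t - s) *\<^sub>R v0) \<le> e * (t - s)"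
    using near_lineD[OF assms(1,3)] by metis
  have "norm (\<gamma> t - x0 - t *\<^sub>R v0) \<le> e * t" if "0 < t" "t < d" for t
    using d(2)[of 0 t] that assms(2) by simp
  with d(1) show ?thesis unfolding eventually_at_right[OF zero_less_one] by blast
qed

text \<open>With points near both ends at both times, monotonicity can be used with \<open>a\<close>
  and \<open>b\<close> exchanged, which bounds the secant along \<open>b - a\<close> from both
  sides. The velocity is a single value of \<open>G\<close>, as
  \<open>narrow_transversal_velocity\<close> requires; a convex combination of values is not covered
  by it.\<close>

lemma strict_characteristic_near_line:
  assumes ab: "ends a b"
    and T: "0 < T" and lip: "M-lipschitz_on {0..T} \<gamma>" and B: "\<gamma> ` {0..T} \<subseteq> B"
    and N: "negligible N"
    and der: "\<And>t. t \<in> {0..T} - N \<Longrightarrow> \<exists>q\<in>D (\<gamma> t). (\<gamma> has_vector_derivative G (\<gamma> t) q) (at t within {0..T})"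
    and narrow: "filterlim \<gamma> narrow (at_right 0)"
    and near_a: "\<And>e. 0 < e \<Longrightarrow> \<forall>\<^sub>F t in at_right 0. \<exists>q\<in>D (\<gamma> t). dist q a < e"
    and near_b: "\<And>e. 0 < e \<Longrightarrow> \<forall>\<^sub>F t in at_right 0. \<exists>q\<in>D (\<gamma> t). dist q b < e"
  shows "near_line \<gamma>"
  unfolding near_line_def
proof (intro allI impI)
  fix e :: real assume e: "0 < e"
  have M0: "0 \<le> M" using lipschitz_on_nonneg[OF lip] .
  obtain k where k: "0 < k"
    "\<forall>\<^sub>F z in narrow. \<forall>q\<in>D z. \<bar>(b - a) \<bullet> G z q\<bar> \<le> k \<longrightarrow> norm (G z q - v0) < e"
    using narrow_transversal_velocity[OF ab e] .
  \<comment> \<open>Error budget: half of \<open>k\<close> pays for the distance to the ends,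
    through \<open>2 * \<eta> * M\<close>; the other half is kept for the quadratic term, bounded by
    \<open>c * d\<close> below.\<close>
  define \<eta> where "\<eta> = k / (4 * (M + 1))"
  have \<eta>: "0 < \<eta>" "2 * \<eta> * M \<le> k / 2" using k(1) M0 by (auto simp: \<eta>_def field_simps)
  have "\<forall>\<^sub>F t in at_right 0. \<forall>q\<in>D (\<gamma> t). \<bar>(b - a) \<bullet> G (\<gamma> t) q\<bar> \<le> k \<longrightarrow> norm (G (\<gamma> t) q - v0) < e"
    using narrow k(2) unfolding filterlim_iff by blast
  with near_a[OF \<eta>(1)] near_b[OF \<eta>(1)] have "\<forall>\<^sub>F t in at_right 0.
      (\<exists>q\<in>D (\<gamma> t). dist q a < \<eta>) \<and> (\<exists>q\<in>D (\<gamma> t). dist q b < \<eta>) \<and>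
      (\<forall>q\<in>D (\<gamma> t). \<bar>(b - a) \<bullet> G (\<gamma> t) q\<bar> \<le> k \<longrightarrow> norm (G (\<gamma> t) q - v0) < e)"
    by eventually_elim blast
  then obtain t1 where "0 < t1" and all: "\<forall>t>0. t < t1 \<longrightarrow>
      (\<exists>q\<in>D (\<gamma> t). dist q a < \<eta>) \<and> (\<exists>q\<in>D (\<gamma> t). dist q b < \<eta>) \<and>
      (\<forall>q\<in>D (\<gamma> t). \<bar>(b - a) \<bullet> G (\<gamma> t) q\<bar> \<le> k \<longrightarrow> norm (G (\<gamma> t) q - v0) < e)"
    unfolding eventually_at_right[OF zero_less_one] by blast
  then have t1: "\<And>t. 0 < t \<Longrightarrow> t < t1 \<Longrightarrow> \<exists>q\<in>D (\<gamma> t). dist q a < \<eta>"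
    "\<And>t. 0 < t \<Longrightarrow> t < t1 \<Longrightarrow> \<exists>q\<in>D (\<gamma> t). dist q b < \<eta>"
    "\<And>t q. 0 < t \<Longrightarrow> t < t1 \<Longrightarrow> q \<in> D (\<gamma> t) \<Longrightarrow> \<bar>(b - a) \<bullet> G (\<gamma> t) q\<bar> \<le> k \<Longrightarrow> norm (G (\<gamma> t) q - v0) < e"
    by blast+
  define c where "c = 2 * K * M\<^sup>2"
  have c0: "0 \<le> c" using K_nonneg by (simp add: c_def)
  define d where "d = min (t1 / 2) (min T (k / (2 * (c + 1))))"
  have d: "0 < d" "d < t1" "d \<le> T" using \<open>0 < t1\<close> T k(1) c0 by (auto simp: d_def)
  have "d \<le> k / (2 * (c + 1))" by (simp add: d_def)
  then have "d * (2 * (c + 1)) \<le> k" using c0 by (subst (asm) pos_le_divide_eq) auto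
  then have cd: "c * d \<le> k / 2" using d(1) by (simp add: algebra_simps)
  have transversal: "\<bar>(b - a) \<bullet> (\<gamma> t - \<gamma> s)\<bar> \<le> k * (t - s)" if st: "0 < s" "s < t" "t \<le> d" for s t
  proof -
    have \<gamma>B: "\<gamma> s \<in> B" "\<gamma> t \<in> B" using B st d by auto
    have *: "(x - y) \<bullet> (\<gamma> t - \<gamma> s) \<le> k * (t - s)"
      if p: "p \<in> D (\<gamma> s)" "dist p y < \<eta>" and q: "q \<in> D (\<gamma> t)" "dist q x < \<eta>" for p q x y
    proof -
      let ?n = "norm (\<gamma> t - \<gamma> s)"
      have n: "?n \<le> M * (t - s)" using lipschitz_onD[OF lip, of t s] st d by (simp add: dist_norm)
      then have "?n\<^sup>2 \<le> (M * (t - s))\<^sup>2" by (intro power_mono) auto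
      then have "2 * K * ?n\<^sup>2 \<le> 2 * K * (M * (t - s))\<^sup>2" using K_nonneg by (intro mult_left_mono) auto
      also have "\<dots> = c * (t - s) * (t - s)" by (simp add: c_def power2_eq_square)
      also have "\<dots> \<le> c * d * (t - s)" using st c0 by (intro mult_right_mono mult_left_mono) auto
      also have "\<dots> \<le> k / 2 * (t - s)" using cd st by (intro mult_right_mono) auto
      finally have "2 * K * ?n\<^sup>2 \<le> k / 2 * (t - s)" .
      moreover have "2 * \<eta> * ?n \<le> 2 * \<eta> * M * (t - s)"
        using mult_left_mono[OF n, of "2 * \<eta>"] \<eta>(1) by (simp add: mult.assoc)
      moreover have "2 * \<eta> * M * (t - s) \<le> k / 2 * (t - s)" using \<eta>(2) st by (intro mult_right_mono) auto
      moreover have "k / 2 * (t - s) + k / 2 * (t - s) = k * (t - s)" by simp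
      ultimately show ?thesis using near_ends_monotone[OF \<gamma>B p q] by linarith
    qed
    obtain ps pt qs qt where "ps \<in> D (\<gamma> s)" "dist ps a < \<eta>" "pt \<in> D (\<gamma> t)" "dist pt a < \<eta>"
      "qs \<in> D (\<gamma> s)" "dist qs b < \<eta>" "qt \<in> D (\<gamma> t)" "dist qt b < \<eta>"
      using t1(1)[of s] t1(1)[of t] t1(2)[of s] t1(2)[of t] st d by auto
    then have "(a - b) \<bullet> (\<gamma> t - \<gamma> s) \<le> k * (t - s)" "(b - a) \<bullet> (\<gamma> t - \<gamma> s) \<le> k * (t - s)"
      using * by blast+
    then show ?thesis by (simp add: inner_diff_left abs_le_iff)
  qed
  have velocity: "\<exists>v. (\<gamma> has_vector_derivative v) (at t within {0..T}) \<and> norm (v - v0) \<le> e"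
    if t: "t \<in> {0<..d} - N" for t
  proof -
    obtain q where q: "q \<in> D (\<gamma> t)" and v: "(\<gamma> has_vector_derivative G (\<gamma> t) q) (at t within {0..T})"
      using der[of t] t d by auto
    \<comment> \<open>Starting at \<open>t / 2\<close> restricts the secants to positive times,
      where \<open>transversal\<close> applies.\<close>
    have sub: "{t / 2..<t} \<subseteq> {0..T}" using t d by auto
    have "((\<lambda>s. \<bar>(b - a) \<bullet> ((1 / (t - s)) *\<^sub>R (\<gamma> t - \<gamma> s))\<bar>) \<longlongrightarrow> \<bar>(b - a) \<bullet> G (\<gamma> t) q\<bar>)
        (at t within {t / 2..<t})"
      by (intro tendsto_intros backward_difference_quotient[OF v sub])
    moreover have "\<forall>\<^sub>F s in at t within {t / 2..<t}. \<bar>(b - a) \<bullet> ((1 / (t - s)) *\<^sub>R (\<gamma> t - \<gamma> s))\<bar> \<le> k"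
    proof -
      have "\<bar>(b - a) \<bullet> ((1 / (t - s)) *\<^sub>R (\<gamma> t - \<gamma> s))\<bar> \<le> k" if "s \<in> {t / 2..<t}" for s
        using transversal[of s t] t that by (simp add: abs_mult divide_simps)
      then show ?thesis by (auto simp: eventually_at_filter)
    qed
    moreover have "at t within {t / 2..<t} \<noteq> bot"
      using t by (auto simp: trivial_limit_within islimpt_Ico)
    ultimately have "\<bar>(b - a) \<bullet> G (\<gamma> t) q\<bar> \<le> k" by (intro tendsto_upperbound)
    then have "norm (G (\<gamma> t) q - v0) < e" using t1(3)[of t q] q t d by auto
    with v show ?thesis by (auto intro: less_imp_le)
  qed
  have "norm (\<gamma> t - \<gamma> s - (t - s) *\<^sub>R v0) \<le> e * (t - s)" if "0 \<le> s" "s \<le> t" "t \<le> d" for s t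
  proof (rule curve_close_to_line[OF _ that(2) N])
    show "M-lipschitz_on {s..t} \<gamma>" using lip by (rule lipschitz_on_subset) (use that d in auto)
    show "{s..t} \<subseteq> {0..T}" using that d by auto
  qed (use velocity that in auto)
  with d(1) show "\<exists>d>0. \<forall>s t. 0 \<le> s \<and> s \<le> t \<and> t \<le> d \<longrightarrow>
      norm (\<gamma> t - \<gamma> s - (t - s) *\<^sub>R v0) \<le> e * (t - s)" by (intro exI[of _ d]) auto
qed

end


section \<open>Reparametrisation\<close>

text \<open>\<open>\<phi>\<close> is \<open>\<alpha>\<close> followed by the inverse of
  \<open>\<beta>\<close>; slopes between \<open>1 / 2\<close> and 2 for both give slopes between
  \<open>1 / 4\<close> and 4 for \<open>\<phi>\<close>.\<close>

lemma bilipschitz_reparametrisation: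
  fixes \<alpha> \<beta> :: "real \<Rightarrow> real"
  assumes d: "0 < d" and zero: "\<alpha> 0 = 0" "\<beta> 0 = 0"
    and \<alpha>: "\<And>s t. 0 \<le> s \<Longrightarrow> s \<le> t \<Longrightarrow> t \<le> d \<Longrightarrow> (t - s) / 2 \<le> \<alpha> t - \<alpha> s \<and> \<alpha> t - \<alpha> s \<le> 2 * (t - s)"
    and \<beta>: "\<And>s t. 0 \<le> s \<Longrightarrow> s \<le> t \<Longrightarrow> t \<le> d \<Longrightarrow> (t - s) / 2 \<le> \<beta> t - \<beta> s \<and> \<beta> t - \<beta> s \<le> 2 * (t - s)"
  obtains \<sigma> \<phi> where "0 < \<sigma>" "\<sigma> \<le> d" "\<phi> 0 = 0" "bilipschitz_homeomorphism {0..\<sigma>} {0..\<phi> \<sigma>} \<phi>"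
    "\<And>s. 0 < s \<Longrightarrow> s \<le> \<sigma> \<Longrightarrow> 0 < \<phi> s \<and> \<phi> s \<le> d \<and> \<beta> (\<phi> s) = \<alpha> s"
proof -
  \<comment> \<open>Then \<open>\<alpha>\<close> is at most \<open>2 * \<sigma> = d / 2\<close>,
    which is at most \<open>\<beta> d\<close>, so its values lie in the range of
    \<open>\<beta>\<close>.\<close>
  define \<sigma> where "\<sigma> = d / 4"
  have \<sigma>: "0 < \<sigma>" "\<sigma> \<le> d" using d by (auto simp: \<sigma>_def)
  have "2-lipschitz_on {0..d} \<beta>"
  proof (rule lipschitz_on_leI)
    fix s t assume st: "s \<in> {0..d}" "t \<in> {0..d}" "s \<le> t"
    then have "(t - s) / 2 \<le> \<beta> t - \<beta> s" "\<beta> t - \<beta> s \<le> 2 * (t - s)" using \<beta>[of s t] by auto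
    then show "dist (\<beta> s) (\<beta> t) \<le> 2 * dist s t" using st by (auto simp: dist_real_def)
  qed simp
  then have cont: "continuous_on {0..d} \<beta>" by (rule lipschitz_on_continuous_on)
  have "\<exists>r. r \<in> {0..d} \<and> \<beta> r = \<alpha> s" if s: "s \<in> {0..\<sigma>}" for s
  proof -
    have "0 \<le> \<alpha> s" "\<alpha> s \<le> 2 * s" using \<alpha>[of 0 s] s \<sigma> zero by auto
    moreover have "d / 2 \<le> \<beta> d" using \<beta>[of 0 d] d zero by auto
    ultimately have "0 \<le> \<alpha> s" "\<alpha> s \<le> \<beta> d" using s by (auto simp: \<sigma>_def)
    then show ?thesis using IVT'[of \<beta> 0 "\<alpha> s" d] cont d zero by auto
  qed
  then obtain \<phi> where \<phi>: "\<And>s. s \<in> {0..\<sigma>} \<Longrightarrow> \<phi> s \<in> {0..d}" "\<And>s. s \<in> {0..\<sigma>} \<Longrightarrow> \<beta> (\<phi> s) = \<alpha> s"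
    by metis
  have incr: "(t - s) / 4 \<le> \<phi> t - \<phi> s \<and> \<phi> t - \<phi> s \<le> 4 * (t - s)"
    if st: "s \<in> {0..\<sigma>}" "t \<in> {0..\<sigma>}" "s \<le> t" for s t
  proof -
    have a: "(t - s) / 2 \<le> \<alpha> t - \<alpha> s" "\<alpha> t - \<alpha> s \<le> 2 * (t - s)" using \<alpha>[of s t] st \<sigma> by auto
    have "\<phi> s \<le> \<phi> t"
    proof (rule ccontr)
      assume "\<not> \<phi> s \<le> \<phi> t"
      then have lt: "\<phi> t < \<phi> s" by simp
      then have "(\<phi> s - \<phi> t) / 2 \<le> \<alpha> s - \<alpha> t"
        using \<beta>[of "\<phi> t" "\<phi> s"] \<phi>(1)[OF st(1)] \<phi>(1)[OF st(2)] \<phi>(2)[OF st(1)] \<phi>(2)[OF st(2)] by simp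
      moreover have "0 < (\<phi> s - \<phi> t) / 2" "0 \<le> (t - s) / 2" using lt st(3) by auto
      ultimately show False using a(1) by linarith
    qed
    then have "(\<phi> t - \<phi> s) / 2 \<le> \<alpha> t - \<alpha> s" "\<alpha> t - \<alpha> s \<le> 2 * (\<phi> t - \<phi> s)"
      using \<beta>[of "\<phi> s" "\<phi> t"] \<phi>(1)[OF st(1)] \<phi>(1)[OF st(2)] \<phi>(2)[OF st(1)] \<phi>(2)[OF st(2)] by auto
    with a show ?thesis by (auto simp: field_simps)
  qed
  have \<phi>0: "\<phi> 0 = 0"
  proof -
    have "\<phi> 0 \<in> {0..d}" "\<beta> (\<phi> 0) = 0" using \<phi>(1)[of 0] \<phi>(2)[of 0] \<sigma> zero by auto
    then show ?thesis using \<beta>[of 0 "\<phi> 0"] zero by auto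
  qed
  have lip: "4-lipschitz_on {0..\<sigma>} \<phi>"
  proof (rule lipschitz_on_leI)
    fix s t assume st: "s \<in> {0..\<sigma>}" "t \<in> {0..\<sigma>}" "s \<le> t"
    show "dist (\<phi> s) (\<phi> t) \<le> 4 * dist s t" using incr[OF st] st by (auto simp: dist_real_def)
  qed simp
  have expand: "dist s t \<le> 4 * dist (\<phi> s) (\<phi> t)" if st: "s \<in> {0..\<sigma>}" "t \<in> {0..\<sigma>}" for s t
    using incr[OF st] incr[OF st(2,1)] by (cases "s \<le> t") (auto simp: dist_real_def)
  have \<phi>cont: "continuous_on {0..\<sigma>} \<phi>" using lip by (rule lipschitz_on_continuous_on)
  have img: "\<phi> ` {0..\<sigma>} = {0..\<phi> \<sigma>}"
  proof
    show "\<phi> ` {0..\<sigma>} \<subseteq> {0..\<phi> \<sigma>}"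
    proof
      fix r assume "r \<in> \<phi> ` {0..\<sigma>}"
      then obtain s where s: "s \<in> {0..\<sigma>}" "r = \<phi> s" by blast
      have "0 \<le> (\<sigma> - s) / 4" using s by simp
      then show "r \<in> {0..\<phi> \<sigma>}" using incr[of s \<sigma>] \<phi>(1)[OF s(1)] s \<sigma> by auto
    qed
    show "{0..\<phi> \<sigma>} \<subseteq> \<phi> ` {0..\<sigma>}"
    proof
      fix r assume "r \<in> {0..\<phi> \<sigma>}"
      then show "r \<in> \<phi> ` {0..\<sigma>}" using IVT'[of \<phi> 0 r \<sigma>] \<phi>cont \<phi>0 \<sigma> by auto
    qed
  qed
  have inj: "inj_on \<phi> {0..\<sigma>}"
    by (rule inj_onI) (use expand in fastforce)
  obtain g where g: "homeomorphism {0..\<sigma>} {0..\<phi> \<sigma>} \<phi> g"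
    using homeomorphism_compact[OF compact_Icc \<phi>cont img inj] by blast
  have "4-lipschitz_on {0..\<phi> \<sigma>} g"
  proof (rule lipschitz_onI)
    fix r r' assume r: "r \<in> {0..\<phi> \<sigma>}" "r' \<in> {0..\<phi> \<sigma>}"
    have "g r \<in> {0..\<sigma>}" "g r' \<in> {0..\<sigma>}" "\<phi> (g r) = r" "\<phi> (g r') = r'"
      using g r unfolding homeomorphism_def by auto
    then show "dist (g r) (g r') \<le> 4 * dist r r'" using expand[of "g r" "g r'"] by simp
  qed simp
  with g lip have "bilipschitz_homeomorphism {0..\<sigma>} {0..\<phi> \<sigma>} \<phi>"
    unfolding bilipschitz_homeomorphism_def by blast
  moreover have "0 < \<phi> s \<and> \<phi> s \<le> d \<and> \<beta> (\<phi> s) = \<alpha> s" if "0 < s" "s \<le> \<sigma>" for s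
    using incr[of 0 s] \<phi>(1)[of s] \<phi>(2)[of s] that \<phi>0 by auto
  ultimately show ?thesis using that \<sigma> \<phi>0 by blast
qed

section \<open>Coincidence of the two curves\<close>

context hj_singular_point
begin

definition near_ends :: "real^2 \<Rightarrow> real^2 \<Rightarrow> (real \<Rightarrow> real^2) \<Rightarrow> bool" where
  "near_ends a b \<gamma> \<longleftrightarrow> (\<forall>e>0. \<forall>\<^sub>F t in at_right 0.
     \<gamma> t \<in> B \<and> (\<exists>q\<in>D (\<gamma> t). dist q a < e) \<and> (\<exists>q\<in>D (\<gamma> t). dist q b < e))"

text \<open>The coordinate is normalised so that motion with velocity \<open>v0\<close> has unit
  speed; accuracy \<open>norm v0 / 2\<close> in \<open>near_line\<close> then leaves slopes within
  \<open>1 / 2\<close> of 1.\<close>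

lemma near_line_coordinate:
  assumes "near_line \<gamma>"
  obtains d where "0 < d" "\<And>s t. 0 \<le> s \<Longrightarrow> s \<le> t \<Longrightarrow> t \<le> d \<Longrightarrow>
    (t - s) / 2 \<le> v0 \<bullet> \<gamma> t / (v0 \<bullet> v0) - v0 \<bullet> \<gamma> s / (v0 \<bullet> v0) \<and>
    v0 \<bullet> \<gamma> t / (v0 \<bullet> v0) - v0 \<bullet> \<gamma> s / (v0 \<bullet> v0) \<le> 2 * (t - s)"
proof -
  have v: "0 < norm v0" "0 < v0 \<bullet> v0" using v0_nonzero by auto
  obtain d where d: "0 < d" "\<And>s t. 0 \<le> s \<Longrightarrow> s \<le> t \<Longrightarrow> t \<le> d \<Longrightarrow>
    norm (\<gamma> t - \<gamma> s - (t - s) *\<^sub>R v0) \<le> norm v0 / 2 * (t - s)"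
    using near_lineD[OF assms, of "norm v0 / 2"] v by (metis half_gt_zero)
  show ?thesis
  proof (rule that[OF d(1)])
    fix s t assume st: "0 \<le> s" "s \<le> t" "t \<le> d"
    define h where "h = v0 \<bullet> \<gamma> t / (v0 \<bullet> v0) - v0 \<bullet> \<gamma> s / (v0 \<bullet> v0)"
    have "(v0 \<bullet> v0) * \<bar>h - (t - s)\<bar> = \<bar>v0 \<bullet> (\<gamma> t - \<gamma> s - (t - s) *\<^sub>R v0)\<bar>"
    proof -
      have "(v0 \<bullet> v0) * (h - (t - s)) = v0 \<bullet> (\<gamma> t - \<gamma> s - (t - s) *\<^sub>R v0)"
        using v(2) unfolding h_def
          by (simp add: inner_diff_right right_diff_distrib left_diff_distrib mult.commute del: inner_gt_zero_iff)
      then show ?thesis using v(2) by (metis abs_mult abs_of_pos)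
    qed
    also have "\<dots> \<le> norm v0 * (norm v0 / 2 * (t - s))"
      using Cauchy_Schwarz_ineq2 mult_left_mono[OF d(2)[OF st] norm_ge_zero] by (rule order_trans)
    also have "\<dots> = (v0 \<bullet> v0) * ((t - s) / 2)" by (simp add: power2_norm_eq_inner[symmetric] power2_eq_square)
    finally have "\<bar>h - (t - s)\<bar> \<le> (t - s) / 2" using v(2) by (simp del: inner_gt_zero_iff)
    then show "(t - s) / 2 \<le> v0 \<bullet> \<gamma> t / (v0 \<bullet> v0) - v0 \<bullet> \<gamma> s / (v0 \<bullet> v0) \<and>
      v0 \<bullet> \<gamma> t / (v0 \<bullet> v0) - v0 \<bullet> \<gamma> s / (v0 \<bullet> v0) \<le> 2 * (t - s)"
      unfolding h_def[symmetric] abs_le_iff using st(2) by auto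
  qed
qed

text \<open>Since \<open>z' - z\<close> is a multiple of \<open>b - a\<close>, Cauchy-Schwarz is an
  equality for their pairing, while monotonicity with both assignments of the ends permits only the
  smaller factor in \<open>close\<close>.\<close>

lemma same_coordinate_near_ends_eq:
  assumes ab: "ends a b" and B: "z \<in> B" "z' \<in> B" and perp: "(z' - z) \<bullet> v0 = 0"
    and close: "2 * K * norm (z' - z) + 2 * e < norm (b - a)"
    and p: "pa \<in> D z" "dist pa a < e" "pb \<in> D z" "dist pb b < e"
    and q: "qa \<in> D z'" "dist qa a < e" "qb \<in> D z'" "dist qb b < e"
  shows "z' = z"
proof (rule ccontr)
  assume "z' \<noteq> z"
  then have n: "0 < norm (z' - z)" by simp
  obtain c where c: "z' - z = c *\<^sub>R (b - a)"
    using orthogonal_vec2_collinear[OF v0_nonzero _ perp, of "b - a"] ab ends_neq[OF ab]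
    by (auto simp: ends_def)
  have "\<bar>(b - a) \<bullet> (z' - z)\<bar> = norm (z' - z) * norm (b - a)"
    by (simp add: c abs_mult power2_norm_eq_inner[symmetric] power2_eq_square)
  moreover have "\<bar>(b - a) \<bullet> (z' - z)\<bar> \<le> 2 * K * (norm (z' - z))\<^sup>2 + 2 * e * norm (z' - z)"
    using near_ends_monotone[OF B p(3,4) q(1,2)] near_ends_monotone[OF B p(1,2) q(3,4)]
    by (auto simp: abs_le_iff inner_diff_left)
  ultimately have "norm (z' - z) * norm (b - a) \<le> norm (z' - z) * (2 * K * norm (z' - z) + 2 * e)"
    by (simp add: power2_eq_square algebra_simps)
  then show False using n close by simp
qed

lemma near_line_curves_reparametrisation:
  assumes ab: "ends a b" and line: "near_line x" "near_line y" and zero: "x 0 = x0" "y 0 = x0"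
    and near: "near_ends a b x" "near_ends a b y" and T: "0 < T" "0 < \<tau>"
  shows "\<exists>\<sigma>>0. \<sigma> \<le> T \<and> (\<exists>\<phi>. \<phi> \<sigma> \<le> \<tau> \<and> bilipschitz_homeomorphism {0..\<sigma>} {0..\<phi> \<sigma>} \<phi> \<and>
    (\<forall>s\<in>{0..\<sigma>}. y (\<phi> s) = x s))"
proof -
  define n where "n = norm (b - a)"
  have n: "0 < n" using ends_neq[OF ab] by (simp add: n_def)
  \<comment> \<open>Two points within \<open>k\<close> of \<open>x0\<close> are at distance at most
    \<open>2 * k\<close>; with \<open>e = n / 8\<close> the two terms of the closeness condition are
    then at most \<open>n / 2\<close> and \<open>n / 4\<close>.\<close>
  define k where "k = n / (8 * (K + 1))"
  have k: "0 < k" "4 * K * k \<le> n / 2"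
    using n K_nonneg by (auto simp: k_def field_simps)
  have ev: "\<forall>\<^sub>F t in at_right 0. dist (\<gamma> t) x0 < k \<and> \<gamma> t \<in> B \<and>
      (\<exists>q\<in>D (\<gamma> t). dist q a < n / 8) \<and> (\<exists>q\<in>D (\<gamma> t). dist q b < n / 8)"
    if "near_line \<gamma>" "\<gamma> 0 = x0" "near_ends a b \<gamma>" for \<gamma>
  proof -
    have "filterlim \<gamma> (nhds x0) (at_right 0)"
      using narrow_if_tangent[OF near_line_tangent[OF that(1,2)]] narrow_le_nhds order_refl by (rule filterlim_mono)
    then have "\<forall>\<^sub>F t in at_right 0. dist (\<gamma> t) x0 < k" using k(1) by (simp add: tendsto_iff)
    moreover have "0 < n / 8" using n by simp
    with that(3) have "\<forall>\<^sub>F t in at_right 0. \<gamma> t \<in> B \<and>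
        (\<exists>q\<in>D (\<gamma> t). dist q a < n / 8) \<and> (\<exists>q\<in>D (\<gamma> t). dist q b < n / 8)"
      unfolding near_ends_def by blast
    ultimately show ?thesis by (rule eventually_conj)
  qed
  obtain t1 where t1: "0 < t1" and t1x: "\<And>t. 0 < t \<Longrightarrow> t < t1 \<Longrightarrow> dist (x t) x0 < k \<and> x t \<in> B \<and>
      (\<exists>q\<in>D (x t). dist q a < n / 8) \<and> (\<exists>q\<in>D (x t). dist q b < n / 8)"
    using ev[OF line(1) zero(1) near(1)] unfolding eventually_at_right[OF zero_less_one] by meson
  obtain t2 where t2: "0 < t2" and t2y: "\<And>t. 0 < t \<Longrightarrow> t < t2 \<Longrightarrow> dist (y t) x0 < k \<and> y t \<in> B \<and>
      (\<exists>q\<in>D (y t). dist q a < n / 8) \<and> (\<exists>q\<in>D (y t). dist q b < n / 8)"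
    using ev[OF line(2) zero(2) near(2)] unfolding eventually_at_right[OF zero_less_one] by meson
  let ?c = "\<lambda>\<gamma> t. v0 \<bullet> \<gamma> t / (v0 \<bullet> v0)"
  obtain d1 where d1: "0 < d1" "\<And>s t. 0 \<le> s \<Longrightarrow> s \<le> t \<Longrightarrow> t \<le> d1 \<Longrightarrow>
      (t - s) / 2 \<le> ?c x t - ?c x s \<and> ?c x t - ?c x s \<le> 2 * (t - s)"
    using near_line_coordinate[OF line(1)] by metis
  obtain d2 where d2: "0 < d2" "\<And>s t. 0 \<le> s \<Longrightarrow> s \<le> t \<Longrightarrow> t \<le> d2 \<Longrightarrow>
      (t - s) / 2 \<le> ?c y t - ?c y s \<and> ?c y t - ?c y s \<le> 2 * (t - s)"
    using near_line_coordinate[OF line(2)] by metis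
  define d where "d = min (min d1 d2) (min (min (t1 / 2) (t2 / 2)) (min T \<tau>))"
  have d: "0 < d" "d \<le> d1" "d \<le> d2" "d < t1" "d < t2" "d \<le> T" "d \<le> \<tau>"
    using d1(1) d2(1) t1 t2 T by (auto simp: d_def)
  obtain \<sigma> \<phi> where \<sigma>: "0 < \<sigma>" "\<sigma> \<le> d" "\<phi> 0 = 0" "bilipschitz_homeomorphism {0..\<sigma>} {0..\<phi> \<sigma>} \<phi>"
    and \<phi>: "\<And>s. 0 < s \<Longrightarrow> s \<le> \<sigma> \<Longrightarrow> 0 < \<phi> s \<and> \<phi> s \<le> d \<and> ?c y (\<phi> s) - ?c y 0 = ?c x s - ?c x 0"
    using bilipschitz_reparametrisation[of d "\<lambda>t. ?c x t - ?c x 0" "\<lambda>t. ?c y t - ?c y 0"] d d1(2) d2(2)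
    by (smt (verit, ccfv_SIG))
  have "y (\<phi> s) = x s" if s: "s \<in> {0..\<sigma>}" for s
  \<comment> \<open>The information from \<open>near_ends\<close> concerns positive times; at time 0
    both curves are at \<open>x0\<close>.\<close>
  proof (cases "s = 0")
    case False
    then have s: "0 < s" "s < t1" "s \<le> \<sigma>" using s \<sigma> d by auto
    have \<phi>s: "0 < \<phi> s" "\<phi> s < t2" "?c y (\<phi> s) = ?c x s" using \<phi>[OF s(1,3)] d zero by auto
    from t1x[OF s(1,2)] obtain pa pb where p: "dist (x s) x0 < k" "x s \<in> B"
      "pa \<in> D (x s)" "dist pa a < n / 8" "pb \<in> D (x s)" "dist pb b < n / 8" by blast
    from t2y[OF \<phi>s(1,2)] obtain qa qb where q: "dist (y (\<phi> s)) x0 < k" "y (\<phi> s) \<in> B"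
      "qa \<in> D (y (\<phi> s))" "dist qa a < n / 8" "qb \<in> D (y (\<phi> s))" "dist qb b < n / 8" by blast
    show ?thesis
    proof (rule same_coordinate_near_ends_eq[OF ab p(2) q(2) _ _ p(3-6) q(3-6)])
      show "(y (\<phi> s) - x s) \<bullet> v0 = 0"
        unfolding inner_commute[of "y (\<phi> s) - x s" v0] using \<phi>s(3) v0_nonzero by (simp add: inner_diff_right)
      have "norm (y (\<phi> s) - x s) \<le> 2 * k"
        using dist_triangle2[of "y (\<phi> s)" "x s" x0] p(1) q(1) by (simp add: dist_norm)
      then have "2 * K * norm (y (\<phi> s) - x s) \<le> 2 * K * (2 * k)"
        using K_nonneg by (intro mult_left_mono) auto
      then show "2 * K * norm (y (\<phi> s) - x s) + 2 * (n / 8) < norm (b - a)"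
        using k(2) n by (simp add: n_def[symmetric])
    qed
  qed (use \<sigma> zero in simp)
  moreover have "\<phi> \<sigma> \<le> \<tau>" using \<phi>[OF \<sigma>(1)] d by auto
  ultimately show ?thesis using \<sigma> d by (intro exI[of _ \<sigma>]) auto
qed

end


section \<open>Viscosity solutions and superdifferentials\<close>

lemma gradient_eq:
  assumes "GDERIV f x :> D" shows "gradient f x = D"
  unfolding gradient_def
proof (rule the_equality)
  show "GDERIV f x :> D" by (rule assms)
  fix D' assume "GDERIV f x :> D'"
  then have "(\<lambda>h. h \<bullet> D') = (\<lambda>h. h \<bullet> D)"
    using assms has_derivative_unique unfolding gderiv_def by blast
  then have "h \<bullet> D' = h \<bullet> D" for h by (rule fun_cong)
  then have "h \<bullet> (D' - D) = 0" for h by (simp add: inner_diff_right)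
  from this[of "D' - D"] show "D' = D" by simp
qed

lemma GDERIV_quadratic:
  fixes p z w :: "'a::real_inner"
  shows "GDERIV (\<lambda>w. c + p \<bullet> (w - z) + A * (norm (w - z))\<^sup>2) w :> p + (2 * A) *\<^sub>R (w - z)"
  unfolding gderiv_def power2_norm_eq_inner
  by (auto intro!: derivative_eq_intros simp: inner_add_right inner_diff_right inner_commute algebra_simps)

lemma C1_on_quadratic:
  "C1_on S (\<lambda>w. c + p \<bullet> (w - z) + A * (norm (w - z))\<^sup>2)"
  unfolding C1_on_def
proof (intro exI conjI ballI)
  show "GDERIV (\<lambda>w. c + p \<bullet> (w - z) + A * (norm (w - z))\<^sup>2) w :> p + (2 * A) *\<^sub>R (w - z)" for w
    by (rule GDERIV_quadratic)
  show "continuous_on S (\<lambda>w. p + (2 * A) *\<^sub>R (w - z))" by (intro continuous_intros)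
qed

lemma C1_on_imp_continuous_on: "C1_on S f \<Longrightarrow> continuous_on S f"
  unfolding C1_on_def gderiv_def
  by (meson continuous_at_imp_continuous_on has_derivative_continuous)

text \<open>The partial gradient is the second component of the joint one, which yields its
  continuity in both variables together.\<close>

lemma C1_on_partial_gradient:
  fixes H :: "'a::euclidean_space \<Rightarrow> 'a \<Rightarrow> real"
  assumes "C1_on (\<Omega> \<times> UNIV) (\<lambda>(x, p). H x p)"
  shows "\<And>z p. z \<in> \<Omega> \<Longrightarrow> GDERIV (H z) p :> grad_p H z p"
    and "continuous_on (\<Omega> \<times> UNIV) (\<lambda>(z, p). grad_p H z p)"
proof -
  obtain g where g: "\<And>x. x \<in> \<Omega> \<times> UNIV \<Longrightarrow> GDERIV (\<lambda>(x, p). H x p) x :> g x"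
    and gc: "continuous_on (\<Omega> \<times> UNIV) g"
    using assms unfolding C1_on_def by blast
  have 1: "GDERIV (H z) p :> snd (g (z, p))" if "z \<in> \<Omega>" for z p
  proof -
    have "((\<lambda>(x, p). H x p) has_derivative (\<lambda>h. h \<bullet> g (z, p))) (at (z, p))"
      using g[of "(z, p)"] that by (simp add: gderiv_def)
    moreover have "((\<lambda>q. (z, q)) has_derivative (\<lambda>h. (0, h))) (at p)"
      by (auto intro!: derivative_eq_intros)
    ultimately have "(((\<lambda>(x, p). H x p) \<circ> (\<lambda>q. (z, q))) has_derivative ((\<lambda>h. h \<bullet> g (z, p)) \<circ> (\<lambda>h. (0, h)))) (at p)"
      using diff_chain_at by blast
    then show ?thesis by (simp add: gderiv_def o_def inner_prod_def)
  qed
  then have 2: "grad_p H z p = snd (g (z, p))" if "z \<in> \<Omega>" for z p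
    using that unfolding grad_p_def by (intro gradient_eq)
  with 1 show "\<And>z p. z \<in> \<Omega> \<Longrightarrow> GDERIV (H z) p :> grad_p H z p" by simp
  have "continuous_on (\<Omega> \<times> UNIV) (\<lambda>x. snd (g x))" by (intro continuous_intros gc)
  then show "continuous_on (\<Omega> \<times> UNIV) (\<lambda>(z, p). grad_p H z p)"
    by (rule continuous_on_eq) (auto simp: 2)
qed

text \<open>Difference quotients give only the weak tangent inequality, so it is used towards the
  midpoint \<open>m\<close>. There \<open>g \<bullet> (q - p)\<close> is twice
  \<open>g \<bullet> (m - p)\<close>, and strict convexity puts \<open>f m\<close> strictly below
  the mean of \<open>f p\<close> and \<open>f q\<close>.\<close>

lemma strictly_convex_gt_tangent:
  fixes f :: "'a::euclidean_space \<Rightarrow> real"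
  assumes conv: "strictly_convex_on UNIV f" and D: "GDERIV f p :> g" and "p \<noteq> q"
  shows "f p + g \<bullet> (q - p) < f q"
proof -
  have sc: "f (s *\<^sub>R x + t *\<^sub>R y) < s * f x + t * f y" if "0 < s" "0 < t" "s + t = 1" "x \<noteq> y" for s t x y
    using conv that unfolding strictly_convex_on_def by blast
  define m where "m = (1 / 2) *\<^sub>R p + (1 / 2) *\<^sub>R q"
  have "m - p = (1 / 2) *\<^sub>R (q - p)"
    by (simp add: m_def scaleR_diff_right) (simp add: scaleR_half_double[symmetric] algebra_simps flip: scaleR_left_distrib)
  then have mp: "g \<bullet> (q - p) = 2 * (g \<bullet> (m - p))" "m \<noteq> p" using \<open>p \<noteq> q\<close> by auto
  have fm: "f m < f p / 2 + f q / 2" using sc[of "1/2" "1/2" p q] \<open>p \<noteq> q\<close> by (simp add: m_def)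
  have "((\<lambda>t. f (p + t *\<^sub>R (m - p))) has_derivative (\<lambda>t. (t *\<^sub>R (m - p)) \<bullet> g)) (at 0)"
  proof -
    have "(f has_derivative (\<lambda>h. h \<bullet> g)) (at (p + 0 *\<^sub>R (m - p)))" using D by (simp add: gderiv_def)
    moreover have "((\<lambda>t. p + t *\<^sub>R (m - p)) has_derivative (\<lambda>t. t *\<^sub>R (m - p))) (at 0)"
      by (auto intro!: derivative_eq_intros)
    ultimately show ?thesis using has_derivative_compose by blast
  qed
  then have "((\<lambda>t. f (p + t *\<^sub>R (m - p))) has_real_derivative g \<bullet> (m - p)) (at 0)"
    by (simp add: has_field_derivative_def inner_commute mult.commute[of _ "g \<bullet> (m - p)"])
  then have "((\<lambda>t. (f (p + t *\<^sub>R (m - p)) - f p) / t) \<longlongrightarrow> g \<bullet> (m - p)) (at_right 0)"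
    by (auto simp: has_field_derivative_iff intro: filterlim_mono at_le)
  moreover have "\<forall>\<^sub>F t in at_right 0. (f (p + t *\<^sub>R (m - p)) - f p) / t \<le> f m - f p"
  proof -
    have "(f (p + t *\<^sub>R (m - p)) - f p) / t \<le> f m - f p" if "0 < t" "t < 1" for t
    proof -
      have "f ((1 - t) *\<^sub>R p + t *\<^sub>R m) < (1 - t) * f p + t * f m"
        by (rule sc) (use that mp in auto)
      then have "f (p + t *\<^sub>R (m - p)) - f p \<le> t * (f m - f p)" by (simp add: algebra_simps)
      then show ?thesis using that by (simp add: divide_simps mult.commute)
    qed
    then show ?thesis unfolding eventually_at_right[OF zero_less_one] by (intro exI[of _ 1]) auto
  qed
  ultimately have "g \<bullet> (m - p) \<le> f m - f p"
    by (intro tendsto_upperbound) auto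
  with mp(1) fm show ?thesis by simp
qed

lemma AE_lebesgue_on_imp_negligible:
  assumes "AE t in lebesgue_on S. P t" "S \<in> sets lebesgue"
  obtains N where "negligible N" "\<And>t. t \<in> S - N \<Longrightarrow> P t"
proof -
  have "AE t in lebesgue. t \<in> S \<longrightarrow> P t" using assms by (simp add: AE_restrict_space_iff)
  then obtain N where N: "N \<in> null_sets lebesgue" "{t \<in> space lebesgue. \<not> (t \<in> S \<longrightarrow> P t)} \<subseteq> N"
    unfolding eventually_ae_filter by blast
  show ?thesis
  proof (rule that)
    show "negligible N" using N(1) by (simp add: negligible_iff_null_sets)
    show "P t" if "t \<in> S - N" for t using N(2) that by auto
  qed
qed

lemma superdiff_if_quadratic_bound:
  assumes "\<forall>\<^sub>F y in at z within \<Omega>. u y \<le> u z + p \<bullet> (y - z) + c * (norm (y - z))\<^sup>2"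
  shows "p \<in> superdiff \<Omega> u z"
  unfolding superdiff_def mem_Collect_eq Limsup_le_iff
proof (intro allI impI)
  fix e :: ereal assume "0 < e"
  then obtain k where k: "0 < k" "ereal k < e" by (metis ereal_dense2 ereal_less(2) zero_ereal_def ereal_less_eq(3) less_ereal.simps(1))
  have "((\<lambda>y. c * norm (y - z)) \<longlongrightarrow> c * norm (z - z)) (at z within \<Omega>)" by (intro tendsto_intros)
  then have "\<forall>\<^sub>F y in at z within \<Omega>. c * norm (y - z) < k" using k(1) by (intro order_tendstoD(2)) auto
  then show "\<forall>\<^sub>F y in at z within \<Omega>. ereal ((u y - u z - p \<bullet> (y - z)) / norm (y - z)) < e"
    using assms eventually_neq_at_within[of z z \<Omega>]
  proof eventually_elim
    case (elim y)
    have "(u y - u z - p \<bullet> (y - z)) / norm (y - z) \<le> c * norm (y - z)"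
      using elim by (simp add: divide_simps power2_eq_square mult.assoc)
    then have "(u y - u z - p \<bullet> (y - z)) / norm (y - z) < k" using elim(1) by linarith
    then show ?case using k(2) by (metis less_ereal.simps(1) less_trans)
  qed
qed

text \<open>The infinitesimal inequality is used at a point \<open>y\<close> close to
  \<open>z\<close> on the segment to \<open>w\<close>; semiconcavity transports it to
  \<open>w\<close>, and division by the weight \<open>l\<close> leaves the constant
  \<open>C / 2\<close> and an arbitrarily small error.\<close>

lemma superdiff_eq_quad_superdiff:
  fixes u :: "'a::euclidean_space \<Rightarrow> real"
  assumes B: "open B" "convex B" "B \<subseteq> \<Omega>" and z: "z \<in> B"
    and C: "\<And>l x y. l \<in> {0..1} \<Longrightarrow> x \<in> \<Omega> \<Longrightarrow> y \<in> \<Omega> \<Longrightarrow> closed_segment x y \<subseteq> \<Omega> \<Longrightarrow>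
        l * u x + (1 - l) * u y - u (l *\<^sub>R x + (1 - l) *\<^sub>R y) \<le> C / 2 * l * (1 - l) * (norm (x - y))\<^sup>2"
    and C0: "0 < C"
  shows "superdiff \<Omega> u z = quad_superdiff B (C / 2) u z"
proof
  have zB: "\<forall>\<^sub>F y in at z within \<Omega>. y \<in> B"
    using eventually_at_in_open'[OF B(1) z] by (rule filter_leD[OF at_le[OF subset_UNIV]])
  show "quad_superdiff B (C / 2) u z \<subseteq> superdiff \<Omega> u z"
  proof
    fix p assume "p \<in> quad_superdiff B (C / 2) u z"
    then have "u y \<le> u z + p \<bullet> (y - z) + C / 2 * (norm (y - z))\<^sup>2" if "y \<in> B" for y
      using that by (auto simp: quad_superdiff_def)
    with zB show "p \<in> superdiff \<Omega> u z"
      by (intro superdiff_if_quadratic_bound[where c = "C / 2"]) (auto elim: eventually_mono)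
  qed
  show "superdiff \<Omega> u z \<subseteq> quad_superdiff B (C / 2) u z"
    unfolding quad_superdiff_def
  proof (intro subsetI CollectI ballI)
    fix p w assume p: "p \<in> superdiff \<Omega> u z" and w: "w \<in> B"
    show "u w \<le> u z + p \<bullet> (w - z) + C / 2 * (norm (w - z))\<^sup>2"
    proof (cases "w = z")
      case False
      then have n: "0 < norm (w - z)" by simp
      have seg: "closed_segment w z \<subseteq> \<Omega>" using B(2,3) w z by (meson closed_segment_subset order_trans)
      have bound: "u w - u z - p \<bullet> (w - z) - C / 2 * (norm (w - z))\<^sup>2 \<le> e * norm (w - z)" if e: "0 < e" for e
      proof -
        have "\<forall>\<^sub>F y in at z within \<Omega>. ereal ((u y - u z - p \<bullet> (y - z)) / norm (y - z)) < ereal e"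
          using p e unfolding superdiff_def mem_Collect_eq Limsup_le_iff
          by (simp only: ereal_less(2))
        with zB have "\<forall>\<^sub>F y in at z within \<Omega>. (u y - u z - p \<bullet> (y - z)) / norm (y - z) < e" by eventually_elim simp
        then obtain d where d: "0 < d"
          "\<And>y. y \<in> \<Omega> \<Longrightarrow> y \<noteq> z \<Longrightarrow> dist y z < d \<Longrightarrow> (u y - u z - p \<bullet> (y - z)) / norm (y - z) < e"
          unfolding eventually_at by blast
        \<comment> \<open>The second bound brings \<open>y\<close> within \<open>d\<close> of
          \<open>z\<close>; the first keeps \<open>l\<close> a convex weight.\<close>
        define l where "l = min (1 / 2) (d / (2 * norm (w - z)))"
        have l: "0 < l" "l \<le> 1 / 2" "l * norm (w - z) < d"
        proof -
          show "0 < l" "l \<le> 1 / 2" using d n by (auto simp: l_def)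
          have "l \<le> d / (2 * norm (w - z))" by (simp add: l_def)
          then have "l * norm (w - z) \<le> d / (2 * norm (w - z)) * norm (w - z)" using n by (intro mult_right_mono) auto
          also have "\<dots> = d / 2" using n by simp
          finally show "l * norm (w - z) < d" using d(1) by simp
        qed
        define y where "y = l *\<^sub>R w + (1 - l) *\<^sub>R z"
        have yz: "y - z = l *\<^sub>R (w - z)" by (simp add: y_def algebra_simps)
        have "y \<in> closed_segment w z"
          unfolding y_def closed_segment_commute[of w] in_segment using l by (intro exI[of _ l]) (auto simp: add.commute)
        then have "y \<in> \<Omega>" using seg by blast
        moreover have "y \<noteq> z" using yz l(1) n by auto
        moreover have "dist y z < d" using l by (simp add: dist_norm yz)
        ultimately have "(u y - u z - p \<bullet> (y - z)) / norm (y - z) < e" by (rule d(2))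
        then have "u y - u z - p \<bullet> (y - z) < e * norm (y - z)" using \<open>y \<noteq> z\<close> by (simp add: pos_divide_less_eq)
        then have 1: "u y - u z < l * (p \<bullet> (w - z)) + l * (e * norm (w - z))" using l by (simp add: yz mult.left_commute)
        have "l * u w + (1 - l) * u z - u y \<le> C / 2 * l * (1 - l) * (norm (w - z))\<^sup>2"
          unfolding y_def by (rule C) (use l w z B(3) seg in auto)
        also have "\<dots> \<le> C / 2 * l * 1 * (norm (w - z))\<^sup>2"
          using l C0 by (intro mult_right_mono mult_left_mono) auto
        finally have "l * (u w - u z) \<le> l * (p \<bullet> (w - z) + e * norm (w - z) + C / 2 * (norm (w - z))\<^sup>2)"
          using 1 by (simp add: algebra_simps)
        then have "u w - u z \<le> p \<bullet> (w - z) + e * norm (w - z) + C / 2 * (norm (w - z))\<^sup>2"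
          using l(1) by (rule mult_left_le_imp_le)
        then show ?thesis by simp
      qed
      have "(u w - u z - p \<bullet> (w - z) - C / 2 * (norm (w - z))\<^sup>2) / norm (w - z) \<le> 0 + e" if e: "0 < e" for e
        using bound[OF e] n by (subst pos_divide_le_eq) auto
      then have "(u w - u z - p \<bullet> (w - z) - C / 2 * (norm (w - z))\<^sup>2) / norm (w - z) \<le> 0"
        by (rule field_le_epsilon)
      then show ?thesis using n by (simp add: divide_le_0_iff)
    qed simp
  qed
qed

text \<open>The quadratic bound in \<open>quad_superdiff\<close> is itself a smooth test function
  touching \<open>u\<close> from above.\<close>

lemma viscosity_subsolution_superdiff_le:
  assumes sub: "viscosity_subsolution \<Omega> H u" and B: "open B" "B \<subseteq> \<Omega>" and z: "z \<in> B"
    and p: "p \<in> quad_superdiff B K u z"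
  shows "H z p \<le> 0"
proof -
  let ?\<phi> = "\<lambda>w. 0 + p \<bullet> (w - z) + K * (norm (w - z))\<^sup>2"
  have zB: "\<forall>\<^sub>F y in at z within \<Omega>. y \<in> B"
    using eventually_at_in_open'[OF B(1) z] by (rule filter_leD[OF at_le[OF subset_UNIV]])
  have "u y \<le> u z + p \<bullet> (y - z) + K * (norm (y - z))\<^sup>2" if "y \<in> B" for y
    using p that by (auto simp: quad_superdiff_def)
  then have "\<forall>\<^sub>F y in at z within \<Omega>. u y - ?\<phi> y \<le> u z - ?\<phi> z"
    using zB by (force elim: eventually_mono)
  then have "H z (gradient ?\<phi> z) \<le> 0"
    using sub C1_on_quadratic z B(2) unfolding viscosity_subsolution_def by blast
  moreover have "gradient ?\<phi> z = p"
    using gradient_eq[OF GDERIV_quadratic[of 0 p z K z]] by simp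
  ultimately show ?thesis by simp
qed

text \<open>
  Where \<open>u + A |\<cdot> - z|\<^sup>2\<close> has a local minimum, \<open>u\<close> is touched from below by a smooth function;
  being semiconcave, it is then also touched from above with the same slope.
\<close>

lemma viscosity_solution_zero_level_dense:
  fixes u :: "'a::euclidean_space \<Rightarrow> real"
  assumes super: "viscosity_supersolution \<Omega> H u"
    and B: "open B" "convex B" "B \<subseteq> \<Omega>" and z: "z \<in> B" and e: "0 < e"
    and lip: "L-lipschitz_on \<Omega> u"
    and C: "\<And>l x y. l \<in> {0..1} \<Longrightarrow> x \<in> \<Omega> \<Longrightarrow> y \<in> \<Omega> \<Longrightarrow> closed_segment x y \<subseteq> \<Omega> \<Longrightarrow>
        l * u x + (1 - l) * u y - u (l *\<^sub>R x + (1 - l) *\<^sub>R y) \<le> C / 2 * l * (1 - l) * (norm (x - y))\<^sup>2"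
  obtains m p where "m \<in> B" "dist m z < e" "p \<in> superdiff \<Omega> u m" "0 \<le> H m p"
proof -
  from B(1) z obtain r0 where r0: "0 < r0" "ball z r0 \<subseteq> B" by (auto elim: openE)
  define r where "r = min (e / 2) (r0 / 2)"
  have r: "0 < r" "r < e" "cball z r \<subseteq> B" using r0 e by (auto simp: r_def subset_iff)
  \<comment> \<open>On the sphere of radius \<open>r\<close> the penalty is
    \<open>(L + 1) * r\<close>, more than \<open>u\<close> can vary, so the minimiser is
    interior.\<close>
  define A where "A = (L + 1) / r"
  define F where "F w = u w + A * (norm (w - z))\<^sup>2" for w
  have "continuous_on (cball z r) F"
    unfolding F_def using lipschitz_on_continuous_on[OF lip] r(3) B(3)
    by (intro continuous_intros) (auto intro: continuous_on_subset)
  moreover have "cball z r \<noteq> {}" using r(1) by simp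
  ultimately obtain m where m: "m \<in> cball z r" "\<And>w. w \<in> cball z r \<Longrightarrow> F m \<le> F w"
    using continuous_attains_inf[OF compact_cball] by blast
  have mB: "m \<in> B" using m(1) r(3) by blast
  have "norm (m - z) \<noteq> r"
  proof
    assume nr: "norm (m - z) = r"
    have "z \<in> \<Omega>" "m \<in> \<Omega>" using z mB B(3) by auto
    from lipschitz_onD[OF lip this] have "u z - u m \<le> L * r"
      by (simp add: dist_norm norm_minus_commute[of z] nr)
    moreover have "u m + A * r\<^sup>2 \<le> u z" using m(2)[of z] r(1) nr by (simp add: F_def)
    moreover have "A * r\<^sup>2 = (L + 1) * r" using r(1) by (simp add: A_def power2_eq_square)
    ultimately show False using r(1) by (simp add: distrib_right)
  qed
  then have mr: "norm (m - z) < r" using m(1) by (auto simp: dist_norm norm_minus_commute)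
  define d where "d = r - norm (m - z)"
  have d: "0 < d" "\<And>y. dist y m < d \<Longrightarrow> y \<in> cball z r"
  proof -
    show "0 < d" using mr by (simp add: d_def)
    show "y \<in> cball z r" if "dist y m < d" for y
      using that norm_triangle_ineq[of "y - m" "m - z"] by (auto simp: d_def dist_norm norm_minus_commute)
  qed
  let ?\<phi> = "\<lambda>w. 0 + 0 \<bullet> (w - z) + (- A) * (norm (w - z))\<^sup>2"
  define p where "p = - (2 * A) *\<^sub>R (m - z)"
  have below: "u m - p \<bullet> h - A * (norm h)\<^sup>2 \<le> u (m - h)" if "norm h < d" for h
  proof -
    have "F m \<le> F (m - h)" using m(2) d(2)[of "m - h"] that by (simp add: dist_norm)
    then show ?thesis
      by (simp add: F_def p_def power2_norm_eq_inner inner_diff_left inner_diff_right inner_commute algebra_simps)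
  qed
  have "\<forall>\<^sub>F y in at m within \<Omega>. u y - ?\<phi> y \<ge> u m - ?\<phi> m"
    unfolding eventually_at using d m(2) by (intro exI[of _ d]) (auto simp: F_def)
  then have "0 \<le> H m (gradient ?\<phi> m)"
    using super C1_on_quadratic mB B(3) unfolding viscosity_supersolution_def by blast
  then have "0 \<le> H m p"
    using gradient_eq[OF GDERIV_quadratic[of 0 0 z "- A" m]] by (simp add: p_def)
  moreover have "p \<in> superdiff \<Omega> u m"
  proof (rule superdiff_if_quadratic_bound[where c = "A + C"])
    have "u y \<le> u m + p \<bullet> (y - m) + (A + C) * (norm (y - m))\<^sup>2" if y: "dist y m < d" for y
    proof -
      \<comment> \<open>The lower bound at the reflected point \<open>m - h\<close>, combined with
        semiconcavity at the midpoint \<open>m\<close> of \<open>m + h\<close> and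
        \<open>m - h\<close>, becomes an upper bound at \<open>m + h\<close> with constant
        \<open>A + C\<close>.\<close>
      define h where "h = y - m"
      have h: "y = m + h" "norm h < d" using y by (auto simp: h_def dist_norm)
      have inB: "m + h \<in> B" "m - h \<in> B" using d(2)[of "m + h"] d(2)[of "m - h"] h r(3) by (auto simp: dist_norm)
      have seg: "closed_segment (m + h) (m - h) \<subseteq> \<Omega>"
        using closed_segment_subset[OF inB B(2)] B(3) by blast
      have "(1 / 2) *\<^sub>R (m + h) + (1 - 1 / 2) *\<^sub>R (m - h) = m"
        by (simp add: algebra_simps flip: scaleR_left_distrib)
      moreover have "(m + h) - (m - h) = 2 *\<^sub>R h" by (simp add: scaleR_2)
      ultimately have "u (m + h) + u (m - h) - 2 * u m \<le> C * (norm h)\<^sup>2"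
        using C[of "1 / 2" "m + h" "m - h"] subsetD[OF B(3) inB(1)] subsetD[OF B(3) inB(2)] seg
        by (simp add: power_mult_distrib)
      with below[OF h(2)] show ?thesis by (simp add: h algebra_simps)
    qed
    then show "\<forall>\<^sub>F y in at m within \<Omega>. u y \<le> u m + p \<bullet> (y - m) + (A + C) * (norm (y - m))\<^sup>2"
      unfolding eventually_at using d(1) by blast
  qed
  ultimately show ?thesis using that mB mr r(2) by (auto simp: dist_norm)
qed


section \<open>Properties of the two kinds of characteristics and conclusion\<close>

lemma (in hj_singular_point) strict_characteristic_properties:
  assumes ab: "ends a b" and T: "0 < T" and lip: "M-lipschitz_on {0..T} \<gamma>" and B: "\<gamma> ` {0..T} \<subseteq> B"
    and \<gamma>0: "\<gamma> 0 = x0" and N: "negligible N"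
    and der: "\<And>t. t \<in> {0..T} - N \<Longrightarrow> \<exists>q\<in>D (\<gamma> t). (\<gamma> has_vector_derivative G (\<gamma> t) q) (at t within {0..T})"
  shows "near_line \<gamma>" "near_ends a b \<gamma>"
proof -
  have nar: "filterlim \<gamma> narrow (at_right 0)"
    using strict_characteristic_tangent[OF T lip B \<gamma>0 N der] by (rule narrow_if_tangent)
  have hull: "\<exists>v\<in>convex hull (G (\<gamma> t) ` D (\<gamma> t)). (\<gamma> has_vector_derivative v) (at t within {0..T})"
    if "t \<in> {0..T} - N" for t
    using der[OF that] by (auto intro: hull_inc)
  have b: "\<forall>\<^sub>F t in at_right 0. \<exists>q\<in>D (\<gamma> t). dist q b < e" if "0 < e" for e
    by (rule generalized_characteristic_far_end[OF ab T lip B \<gamma>0 N hull nar that])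
  have a: "\<forall>\<^sub>F t in at_right 0. \<exists>q\<in>D (\<gamma> t). dist q a < e" if "0 < e" for e
    by (rule generalized_characteristic_far_end[OF ends_swap[OF ab] T lip B \<gamma>0 N hull nar that])
  show "near_line \<gamma>"
    by (rule strict_characteristic_near_line[OF ab T lip B N der nar a b])
  have "\<forall>\<^sub>F t in at_right 0. \<gamma> t \<in> B" using nar narrow_B unfolding filterlim_iff by blast
  with a b show "near_ends a b \<gamma>" unfolding near_ends_def by (intro allI impI eventually_conj) auto
qed

text \<open>The order of deduction is reversed with respect to strict characteristics:
  \<open>near_line\<close> comes first, from the essential supremum condition, and yields the
  tangency needed for the cone estimates.\<close>

lemma (in hj_singular_point) singular_characteristic_near_ends:
  assumes ab: "ends a b" and T: "0 < T" and lip: "M-lipschitz_on {0..T} \<gamma>" and B: "\<gamma> ` {0..T} \<subseteq> B"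
    and \<gamma>0: "\<gamma> 0 = x0" and N: "negligible N"
    and hull: "\<And>t. t \<in> {0..T} - N \<Longrightarrow> \<exists>v\<in>convex hull (G (\<gamma> t) ` D (\<gamma> t)).
        (\<gamma> has_vector_derivative v) (at t within {0..T})"
    and line: "near_line \<gamma>"
  shows "near_ends a b \<gamma>"
proof -
  have nar: "filterlim \<gamma> narrow (at_right 0)"
    using near_line_tangent[OF line \<gamma>0] by (rule narrow_if_tangent)
  have b: "\<forall>\<^sub>F t in at_right 0. \<exists>q\<in>D (\<gamma> t). dist q b < e" if "0 < e" for e
    by (rule generalized_characteristic_far_end[OF ab T lip B \<gamma>0 N hull nar that])
  have a: "\<forall>\<^sub>F t in at_right 0. \<exists>q\<in>D (\<gamma> t). dist q a < e" if "0 < e" for e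
    by (rule generalized_characteristic_far_end[OF ends_swap[OF ab] T lip B \<gamma>0 N hull nar that])
  have "\<forall>\<^sub>F t in at_right 0. \<gamma> t \<in> B" using nar narrow_B unfolding filterlim_iff by blast
  with a b show "near_ends a b \<gamma>" unfolding near_ends_def by (intro allI impI eventually_conj) auto
qed

lemma curve_stays_in_open:
  fixes \<gamma> :: "real \<Rightarrow> 'a::real_normed_vector"
  assumes "0 < T" "continuous_on {0..T} \<gamma>" "open B" "\<gamma> 0 \<in> B"
  obtains T' where "0 < T'" "T' \<le> T" "\<gamma> ` {0..T'} \<subseteq> B"
proof -
  have "(\<gamma> \<longlongrightarrow> \<gamma> 0) (at 0 within {0..T})" using assms(1,2) by (auto simp: continuous_on)
  then have "\<forall>\<^sub>F t in at 0 within {0..T}. \<gamma> t \<in> B" using assms(3,4) by (rule topological_tendstoD)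
  then obtain d where d: "0 < d" "\<And>t. t \<in> {0..T} \<Longrightarrow> t \<noteq> 0 \<Longrightarrow> dist t 0 < d \<Longrightarrow> \<gamma> t \<in> B"
    unfolding eventually_at by blast
  show ?thesis
  proof (rule that[of "min T (d / 2)"])
    show "\<gamma> ` {0..min T (d / 2)} \<subseteq> B"
    proof
      fix z assume "z \<in> \<gamma> ` {0..min T (d / 2)}"
      then obtain t where t: "0 \<le> t" "t \<le> T" "t \<le> d / 2" "z = \<gamma> t" by auto
      then show "z \<in> B" using d(1) d(2)[of t] assms(4) by (cases "t = 0") (auto simp: dist_real_def)
    qed
  qed (use assms(1) d(1) in auto)
qed

text \<open>Turns the essential supremum condition on the velocity into the two-point estimate of
  \<open>near_line\<close>: a bound on \<open>{0..d}\<close> holds almost everywhere on each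
  subinterval.\<close>

lemma esssup_derivative_near_line:
  fixes y :: "real \<Rightarrow> 'a::euclidean_space"
  assumes \<tau>: "0 < \<tau>" and lip: "M-lipschitz_on {0..\<tau>} y" and N: "negligible N"
    and der: "\<And>s. s \<in> {0..\<tau>} - N \<Longrightarrow> \<exists>v. (y has_vector_derivative v) (at s within {0..\<tau>})"
    and ess: "((\<lambda>t. esssup (lebesgue_on {0..t})
        (\<lambda>s. ereal (norm (vector_derivative y (at s within {0..\<tau>}) - v)))) \<longlongrightarrow> 0) (at_right 0)"
    and e: "0 < e"
  obtains d where "0 < d" "\<And>s t. 0 \<le> s \<Longrightarrow> s \<le> t \<Longrightarrow> t \<le> d \<Longrightarrow> norm (y t - y s - (t - s) *\<^sub>R v) \<le> e * (t - s)"
proof -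
  let ?f = "\<lambda>s. ereal (norm (vector_derivative y (at s within {0..\<tau>}) - v))"
  have "\<forall>\<^sub>F t in at_right 0. esssup (lebesgue_on {0..t}) ?f < ereal e"
    using ess e by (intro order_tendstoD(2)) auto
  then obtain b where b: "0 < b" "\<forall>t>0. t < b \<longrightarrow> esssup (lebesgue_on {0..t}) ?f < ereal e"
    unfolding eventually_at_right[OF zero_less_one] by blast
  define d where "d = min (b / 2) \<tau>"
  have d: "0 < d" "d < b" "d \<le> \<tau>" using b(1) \<tau> by (auto simp: d_def)
  have less: "esssup (lebesgue_on {0..d}) ?f < ereal e" using b d by blast
  have "AE s in lebesgue_on {0..d}. ?f s \<le> esssup (lebesgue_on {0..d}) ?f" by (rule esssup_AE)
  then have "AE s in lebesgue_on {0..d}. norm (vector_derivative y (at s within {0..\<tau>}) - v) \<le> e"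
  proof (rule AE_mp, intro AE_I2 impI)
    fix s assume "?f s \<le> esssup (lebesgue_on {0..d}) ?f"
    then have "?f s < ereal e" using less by (rule le_less_trans)
    then show "norm (vector_derivative y (at s within {0..\<tau>}) - v) \<le> e" by simp
  qed
  then obtain N' where N': "negligible N'"
    "\<And>s. s \<in> {0..d} - N' \<Longrightarrow> norm (vector_derivative y (at s within {0..\<tau>}) - v) \<le> e"
    by (rule AE_lebesgue_on_imp_negligible) auto
  have NN: "negligible (N \<union> N')" using N N'(1) by (rule negligible_Un)
  show ?thesis
  proof (rule that[OF d(1)])
    fix s t assume st: "0 \<le> s" "s \<le> t" "t \<le> d"
    show "norm (y t - y s - (t - s) *\<^sub>R v) \<le> e * (t - s)"
    proof (rule curve_close_to_line[OF _ st(2) NN])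
      show "M-lipschitz_on {s..t} y" using lip by (rule lipschitz_on_subset) (use st d in auto)
      show "{s..t} \<subseteq> {0..\<tau>}" using st d by auto
      fix r assume r: "r \<in> {s<..t} - (N \<union> N')"
      then obtain v' where v': "(y has_vector_derivative v') (at r within {0..\<tau>})" using der[of r] st d by auto
      \<comment> \<open>Outside \<open>N\<close> the derivative exists, so the total function
        \<open>vector_derivative\<close> has its true value there, even at an end point of the
        interval.\<close>
      then have "vector_derivative y (at r within {0..\<tau>}) = v'"
        using r st d \<tau> by (intro vector_derivative_within_closed_interval) auto
      with v' N'(2)[of r] r st show "\<exists>v'. (y has_vector_derivative v') (at r within {0..\<tau>}) \<and> norm (v' - v) \<le> e"
        by (intro exI[of _ v']) auto
    qed
  qed
qed

theorem corollary3p8: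
  fixes \<Omega> :: "(real^2) set"
    and H :: "real^2 \<Rightarrow> real^2 \<Rightarrow> real"
    and u :: "real^2 \<Rightarrow> real"
    and x0 :: "real^2"
    and x y :: "real \<Rightarrow> real^2"
    and T \<tau> :: real
  assumes "open \<Omega>" and "connected \<Omega>" and "bounded \<Omega>"
    and "C1_on (\<Omega> \<times> UNIV) (\<lambda>(x, p). H x p)"
    and "\<And>x. x \<in> \<Omega> \<Longrightarrow> strictly_convex_on UNIV (H x)"
    and "\<exists>L. L-lipschitz_on \<Omega> u"
    and "semiconcave_on \<Omega> u"
    and "viscosity_solution \<Omega> H u"
    and "x0 \<in> Sing \<Omega> u"
    and "strict_singular_characteristic \<Omega> H u x0 T x"
    and "singular_characteristic \<Omega> H u x0 \<tau> y"
    and "\<not> critical_point \<Omega> H u x0"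
  shows "\<exists>\<sigma>>0. \<sigma> \<le> T \<and>
           (\<exists>\<phi>. \<phi> \<sigma> \<le> \<tau> \<and> bilipschitz_homeomorphism {0..\<sigma>} {0..\<phi> \<sigma>} \<phi> \<and>
                (\<forall>s\<in>{0..\<sigma>}. y (\<phi> s) = x s))"
proof -
  obtain L where L: "L-lipschitz_on \<Omega> u" using assms(6) by blast
  obtain C where C0: "0 < C" and C: "\<And>l x y. l \<in> {0..1} \<Longrightarrow> x \<in> \<Omega> \<Longrightarrow> y \<in> \<Omega> \<Longrightarrow> closed_segment x y \<subseteq> \<Omega> \<Longrightarrow>
      l * u x + (1 - l) * u y - u (l *\<^sub>R x + (1 - l) *\<^sub>R y) \<le> C / 2 * l * (1 - l) * (norm (x - y))\<^sup>2"
    using assms(7) unfolding semiconcave_on_def by blast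
  have sub: "viscosity_subsolution \<Omega> H u" and super: "viscosity_supersolution \<Omega> H u"
    using assms(8) by (auto simp: viscosity_solution_def)
  have "x0 \<in> \<Omega>" and sing: "\<not> is_singleton (superdiff \<Omega> u x0)" using assms(9) by (auto simp: Sing_def)
  obtain \<rho> where \<rho>: "0 < \<rho>" "ball x0 \<rho> \<subseteq> \<Omega>" using assms(1) \<open>x0 \<in> \<Omega>\<close> by (auto elim: openE)
  \<comment> \<open>In a ball, segments between points stay inside \<open>\<Omega>\<close>, as the
    semiconcavity inequality demands.\<close>
  define B where "B = ball x0 \<rho>"
  have B: "open B" "convex B" "B \<subseteq> \<Omega>" "x0 \<in> B" using \<rho> by (auto simp: B_def)
  have D_eq: "superdiff \<Omega> u z = quad_superdiff B (C / 2) u z" if "z \<in> B" for z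
    by (rule superdiff_eq_quad_superdiff[OF B(1-3) that C C0])
  have H_le: "H z p \<le> 0" if "z \<in> B" "p \<in> quad_superdiff B (C / 2) u z" for z p
    by (rule viscosity_subsolution_superdiff_le[OF sub B(1,3) that])
  note part = C1_on_partial_gradient[OF assms(4)]
  have T: "0 < T" and "\<exists>M. M-lipschitz_on {0..T} x" and x_start: "x 0 = x0"
    and "\<exists>p. (\<forall>t\<in>{0..T}. p t \<in> superdiff \<Omega> u (x t)) \<and>
        (AE t in lebesgue_on {0..T}. (x has_vector_derivative grad_p H (x t) (p t)) (at t within {0..T}))"
    using assms(10) unfolding strict_singular_characteristic_def by blast+
  then obtain M p where M: "M-lipschitz_on {0..T} x" and p: "\<And>t. t \<in> {0..T} \<Longrightarrow> p t \<in> superdiff \<Omega> u (x t)"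
    and "AE t in lebesgue_on {0..T}. (x has_vector_derivative grad_p H (x t) (p t)) (at t within {0..T})" by blast
  then obtain N where N: "negligible N"
    "\<And>t. t \<in> {0..T} - N \<Longrightarrow> (x has_vector_derivative grad_p H (x t) (p t)) (at t within {0..T})"
    by (rule_tac AE_lebesgue_on_imp_negligible) auto
  have \<tau>: "0 < \<tau>" and "\<exists>M. M-lipschitz_on {0..\<tau>} y" and y_start: "y 0 = x0"
    and AEy: "AE s in lebesgue_on {0..\<tau>}. \<exists>v \<in> convex hull (grad_p H (y s) ` superdiff \<Omega> u (y s)).
          (y has_vector_derivative v) (at s within {0..\<tau>})"
    and "\<exists>p0. is_arg_min (H x0) (\<lambda>p. p \<in> superdiff \<Omega> u x0) p0 \<and>
        ((\<lambda>t. esssup (lebesgue_on {0..t})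
                (\<lambda>s. ereal (norm (vector_derivative y (at s within {0..\<tau>}) - grad_p H x0 p0))))
           \<longlongrightarrow> 0) (at_right 0)"
    using assms(11) unfolding singular_characteristic_def by blast+
  then obtain M' p0 where M': "M'-lipschitz_on {0..\<tau>} y"
    and p0: "is_arg_min (H x0) (\<lambda>p. p \<in> superdiff \<Omega> u x0) p0"
    and ess: "((\<lambda>t. esssup (lebesgue_on {0..t})
                (\<lambda>s. ereal (norm (vector_derivative y (at s within {0..\<tau>}) - grad_p H x0 p0))))
           \<longlongrightarrow> 0) (at_right 0)" by blast
  obtain N' where N': "negligible N'"
    "\<And>s. s \<in> {0..\<tau>} - N' \<Longrightarrow> \<exists>v \<in> convex hull (grad_p H (y s) ` superdiff \<Omega> u (y s)).
          (y has_vector_derivative v) (at s within {0..\<tau>})"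
    using AEy by (rule AE_lebesgue_on_imp_negligible) auto
  interpret hj_singular_point B "C / 2" L u H "grad_p H" x0 p0
  proof
    show "L-lipschitz_on B u" using L B(3) by (rule lipschitz_on_subset)
    show "\<exists>m\<in>B. dist m z < e \<and> (\<exists>p\<in>quad_superdiff B (C / 2) u m. H m p = 0)"
      if "z \<in> B" "0 < e" for z e
    proof -
      obtain m p where m: "m \<in> B" "dist m z < e" "p \<in> superdiff \<Omega> u m" "0 \<le> H m p"
        by (rule viscosity_solution_zero_level_dense[OF super B(1-3) \<open>z \<in> B\<close> \<open>0 < e\<close> L C])
      \<comment> \<open>The supersolution property gave \<open>0 \<le> H m p\<close>; the
        subsolution property gives the reverse inequality.\<close>
      then show ?thesis using H_le[of m p] D_eq[of m] by force
    qed
    show "continuous_on (B \<times> UNIV) (\<lambda>(z, p). H z p)"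
      using C1_on_imp_continuous_on[OF assms(4)] by (rule continuous_on_subset) (use B(3) in auto)
    show "continuous_on (B \<times> UNIV) (\<lambda>(z, p). grad_p H z p)"
      using part(2) by (rule continuous_on_subset) (use B(3) in auto)
    show "H z p + grad_p H z p \<bullet> (q - p) < H z q" if "z \<in> B" "p \<noteq> q" for z p q
      by (rule strictly_convex_gt_tangent[OF assms(5) part(1) that(2)]) (use that(1) B(3) in auto)
    show "p0 \<in> quad_superdiff B (C / 2) u x0"
      using p0 D_eq[OF B(4)] by (simp add: is_arg_min_def)
    show "H x0 p0 \<le> H x0 p" if "p \<in> quad_superdiff B (C / 2) u x0" for p
      using p0 D_eq[OF B(4)] that by (auto simp: is_arg_min_def not_less)
    show "quad_superdiff B (C / 2) u x0 \<noteq> {p0}"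
      using sing D_eq[OF B(4)] by (auto simp: is_singleton_def)
    show "grad_p H x0 p0 \<noteq> 0"
    proof
      assume "grad_p H x0 p0 = 0"
      then have "critical_point \<Omega> H u x0"
        using p0 unfolding critical_point_def is_arg_min_def by (metis imageI)
      with assms(12) show False by blast
    qed
  qed (use B C0 H_le in auto)
  obtain a b where ab: "ends a b" using ends_exist .
  obtain T' where T': "0 < T'" "T' \<le> T" "x ` {0..T'} \<subseteq> B"
    using curve_stays_in_open[OF T lipschitz_on_continuous_on[OF M] B(1)] x_start B(4) by metis
  have subT: "{0..T'} \<subseteq> {0..T}" using T' by auto
  have derx: "\<exists>q\<in>D (x t). (x has_vector_derivative grad_p H (x t) q) (at t within {0..T'})"
    if t: "t \<in> {0..T'} - N" for t
  proof
    have "x t \<in> B" using t T'(3) by auto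
    from D_eq[OF this] show "p t \<in> D (x t)" using p[of t] t subT by auto
    show "(x has_vector_derivative grad_p H (x t) (p t)) (at t within {0..T'})"
      using N(2)[of t] t subT by (auto intro: has_vector_derivative_within_subset)
  qed
  note x_props = strict_characteristic_properties[OF ab T'(1) lipschitz_on_subset[OF M subT] T'(3) x_start N(1) derx]
  obtain \<tau>' where \<tau>': "0 < \<tau>'" "\<tau>' \<le> \<tau>" "y ` {0..\<tau>'} \<subseteq> B"
    using curve_stays_in_open[OF \<tau> lipschitz_on_continuous_on[OF M'] B(1)] y_start B(4) by metis
  have sub\<tau>: "{0..\<tau>'} \<subseteq> {0..\<tau>}" using \<tau>' by auto
  have dery: "\<exists>v\<in>convex hull (grad_p H (y t) ` D (y t)). (y has_vector_derivative v) (at t within {0..\<tau>'})"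
    if t: "t \<in> {0..\<tau>'} - N'" for t
  proof -
    have "y t \<in> B" using t \<tau>'(3) by auto
    obtain v where "v \<in> convex hull (grad_p H (y t) ` D (y t))" "(y has_vector_derivative v) (at t within {0..\<tau>})"
      using N'(2)[of t] t sub\<tau> D_eq[OF \<open>y t \<in> B\<close>] by auto
    then show ?thesis using has_vector_derivative_within_subset[OF _ sub\<tau>] by blast
  qed
  have y_line: "near_line y"
    unfolding near_line_def
  proof (intro allI impI)
    fix e :: real assume "0 < e"
    obtain d where "0 < d" "\<And>s t. 0 \<le> s \<Longrightarrow> s \<le> t \<Longrightarrow> t \<le> d \<Longrightarrow>
        norm (y t - y s - (t - s) *\<^sub>R grad_p H x0 p0) \<le> e * (t - s)"
      using N'(2) by (rule_tac esssup_derivative_near_line[OF \<tau> M' N'(1) _ ess \<open>0 < e\<close>]) blast+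
    then show "\<exists>d>0. \<forall>s t. 0 \<le> s \<and> s \<le> t \<and> t \<le> d \<longrightarrow> norm (y t - y s - (t - s) *\<^sub>R v0) \<le> e * (t - s)"
      unfolding v0_def by (intro exI[of _ d]) auto
  qed
  have y_ends: "near_ends a b y"
    by (rule singular_characteristic_near_ends[OF ab \<tau>'(1) lipschitz_on_subset[OF M' sub\<tau>] \<tau>'(3) y_start N'(1) dery y_line])
  show ?thesis
    \<comment> \<open>The properties collected for the two curves concern small times only, so the
      original \<open>T\<close> and \<open>\<tau>\<close> may take the place of \<open>T'\<close>
      and \<open>\<tau>'\<close>.\<close>
    by (rule near_line_curves_reparametrisation[OF ab x_props(1) y_line x_start y_start x_props(2) y_ends T \<tau>])
qed

end
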